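(* Let $\mathcal E$ be a complex separable Hilbert space, let $m\geqslant2$ and let $\pmb\mu=(\mu_1,\ldots,\mu_{m-1})$ be an $(m-1)$-tuple of $\mathcal B(\mathcal E)$-valued semi-spectral measures on the unit circle $\mathbb T$. Then the multiplication operator $M_z$ on $\mathcal H_{\pmb\mu}(\mathcal E)$, $(M_zf)(z)=zf(z)$, is a bounded, analytic $m$-isometry.
   Context: $\mathbb D$ is the open unit disc, $dA$ its normalized Lebesgue area measure, and $\mathcal O(\mathbb D,\mathcal E)$ the space of $\mathcal E$-valued holomorphic functions on $\mathbb D$. A $\mathcal B(\mathcal E)$-valued semi-spectral measure on $\mathbb T$ is a finitely additive set function $\mu$ from the Borel $\sigma$-algebra of $\mathbb T$ into the positive operators in $\mathcal B(\mathcal E)$ such that $\mu_{x,y}(\cdot):=\langle\mu(\cdot)x,y\rangle$ is a regular complex Borel measure for all $x,y\in\mathcal E$. Its Poisson integral is $P_\mu(z)=\int_{\mathbb T}\frac{1-|z|^2}{|z-\zeta|^2}d\mu(\zeta)$, $z\in\mathbb D$. For $n\ge1$ and $f\in\mathcal O(\mathbb D,\mathcal E)$, $$D_{\mu,n}(f):=\frac1{n!(n-1)!}\int_{\mathbb D}\langle P_\mu(z)f^{(n)}(z),f^{(n)}(z)\rangle(1-|z|^2)^{n-1}dA(z),$$ and $\mathcal H_{\mu,n}(\mathcal E):=\{f\in\mathcal O(\mathbb D,\mathcal E):D_{\mu,n}(f)<\infty\}$. $H^2(\mathcal E)$ is the Hardy space of functions $\sum_{j\ge0}a_jz^j$, $a_j\in\mathcal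 E$, with $\|f\|^2_{H^2(\mathcal E)}=\sum_j\|a_j\|^2<\infty$. $\mathcal H_{\pmb\mu}(\mathcal E):=\bigcap_{j=1}^{m-1}\mathcal H_{\mu_j,j}(\mathcal E)\cap H^2(\mathcal E)$, a Hilbert space with norm $\|f\|^2_{\pmb\mu}=\|f\|^2_{H^2(\mathcal E)}+\sum_{j=1}^{m-1}D_{\mu_j,j}(f)$. A bounded operator $T$ on a Hilbert space $\mathcal H$ is an $m$-isometry if $\sum_{j=0}^m\binom mj(-1)^{m-j}{T^*}^jT^j=0$, and analytic if $\bigcap_{n\ge0}T^n(\mathcal H)=\{0\}$. *)

theory Defs
  imports "HOL-Analysis.Analysis" "HOL-Library.Function_Algebras"
begin

section \<open>Complex vector spaces and complex Hilbert spaces\<close>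

class complex_vector = ab_group_add +
  fixes scaleC :: "complex \<Rightarrow> 'a \<Rightarrow> 'a"  (infixr "*\<^sub>C" 75)
  assumes scaleC_add_right: "a *\<^sub>C (x + y) = a *\<^sub>C x + a *\<^sub>C y"
    and scaleC_add_left: "(a + b) *\<^sub>C x = a *\<^sub>C x + b *\<^sub>C x"
    and scaleC_scaleC: "a *\<^sub>C (b *\<^sub>C x) = (a * b) *\<^sub>C x"
    and scaleC_one: "1 *\<^sub>C x = x"

text \<open>The inner product is linear in its first argument.\<close>

class chilbert_space = complex_vector + banach +
  fixes cinner :: "'a \<Rightarrow> 'a \<Rightarrow> complex"
  assumes scaleR_scaleC: "r *\<^sub>R x = complex_of_real r *\<^sub>C x"
    and cinner_commute: "cinner x y = cnj (cinner y x)"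
    and cinner_add_left: "cinner (x + y) z = cinner x z + cinner y z"
    and cinner_scaleC_left: "cinner (a *\<^sub>C x) y = a * cinner x y"
    and norm_eq_sqrt_cinner: "norm x = sqrt (Re (cinner x x))"

instantiation "fun" :: (type, complex_vector) complex_vector
begin

definition scaleC_fun :: "complex \<Rightarrow> ('a \<Rightarrow> 'b) \<Rightarrow> 'a \<Rightarrow> 'b"
  where "scaleC_fun a f = (\<lambda>x. a *\<^sub>C f x)"

instance
  by standard
    (simp_all add: scaleC_fun_def fun_eq_iff scaleC_add_right scaleC_add_left
      scaleC_scaleC scaleC_one)

end

text \<open>
  Function spaces such as the ones below depend on parameters, so they are treated as carrier
  sets \<open>H\<close> inside a complex vector space, with an inner product \<open>ip\<close> that is only meaningful on \<open>H\<close>.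
\<close>

definition ip_norm :: "('v \<Rightarrow> 'v \<Rightarrow> complex) \<Rightarrow> 'v \<Rightarrow> real"
  where "ip_norm ip x = sqrt (Re (ip x x))"

locale complex_hilbert_space =
  fixes H :: "'v::complex_vector set" and ip :: "'v \<Rightarrow> 'v \<Rightarrow> complex"
  assumes zero_mem: "0 \<in> H"
    and add_mem: "\<lbrakk>x \<in> H; y \<in> H\<rbrakk> \<Longrightarrow> x + y \<in> H"
    and scale_mem: "x \<in> H \<Longrightarrow> a *\<^sub>C x \<in> H"
    and ip_commute: "\<lbrakk>x \<in> H; y \<in> H\<rbrakk> \<Longrightarrow> ip x y = cnj (ip y x)"
    and ip_add_left: "\<lbrakk>x \<in> H; y \<in> H; z \<in> H\<rbrakk> \<Longrightarrow> ip (x + y) z = ip x z + ip y z"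
    and ip_scale_left: "\<lbrakk>x \<in> H; y \<in> H\<rbrakk> \<Longrightarrow> ip (a *\<^sub>C x) y = a * ip x y"
    and ip_nonneg: "x \<in> H \<Longrightarrow> 0 \<le> Re (ip x x)"
    and ip_definite: "\<lbrakk>x \<in> H; ip x x = 0\<rbrakk> \<Longrightarrow> x = 0"
    and ip_complete:
      "\<lbrakk>\<forall>n. X n \<in> H; \<forall>e>0. \<exists>N. \<forall>k\<ge>N. \<forall>l\<ge>N. ip_norm ip (X k - X l) < e\<rbrakk>
        \<Longrightarrow> \<exists>L\<in>H. (\<lambda>n. ip_norm ip (X n - L)) \<longlonglongrightarrow> 0"

definition bounded_operator ::
    "'v::complex_vector set \<Rightarrow> ('v \<Rightarrow> 'v \<Rightarrow> complex) \<Rightarrow> ('v \<Rightarrow> 'v) \<Rightarrow> bool"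
  where "bounded_operator H ip T \<longleftrightarrow>
    (\<forall>x\<in>H. T x \<in> H) \<and>
    (\<forall>x\<in>H. \<forall>y\<in>H. T (x + y) = T x + T y) \<and>
    (\<forall>a. \<forall>x\<in>H. T (a *\<^sub>C x) = a *\<^sub>C T x) \<and>
    (\<exists>K. \<forall>x\<in>H. ip_norm ip (T x) \<le> K * ip_norm ip x)"

definition hilbert_adjoint ::
    "'v::complex_vector set \<Rightarrow> ('v \<Rightarrow> 'v \<Rightarrow> complex) \<Rightarrow> ('v \<Rightarrow> 'v) \<Rightarrow> 'v \<Rightarrow> 'v"
  where "hilbert_adjoint H ip T y = (THE w. w \<in> H \<and> (\<forall>x\<in>H. ip (T x) y = ip x w))"

definition m_isometry ::
    "'v::complex_vector set \<Rightarrow> ('v \<Rightarrow> 'v \<Rightarrow> complex) \<Rightarrow> nat \<Rightarrow> ('v \<Rightarrow> 'v) \<Rightarrow> bool"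
  where "m_isometry H ip m T \<longleftrightarrow>
    complex_hilbert_space H ip \<and> bounded_operator H ip T \<and>
    (\<forall>x\<in>H. (\<Sum>j\<le>m. (of_nat (m choose j) * (-1) ^ (m - j)) *\<^sub>C
                     ((hilbert_adjoint H ip T ^^ j) ((T ^^ j) x))) = 0)"

definition analytic_operator :: "'v::complex_vector set \<Rightarrow> ('v \<Rightarrow> 'v) \<Rightarrow> bool"
  where "analytic_operator H T \<longleftrightarrow> (\<Inter>n. (T ^^ n) ` H) = {0}"


section \<open>Complex Borel measures on the unit circle\<close>

abbreviation circle :: "complex set"
  where "circle \<equiv> sphere 0 1"

definition circle_sets :: "complex set set"
  where "circle_sets = sets (restrict_space borel circle)"

definition complex_borel_measure :: "(complex set \<Rightarrow> complex) \<Rightarrow> bool"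
  where "complex_borel_measure \<nu> \<longleftrightarrow>
    (\<forall>A :: nat \<Rightarrow> complex set. range A \<subseteq> circle_sets \<and> disjoint_family A
       \<longrightarrow> (\<lambda>i. \<nu> (A i)) sums \<nu> (\<Union>i. A i))"

definition total_variation :: "(complex set \<Rightarrow> complex) \<Rightarrow> complex set \<Rightarrow> ennreal"
  where "total_variation \<nu> B =
    (SUP A \<in> {A :: nat \<Rightarrow> complex set.
                range A \<subseteq> circle_sets \<and> disjoint_family A \<and> (\<Union>i. A i) = B}.
       \<Sum>i. ennreal (cmod (\<nu> (A i))))"

definition regular_measure :: "(complex set \<Rightarrow> complex) \<Rightarrow> bool"
  where "regular_measure \<nu> \<longleftrightarrow>
    (\<forall>B\<in>circle_sets.
       total_variation \<nu> B =
         (INF U \<in> {U. openin (top_of_set circle) U \<and> B \<subseteq> U}. total_variation \<nu> U) \<and>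
       total_variation \<nu> B =
         (SUP K \<in> {K. compact K \<and> K \<subseteq> B}. total_variation \<nu> K))"

text \<open>
  Integration against a complex measure: its real and imaginary parts are split by the Jordan
  decomposition, where the positive variation of a real measure \<open>\<nu>\<close> is
  \<open>B \<mapsto> sup {\<nu> A | A \<subseteq> B Borel}\<close> (\<open>ennreal\<close> sends negative values to \<open>0\<close>, which does not
  matter as \<open>A = {}\<close> is allowed), and the negative variation is the positive one of \<open>-\<nu>\<close>.
\<close>

definition positive_variation :: "(complex set \<Rightarrow> real) \<Rightarrow> complex measure"
  where "positive_variation \<nu> =
    measure_of circle circle_sets
      (\<lambda>B. SUP A \<in> {A \<in> circle_sets. A \<subseteq> B}. ennreal (\<nu> A))"

definition signed_integral :: "(complex set \<Rightarrow> real) \<Rightarrow> (complex \<Rightarrow> real) \<Rightarrow> real"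
  where "signed_integral \<nu> g =
    (LINT \<zeta>|positive_variation \<nu>. g \<zeta>) - (LINT \<zeta>|positive_variation (\<lambda>A. - \<nu> A). g \<zeta>)"

definition complex_measure_integral ::
    "(complex set \<Rightarrow> complex) \<Rightarrow> (complex \<Rightarrow> real) \<Rightarrow> complex"
  where "complex_measure_integral \<nu> g =
    Complex (signed_integral (\<lambda>A. Re (\<nu> A)) g) (signed_integral (\<lambda>A. Im (\<nu> A)) g)"


section \<open>Semi-spectral measures and Poisson integrals\<close>

definition positive_operator :: "('e::chilbert_space \<Rightarrow> 'e) \<Rightarrow> bool"
  where "positive_operator T \<longleftrightarrow>
    bounded_operator UNIV cinner T \<and> (\<forall>x. cinner (T x) x \<in> \<real>\<^sub>\<ge>\<^sub>0)"

definition semi_spectral_measure :: "(complex set \<Rightarrow> 'e::chilbert_space \<Rightarrow> 'e) \<Rightarrow> bool"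
  where "semi_spectral_measure \<mu> \<longleftrightarrow>
    (\<forall>A\<in>circle_sets. positive_operator (\<mu> A)) \<and>
    (\<forall>A\<in>circle_sets. \<forall>B\<in>circle_sets. A \<inter> B = {} \<longrightarrow> \<mu> (A \<union> B) = \<mu> A + \<mu> B) \<and>
    (\<forall>x y. complex_borel_measure (\<lambda>A. cinner (\<mu> A x) y) \<and>
           regular_measure (\<lambda>A. cinner (\<mu> A x) y))"

text \<open>The operator-valued Poisson integral is understood in the weak sense.\<close>

definition poisson_integral ::
    "(complex set \<Rightarrow> 'e::chilbert_space \<Rightarrow> 'e) \<Rightarrow> complex \<Rightarrow> 'e \<Rightarrow> 'e"
  where "poisson_integral \<mu> z =
    (THE P. bounded_operator UNIV cinner P \<and>
       (\<forall>x y. cinner (P x) y =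
          complex_measure_integral (\<lambda>A. cinner (\<mu> A x) y)
            (\<lambda>\<zeta>. (1 - (cmod z)\<^sup>2) / (cmod (z - \<zeta>))\<^sup>2)))"


section \<open>Spaces of vector-valued holomorphic functions on the unit disc\<close>

abbreviation disc :: "complex set"
  where "disc \<equiv> ball 0 1"

definition has_cderiv :: "(complex \<Rightarrow> 'e::chilbert_space) \<Rightarrow> 'e \<Rightarrow> complex \<Rightarrow> bool"
  where "has_cderiv f d z \<longleftrightarrow> (f has_derivative (\<lambda>h. h *\<^sub>C d)) (at z)"

definition cderiv :: "(complex \<Rightarrow> 'e::chilbert_space) \<Rightarrow> complex \<Rightarrow> 'e"
  where "cderiv f z = (THE d. has_cderiv f d z)"

text \<open>
  Functions on the disc are represented by functions on \<open>complex\<close> that vanish off the disc, so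
  that equality of functions on the disc is equality in HOL.
\<close>

definition holomorphic_disc :: "(complex \<Rightarrow> 'e::chilbert_space) set"
  where "holomorphic_disc =
    {f. (\<forall>z\<in>disc. \<exists>d. has_cderiv f d z) \<and> (\<forall>z. z \<notin> disc \<longrightarrow> f z = 0)}"

text \<open>\<open>uniform_measure lborel disc\<close> is normalized area measure on the disc.\<close>

definition dirichlet_integral ::
    "(complex set \<Rightarrow> 'e::chilbert_space \<Rightarrow> 'e) \<Rightarrow> nat \<Rightarrow> (complex \<Rightarrow> 'e) \<Rightarrow> ennreal"
  where "dirichlet_integral \<mu> n f =
    ennreal (1 / (fact n * fact (n - 1))) *
    (\<integral>\<^sup>+ z. ennreal (Re (cinner (poisson_integral \<mu> z ((cderiv ^^ n) f z)) ((cderiv ^^ n) f z))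
                * (1 - (cmod z)\<^sup>2) ^ (n - 1))
       \<partial>uniform_measure lborel disc)"

definition dirichlet_space ::
    "(complex set \<Rightarrow> 'e::chilbert_space \<Rightarrow> 'e) \<Rightarrow> nat \<Rightarrow> (complex \<Rightarrow> 'e) set"
  where "dirichlet_space \<mu> n = {f \<in> holomorphic_disc. dirichlet_integral \<mu> n f < \<infinity>}"

definition is_power_series :: "(complex \<Rightarrow> 'e::chilbert_space) \<Rightarrow> (nat \<Rightarrow> 'e) \<Rightarrow> bool"
  where "is_power_series f a \<longleftrightarrow> (\<forall>z\<in>disc. (\<lambda>j. z ^ j *\<^sub>C a j) sums f z)"

definition hardy_space :: "(complex \<Rightarrow> 'e::chilbert_space) set"
  where "hardy_space =
    {f \<in> holomorphic_disc. \<exists>a. is_power_series f a \<and> summable (\<lambda>j. (norm (a j))\<^sup>2)}"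

definition hardy_norm_sq :: "(complex \<Rightarrow> 'e::chilbert_space) \<Rightarrow> real"
  where "hardy_norm_sq f = (\<Sum>j. (norm ((THE a. is_power_series f a) j))\<^sup>2)"

text \<open>The tuple of measures is indexed by \<open>{1..m-1}\<close>; other values of \<open>\<mu>\<close> are irrelevant.\<close>

definition hmu_space ::
    "nat \<Rightarrow> (nat \<Rightarrow> complex set \<Rightarrow> 'e::chilbert_space \<Rightarrow> 'e) \<Rightarrow> (complex \<Rightarrow> 'e) set"
  where "hmu_space m \<mu> = (\<Inter>j\<in>{1..m-1}. dirichlet_space (\<mu> j) j) \<inter> hardy_space"

definition hmu_norm_sq ::
    "nat \<Rightarrow> (nat \<Rightarrow> complex set \<Rightarrow> 'e::chilbert_space \<Rightarrow> 'e) \<Rightarrow> (complex \<Rightarrow> 'e) \<Rightarrow> real"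
  where "hmu_norm_sq m \<mu> f =
    hardy_norm_sq f + (\<Sum>j=1..m-1. enn2real (dirichlet_integral (\<mu> j) j f))"

text \<open>The inner product is recovered from the norm by polarization.\<close>

definition hmu_inner ::
    "nat \<Rightarrow> (nat \<Rightarrow> complex set \<Rightarrow> 'e::chilbert_space \<Rightarrow> 'e) \<Rightarrow>
      (complex \<Rightarrow> 'e) \<Rightarrow> (complex \<Rightarrow> 'e) \<Rightarrow> complex"
  where "hmu_inner m \<mu> f g =
    (\<Sum>k<4. \<i> ^ k * complex_of_real (hmu_norm_sq m \<mu> (f + \<i> ^ k *\<^sub>C g))) / 4"

definition mult_z :: "(complex \<Rightarrow> 'e::chilbert_space) \<Rightarrow> complex \<Rightarrow> 'e"
  where "mult_z f = (\<lambda>z. z *\<^sub>C f z)"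

end

theory Submission
  imports Defs
begin

text \<open>
  Everything is read off from Taylor coefficients.  Put \<open>c\<^sub>d(x, y) = \<integral> \<zeta>\<^sup>d d\<langle>\<mu>(\<zeta>)x, y\<rangle>\<close>.  In the
  Fourier expansion of the Poisson kernel only one term survives integration against
  \<open>z\<^sup>i cnj z\<^sup>j\<close> and a radial weight.  Replacing the weight \<open>(1 - |z|\<^sup>2)\<^sup>n\<^sup>-\<^sup>1\<close> of the Dirichlet
  integral by \<open>(t - |z|\<^sup>2)\<^sub>+\<^sup>n\<^sup>-\<^sup>1\<close> with \<open>t < 1\<close> therefore gives, for \<open>f = \<Sum> a\<^sub>j z\<^sup>j\<close>,

    \<open>D\<^sub>n(t, f) = \<Sum>\<^sub>i\<^sub>,\<^sub>j (min i j choose n) t\<^bsup>max i j\<^esup> c\<^sub>i\<^sub>-\<^sub>j(a\<^sub>i, a\<^sub>j)\<close>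

  (\<open>dform_eq_integral\<close>).  The integral shows that \<open>D\<^sub>n(t, f)\<close> is nonnegative and increases to
  \<open>D\<^sub>\<mu>\<^sub>,\<^sub>n(f)\<close> as \<open>t\<close> tends to 1 (\<open>dirichlet_integral_psum\<close>).  The series also makes sense for
  \<open>n = 0\<close>, where it is the mean of \<open>\<langle>P\<^sub>\<mu> f, f\<rangle>\<close> over the circle \<open>|z|\<^sup>2 = t\<close>, and it is nonnegative
  there too (\<open>dquad_0_nonneg\<close>).

  Multiplication by \<open>z\<close> shifts the coefficients, so Pascal's rule gives
  \<open>D\<^sub>n(t, zf) = t (D\<^sub>n(t, f) + D\<^sub>n\<^sub>-\<^sub>1(t, f))\<close> and \<open>D\<^sub>0(t, zf) = t D\<^sub>0(t, f)\<close>.  Applying this to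
  \<open>f = a\<^sub>0 + z g\<close> shows by induction on \<open>n\<close> that \<open>D\<^sub>n\<^sub>-\<^sub>1(t, f)\<close> is bounded by a constant times
  \<open>D\<^sub>n(t, f) + \<parallel>f\<parallel>\<^sup>2\<close>, uniformly in \<open>t\<close> (\<open>dquad_le_Suc\<close>).  Hence, if \<open>D\<^sub>\<mu>\<^sub>,\<^sub>n(f)\<close> is finite, all the limits
  \<open>D\<^sub>k(f)\<close> with \<open>k \<le> n\<close> exist and satisfy \<open>D\<^sub>k(zf) = D\<^sub>k(f) + D\<^sub>k\<^sub>-\<^sub>1(f)\<close> and \<open>D\<^sub>0(zf) = D\<^sub>0(f)\<close>.

  Boundedness of multiplication by \<open>z\<close> is immediate from these two facts.  They also say that
  \<open>s \<mapsto> D\<^sub>n(z\<^sup>s f)\<close> is a polynomial of degree at most \<open>n\<close>, so for \<open>n < m\<close> its differences of order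
  \<open>m\<close> vanish (\<open>dlim_difference_eq_0\<close>); the Hardy norm of \<open>z\<^sup>s f\<close> is constant in \<open>s\<close>.  After
  polarisation this is the defining identity of an \<open>m\<close>-isometry.  A function in the range of
  every power of the operator has only zero Taylor coefficients, which is analyticity.

  The same forms with \<open>t < 1\<close> give the Hilbert space structure: they are sesquilinear, so their
  limit is (\<open>truncated_tendsto\<close>), and they are continuous in the Hardy norm, which yields
  completeness (\<open>dlim_limit\<close>).
\<close>

section \<open>Complex inner product spaces\<close>

lemma scaleC_zero_left [simp]: "(0::complex) *\<^sub>C x = 0"
proof -
  have "(0::complex) *\<^sub>C x + 0 *\<^sub>C x = 0 *\<^sub>C x + 0"
    by (simp flip: scaleC_add_left)
  then show ?thesis by simp
qed

lemma scaleC_zero_right [simp]: "a *\<^sub>C (0::'a::complex_vector) = 0"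
proof -
  have "a *\<^sub>C (0::'a) + a *\<^sub>C 0 = a *\<^sub>C 0 + 0"
    by (simp flip: scaleC_add_right)
  then show ?thesis by simp
qed

lemma scaleC_minus_left: "(- a) *\<^sub>C x = - (a *\<^sub>C (x::'a::complex_vector))"
proof -
  have "(- a) *\<^sub>C x + a *\<^sub>C x = 0"
    by (simp flip: scaleC_add_left)
  then show ?thesis by (simp add: eq_neg_iff_add_eq_0)
qed

lemma scaleC_minus_right: "a *\<^sub>C (- x) = - (a *\<^sub>C (x::'a::complex_vector))"
proof -
  have "a *\<^sub>C (- x) + a *\<^sub>C x = 0"
    by (simp flip: scaleC_add_right)
  then show ?thesis by (simp add: eq_neg_iff_add_eq_0)
qed

lemma scaleC_diff_right: "a *\<^sub>C (x - y) = a *\<^sub>C x - a *\<^sub>C (y::'a::complex_vector)"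
  using scaleC_add_right[of a x "- y"] by (simp add: scaleC_minus_right)

lemma scaleC_sum_right: "a *\<^sub>C (\<Sum>i\<in>I. f i) = (\<Sum>i\<in>I. a *\<^sub>C (f i :: 'a::complex_vector))"
  by (induction I rule: infinite_finite_induct) (simp_all add: scaleC_add_right)

declare scaleC_one [simp]

context complex_hilbert_space
begin

lemma uminus_mem: "x \<in> H \<Longrightarrow> - x \<in> H"
  using scale_mem[of x "-1"] by (simp add: scaleC_minus_left)

lemma diff_mem: "x \<in> H \<Longrightarrow> y \<in> H \<Longrightarrow> x - y \<in> H"
  using add_mem[of x "- y"] uminus_mem by simp

lemma sum_mem: "(\<And>i. i \<in> I \<Longrightarrow> f i \<in> H) \<Longrightarrow> (\<Sum>i\<in>I. f i) \<in> H"
  by (induction I rule: infinite_finite_induct) (simp_all add: zero_mem add_mem)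

lemma ip_add_right: "\<lbrakk>x \<in> H; y \<in> H; z \<in> H\<rbrakk> \<Longrightarrow> ip x (y + z) = ip x y + ip x z"
  by (metis add_mem complex_cnj_add ip_add_left ip_commute)

lemma ip_scale_right: "\<lbrakk>x \<in> H; y \<in> H\<rbrakk> \<Longrightarrow> ip x (a *\<^sub>C y) = cnj a * ip x y"
  by (metis complex_cnj_mult ip_commute ip_scale_left scale_mem)

lemma ip_minus_left: "\<lbrakk>x \<in> H; y \<in> H\<rbrakk> \<Longrightarrow> ip (- x) y = - ip x y"
  using ip_scale_left[of x y "-1"] by (simp add: scaleC_minus_left)

lemma ip_minus_right: "\<lbrakk>x \<in> H; y \<in> H\<rbrakk> \<Longrightarrow> ip x (- y) = - ip x y"
  using ip_scale_right[of x y "-1"] by (simp add: scaleC_minus_left)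

lemma ip_diff_left: "\<lbrakk>x \<in> H; y \<in> H; z \<in> H\<rbrakk> \<Longrightarrow> ip (x - y) z = ip x z - ip y z"
  using ip_add_left[of x "- y" z] by (simp add: uminus_mem ip_minus_left)

lemma ip_diff_right: "\<lbrakk>x \<in> H; y \<in> H; z \<in> H\<rbrakk> \<Longrightarrow> ip x (y - z) = ip x y - ip x z"
  using ip_add_right[of x y "- z"] by (simp add: uminus_mem ip_minus_right)

lemma ip_zero_left: "y \<in> H \<Longrightarrow> ip 0 y = 0"
  using ip_scale_left[of 0 y 0] by (simp add: zero_mem)

lemma ip_sum_left:
  "y \<in> H \<Longrightarrow> (\<And>i. i \<in> I \<Longrightarrow> f i \<in> H) \<Longrightarrow> ip (\<Sum>i\<in>I. f i) y = (\<Sum>i\<in>I. ip (f i) y)"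
  by (induction I rule: infinite_finite_induct) (simp_all add: ip_zero_left ip_add_left sum_mem)

lemma ip_norm_sq: "x \<in> H \<Longrightarrow> (ip_norm ip x)\<^sup>2 = Re (ip x x)"
  by (simp add: ip_norm_def ip_nonneg)

lemma ip_norm_nonneg: "x \<in> H \<Longrightarrow> 0 \<le> ip_norm ip x"
  by (simp add: ip_norm_def ip_nonneg)

lemma ip_self: "x \<in> H \<Longrightarrow> ip x x = of_real ((ip_norm ip x)\<^sup>2)"
  by (metis Reals_cnj_iff ip_commute ip_norm_sq of_real_Re)

lemmas ip_simps = ip_add_left ip_add_right ip_scale_left ip_scale_right ip_diff_left
  ip_diff_right add_mem diff_mem scale_mem

lemma cauchy_schwarz:
  assumes x: "x \<in> H" and y: "y \<in> H"
  shows "cmod (ip x y) \<le> ip_norm ip x * ip_norm ip y"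
proof (cases "ip_norm ip y = 0")
  case True
  then have "y = 0" using ip_self[OF y] ip_definite[OF y] by simp
  then have "ip x y = 0" using ip_scale_right[of x 0 0] x zero_mem by simp
  then show ?thesis using x y by (simp add: ip_norm_nonneg)
next
  case False
  define q where "q = (ip_norm ip y)\<^sup>2"
  have q: "q > 0" using False by (simp add: q_def)
  have yy: "ip y y = of_real q" using ip_self[OF y] by (simp add: q_def)
  have yx: "ip y x = cnj (ip x y)" by (rule ip_commute[OF y x])
  define b where "b = ip x y"
  \<comment> \<open>\<open>c *\<^sub>C y\<close> is the projection of \<open>x\<close> to the line through \<open>y\<close>.\<close>
  define c where "c = b / of_real q"
  have "ip (x - c *\<^sub>C y) (x - c *\<^sub>C y)
      = ip x x - cnj c * b - c * cnj b + c * cnj c * of_real q"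
    using x y by (simp add: ip_simps yy yx b_def algebra_simps)
  also have "\<dots> = ip x x - of_real ((cmod b)\<^sup>2 / q)"
    using q complex_norm_square[of b] by (simp add: c_def field_simps)
  finally have "0 \<le> Re (ip x x) - (cmod b)\<^sup>2 / q"
    using ip_nonneg[of "x - c *\<^sub>C y"] x y by (simp add: diff_mem scale_mem)
  then have "(cmod b)\<^sup>2 \<le> (ip_norm ip x * ip_norm ip y)\<^sup>2"
    using q by (simp add: pos_divide_le_eq power_mult_distrib ip_norm_sq[OF x] q_def)
  then show ?thesis
    unfolding b_def by (rule power2_le_imp_le) (simp add: ip_norm_nonneg x y)
qed

text \<open>The Riesz representation theorem.  The representing vector is the minimiser of
  \<open>x \<mapsto> \<parallel>x\<parallel>\<^sup>2 - 2 Re (\<phi> x)\<close>: by the parallelogram law a minimising sequence is Cauchy, and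
  the first variation along \<open>v\<close> of this functional is \<open>2 Re (ip x v - \<phi> v)\<close>.\<close>

lemma riesz_representation:
  assumes add: "\<And>x y. x \<in> H \<Longrightarrow> y \<in> H \<Longrightarrow> \<phi> (x + y) = \<phi> x + \<phi> y"
    and scale: "\<And>a x. x \<in> H \<Longrightarrow> \<phi> (a *\<^sub>C x) = a * \<phi> x"
    and bound: "\<And>x. x \<in> H \<Longrightarrow> cmod (\<phi> x) \<le> K * ip_norm ip x"
  obtains w where "w \<in> H" "\<And>x. x \<in> H \<Longrightarrow> \<phi> x = ip x w"
proof -
  define J where "J x = Re (ip x x) - 2 * Re (\<phi> x)" for x
  have J_lower: "- (K\<^sup>2) \<le> J x" if "x \<in> H" for x
  proof -
    have "Re (\<phi> x) \<le> K * ip_norm ip x"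
      using bound[OF that] complex_Re_le_cmod order_trans by blast
    moreover have "0 \<le> (ip_norm ip x - K)\<^sup>2" by simp
    ultimately show ?thesis
      unfolding J_def ip_norm_sq[OF that, symmetric] by (simp add: power2_eq_square algebra_simps)
  qed
  define d where "d = Inf (J ` H)"
  have bdd: "bdd_below (J ` H)" using J_lower by (auto simp: bdd_below_def)
  have ne: "J ` H \<noteq> {}" using zero_mem by auto
  have d_le: "d \<le> J x" if "x \<in> H" for x
    unfolding d_def using that bdd by (auto intro: cInf_lower)
  have "\<exists>x\<in>H. J x < d + 1 / Suc n" for n
    using cInf_lessD[OF ne, of "d + 1 / Suc n"] by (auto simp: d_def)
  then obtain X where X: "\<And>n. X n \<in> H" and JX: "\<And>n. J (X n) < d + 1 / Suc n" by metis
  have "\<exists>N. \<forall>k\<ge>N. \<forall>l\<ge>N. ip_norm ip (X k - X l) < e" if e: "e > 0" for e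
  proof -
    obtain N :: nat where N: "4 / e\<^sup>2 < real N" using reals_Archimedean2 by blast
    have "ip_norm ip (X k - X l) < e" if kl: "k \<ge> N" "l \<ge> N" for k l
    proof -
      let ?m = "(1/2) *\<^sub>C (X k + X l)"
      have m: "?m \<in> H" using X by (simp add: add_mem scale_mem)
      have lk: "ip (X l) (X k) = cnj (ip (X k) (X l))" by (rule ip_commute[OF X X])
      have "Re (ip (X k - X l) (X k - X l)) = 2 * (J (X k) + J (X l) - 2 * J ?m)"
        using X by (simp add: J_def ip_simps add scale lk algebra_simps)
      also have "\<dots> \<le> 2 * (J (X k) + J (X l) - 2 * d)" using d_le[OF m] by simp
      also have "\<dots> < 2 * (1 / Suc k + 1 / Suc l)" using JX[of k] JX[of l] by simp
      also have "\<dots> \<le> 2 * (1 / Suc N + 1 / Suc N)"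
        using kl by (intro mult_left_mono add_mono divide_left_mono) auto
      also have "\<dots> = 4 / Suc N" by simp
      also have "\<dots> < e\<^sup>2"
      proof -
        have "4 < e\<^sup>2 * real N" using N e by (simp add: field_simps)
        also have "\<dots> \<le> e\<^sup>2 * real (Suc N)" by (intro mult_left_mono) auto
        finally show ?thesis by (simp add: field_simps)
      qed
      finally have "(ip_norm ip (X k - X l))\<^sup>2 < e\<^sup>2"
        using X by (simp add: ip_norm_sq diff_mem)
      then show ?thesis using e power2_less_imp_less by fastforce
    qed
    then show ?thesis by blast
  qed
  then obtain w where w: "w \<in> H" and lim: "(\<lambda>n. ip_norm ip (X n - w)) \<longlonglongrightarrow> 0"
    using ip_complete[of X] X by blast
  have re: "Re (ip v w) = Re (\<phi> v)" if v: "v \<in> H" for v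
  proof -
    define A where "A n = Re (ip v (X n)) - Re (\<phi> v)" for n
    define q where "q = Re (ip v v)"
    have var: "0 \<le> 1 / Suc n + 2 * s * A n + s\<^sup>2 * q" for s n
    proof -
      have vx: "ip (X n) v = cnj (ip v (X n))" by (rule ip_commute[OF X v])
      have "J (X n + complex_of_real s *\<^sub>C v) = J (X n) + 2 * s * A n + s\<^sup>2 * q"
        using X v by (simp add: J_def A_def q_def ip_simps add scale vx power2_eq_square algebra_simps)
      moreover have "d \<le> J (X n + complex_of_real s *\<^sub>C v)"
        using X v by (intro d_le) (simp add: add_mem scale_mem)
      ultimately show ?thesis using JX[of n] by linarith
    qed
    have "(A n)\<^sup>2 \<le> (q + 1) / Suc n" for n
    proof -
      have q: "q \<ge> 0" unfolding q_def by (rule ip_nonneg[OF v])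
      \<comment> \<open>The step \<open>- A n / q\<close> would be optimal; \<open>q + 1\<close> covers the case \<open>q = 0\<close>.\<close>
      have "0 \<le> 1 / Suc n + 2 * (- A n / (q + 1)) * A n + (- A n / (q + 1))\<^sup>2 * q"
        by (rule var)
      also have "\<dots> \<le> 1 / Suc n + 2 * (- A n / (q + 1)) * A n + (- A n / (q + 1))\<^sup>2 * (q + 1)"
        by (intro add_left_mono mult_left_mono) auto
      also have "(- A n / (q + 1))\<^sup>2 * (q + 1) = (A n)\<^sup>2 / (q + 1)"
        using q by (simp add: power_divide power2_eq_square)
      finally have "(A n)\<^sup>2 / (q + 1) \<le> 1 / Suc n"
        by (simp add: power2_eq_square)
      then show ?thesis using q by (simp add: pos_divide_le_eq mult.commute)
    qed
    moreover have "(\<lambda>n. (q + 1) / Suc n) \<longlonglongrightarrow> 0"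
      using LIMSEQ_Suc[OF lim_const_over_n[of "q + 1"]] by simp
    ultimately have "(\<lambda>n. (A n)\<^sup>2) \<longlonglongrightarrow> 0"
      by (intro tendsto_sandwich[of "\<lambda>_. 0" "\<lambda>n. (A n)\<^sup>2" sequentially "\<lambda>n. (q + 1) / Suc n"])
        (auto simp: eventually_sequentially)
    then have "(\<lambda>n. \<bar>A n\<bar>) \<longlonglongrightarrow> 0" using tendsto_real_sqrt[of "\<lambda>n. (A n)\<^sup>2" 0] by simp
    then have A0: "A \<longlonglongrightarrow> 0" by (rule tendsto_rabs_zero_cancel)
    have "(\<lambda>n. ip_norm ip v * ip_norm ip (X n - w)) \<longlonglongrightarrow> 0"
      using tendsto_mult_right_zero[OF lim] by simp
    then have "(\<lambda>n. ip v (X n - w)) \<longlonglongrightarrow> 0"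
      by (rule Lim_null_comparison[rotated])
        (use cauchy_schwarz v X w in \<open>simp add: diff_mem\<close>)
    then have "(\<lambda>n. Re (ip v (X n - w))) \<longlonglongrightarrow> 0"
      using tendsto_Re[of "\<lambda>n. ip v (X n - w)" 0] by simp
    then have "(\<lambda>n. A n - Re (ip v (X n - w))) \<longlonglongrightarrow> 0"
      using tendsto_diff[OF A0, of "\<lambda>n. Re (ip v (X n - w))" 0] by simp
    moreover have "A n - Re (ip v (X n - w)) = Re (ip v w) - Re (\<phi> v)" for n
      using v X w by (simp add: A_def ip_diff_right)
    ultimately show ?thesis by (simp add: LIMSEQ_const_iff)
  qed
  have "\<phi> v = ip v w" if v: "v \<in> H" for v
  proof (rule complex_eqI)
    show "Re (\<phi> v) = Re (ip v w)" using re[OF v] by simp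
    have "Re (ip ((-\<i>) *\<^sub>C v) w) = Re (\<phi> ((-\<i>) *\<^sub>C v))"
      by (rule re) (simp add: v scale_mem)
    then show "Im (\<phi> v) = Im (ip v w)" by (simp only: ip_scale_left[OF v w] scale[OF v]) simp
  qed
  with w that show ?thesis by blast
qed

lemma eq_if_ip_eq:
  assumes "u \<in> H" "v \<in> H" "\<And>x. x \<in> H \<Longrightarrow> ip x u = ip x v"
  shows "u = v"
proof -
  have "ip (u - v) (u - v) = 0"
    using assms by (simp add: ip_diff_right diff_mem)
  then show ?thesis using ip_definite[of "u - v"] assms by (simp add: diff_mem)
qed

lemma adjoint:
  assumes T: "bounded_operator H ip T" and y: "y \<in> H"
  shows "hilbert_adjoint H ip T y \<in> H"
    and "x \<in> H \<Longrightarrow> ip (T x) y = ip x (hilbert_adjoint H ip T y)"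
proof -
  obtain K where K: "\<And>x. x \<in> H \<Longrightarrow> ip_norm ip (T x) \<le> K * ip_norm ip x"
    and mem: "\<And>x. x \<in> H \<Longrightarrow> T x \<in> H"
    and add: "\<And>x y. x \<in> H \<Longrightarrow> y \<in> H \<Longrightarrow> T (x + y) = T x + T y"
    and scale: "\<And>a x. x \<in> H \<Longrightarrow> T (a *\<^sub>C x) = a *\<^sub>C T x"
    using T unfolding bounded_operator_def by blast
  have bound: "cmod (ip (T x) y) \<le> (K * ip_norm ip y) * ip_norm ip x" if "x \<in> H" for x
  proof -
    have "cmod (ip (T x) y) \<le> ip_norm ip (T x) * ip_norm ip y"
      using cauchy_schwarz mem y that by blast
    also have "\<dots> \<le> (K * ip_norm ip x) * ip_norm ip y"
      using K[OF that] y by (intro mult_right_mono) (simp_all add: ip_norm_nonneg)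
    finally show ?thesis by (simp add: mult_ac)
  qed
  obtain w where w: "w \<in> H" "\<And>x. x \<in> H \<Longrightarrow> ip (T x) y = ip x w"
  proof (rule riesz_representation[of "\<lambda>x. ip (T x) y" "K * ip_norm ip y"])
    show "ip (T (x + x')) y = ip (T x) y + ip (T x') y" if "x \<in> H" "x' \<in> H" for x x'
      using that by (simp add: add mem y ip_add_left)
    show "ip (T (a *\<^sub>C x)) y = a * ip (T x) y" if "x \<in> H" for a x
      using that by (simp add: scale mem y ip_scale_left)
  qed (use bound in blast)+
  have "hilbert_adjoint H ip T y = w"
    unfolding hilbert_adjoint_def
  proof (rule the_equality)
    fix u assume u: "u \<in> H \<and> (\<forall>x\<in>H. ip (T x) y = ip x u)"
    show "u = w"
    proof (rule eq_if_ip_eq)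
      show "ip x u = ip x w" if "x \<in> H" for x using u w(2)[OF that] that by metis
    qed (use u w in auto)
  qed (use w in blast)
  with w show "hilbert_adjoint H ip T y \<in> H"
    and "x \<in> H \<Longrightarrow> ip (T x) y = ip x (hilbert_adjoint H ip T y)"
    by simp_all
qed

text \<open>The defining operator identity of an \<open>m\<close>-isometry only has to be tested in the
  quadratic-form sense, because \<open>\<langle>T*\<^sup>jT\<^sup>jx, y\<rangle> = \<langle>T\<^sup>jx, T\<^sup>jy\<rangle>\<close>.\<close>

lemma m_isometryI:
  assumes T: "bounded_operator H ip T"
    and sum0: "\<And>x y. x \<in> H \<Longrightarrow> y \<in> H \<Longrightarrow>
      (\<Sum>j\<le>m. (of_nat (m choose j) * (-1) ^ (m - j)) * ip ((T ^^ j) x) ((T ^^ j) y)) = 0"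
  shows "m_isometry H ip m T"
proof -
  let ?A = "hilbert_adjoint H ip T"
  have mem: "T x \<in> H" if "x \<in> H" for x using T that by (auto simp: bounded_operator_def)
  have Tn: "(T ^^ j) x \<in> H" if "x \<in> H" for x j
    using that by (induction j) (auto intro: mem)
  have An: "(?A ^^ j) x \<in> H" if "x \<in> H" for x j
    using that by (induction j) (auto intro: adjoint(1)[OF T])
  have adj: "ip ((T ^^ j) x) y = ip x ((?A ^^ j) y)" if "x \<in> H" "y \<in> H" for x y j
    using that
  proof (induction j arbitrary: y)
    case (Suc j)
    have "ip ((T ^^ Suc j) x) y = ip ((T ^^ j) x) (?A y)"
      using Suc.prems by (simp add: adjoint(2)[OF T] Tn)
    also have "\<dots> = ip x ((?A ^^ j) (?A y))"
      using Suc by (intro Suc.IH) (auto intro: adjoint(1)[OF T])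
    finally show ?case by (simp add: funpow_Suc_right del: funpow.simps)
  qed simp
  have "(\<Sum>j\<le>m. (of_nat (m choose j) * (-1) ^ (m - j)) *\<^sub>C ((?A ^^ j) ((T ^^ j) x))) = 0"
    (is "?s = 0") if x: "x \<in> H" for x
  proof (rule ip_definite)
    have terms: "(of_nat (m choose j) * (-1) ^ (m - j)) *\<^sub>C ((?A ^^ j) ((T ^^ j) x)) \<in> H" for j
      using x by (intro scale_mem An Tn)
    then show s: "?s \<in> H" by (intro sum_mem) auto
    have swap: "ip ((?A ^^ j) ((T ^^ j) x)) ?s = ip ((T ^^ j) x) ((T ^^ j) ?s)" for j
    proof -
      have "ip ((?A ^^ j) ((T ^^ j) x)) ?s = cnj (ip ?s ((?A ^^ j) ((T ^^ j) x)))"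
        by (rule ip_commute[OF An[OF Tn[OF x]] s])
      also have "\<dots> = cnj (ip ((T ^^ j) ?s) ((T ^^ j) x))"
        by (simp only: adj[OF s Tn[OF x]])
      also have "\<dots> = ip ((T ^^ j) x) ((T ^^ j) ?s)"
        by (rule ip_commute[OF Tn[OF x] Tn[OF s], symmetric])
      finally show ?thesis .
    qed
    have "ip ?s ?s = (\<Sum>j\<le>m. (of_nat (m choose j) * (-1) ^ (m - j))
        * ip ((?A ^^ j) ((T ^^ j) x)) ?s)"
      using x by (subst ip_sum_left[OF s terms])
        (intro sum.cong refl ip_scale_left s An Tn)
    also have "\<dots> = 0" unfolding swap by (rule sum0[OF x s])
    finally show "ip ?s ?s = 0" .
  qed
  with T complex_hilbert_space_axioms show ?thesis
    unfolding m_isometry_def by blast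
qed

end

section \<open>The coefficient Hilbert space\<close>

lemma cnj_cinner: "cnj (cinner x y) = cinner y (x::'e::chilbert_space)"
  using cinner_commute[of y x] by simp

lemma cinner_self_real: "cinner x x = of_real ((norm (x::'e::chilbert_space))\<^sup>2)"
proof -
  have "0 \<le> norm x" by simp
  then have "0 \<le> Re (cinner x x)" unfolding norm_eq_sqrt_cinner by simp
  then have "Re (cinner x x) = (norm x)\<^sup>2"
    unfolding norm_eq_sqrt_cinner by simp
  moreover have "Im (cinner x x) = 0"
    using arg_cong[OF cnj_cinner[of x x], of Im] by simp
  ultimately show ?thesis by (simp add: complex_eq_iff)
qed

lemma ip_norm_cinner: "ip_norm cinner = (norm :: 'e::chilbert_space \<Rightarrow> real)"
  by (simp add: ip_norm_def norm_eq_sqrt_cinner fun_eq_iff)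

lemma complex_hilbert_space_UNIV:
  "complex_hilbert_space (UNIV :: 'e::chilbert_space set) cinner"
proof
  fix X :: "nat \<Rightarrow> 'e"
  assume "\<forall>e>0. \<exists>N. \<forall>k\<ge>N. \<forall>l\<ge>N. ip_norm cinner (X k - X l) < e"
  then have "Cauchy X" unfolding ip_norm_cinner Cauchy_def dist_norm by blast
  then obtain L where "X \<longlonglongrightarrow> L" using Cauchy_convergent convergent_def by blast
  then have "(\<lambda>n. norm (X n - L)) \<longlonglongrightarrow> 0"
    using Lim_null tendsto_norm_zero_iff by metis
  then show "\<exists>L\<in>UNIV. (\<lambda>n. ip_norm cinner (X n - L)) \<longlonglongrightarrow> 0"
    by (auto simp: ip_norm_cinner)
qed (auto simp: cinner_add_left cinner_scaleC_left cinner_self_real cnj_cinner)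

interpretation E: complex_hilbert_space "UNIV :: 'e::chilbert_space set" cinner
  by (rule complex_hilbert_space_UNIV)

lemma norm_scaleC [simp]: "norm (a *\<^sub>C x) = cmod a * norm (x::'e::chilbert_space)"
proof -
  have "complex_of_real ((norm (a *\<^sub>C x))\<^sup>2) = (a * cnj a) * of_real ((norm x)\<^sup>2)"
    unfolding cinner_self_real[symmetric] by (simp add: cinner_scaleC_left E.ip_scale_right)
  also have "\<dots> = of_real ((cmod a * norm x)\<^sup>2)"
    unfolding complex_norm_square[symmetric] by (simp add: power_mult_distrib)
  finally have "(norm (a *\<^sub>C x))\<^sup>2 = (cmod a * norm x)\<^sup>2"
    by (simp only: of_real_eq_iff)
  then show ?thesis by (simp add: power2_eq_iff_nonneg)
qed

lemma cmod_cinner_le: "cmod (cinner x y) \<le> norm x * norm (y::'e::chilbert_space)"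
  using E.cauchy_schwarz[of x y] by (simp add: ip_norm_cinner)

lemma bounded_bilinear_scaleC:
  "bounded_bilinear (\<lambda>a x. a *\<^sub>C (x::'e::chilbert_space))"
proof
  fix a b r and x y :: 'e
  show "\<exists>K. \<forall>a x. norm (a *\<^sub>C (x::'e)) \<le> norm a * norm x * K"
    by (intro exI[of _ 1]) auto
qed (simp_all add: scaleC_add_left scaleC_add_right scaleR_scaleC scaleC_scaleC scaleR_conv_of_real mult.commute)

lemma eq_if_cinner_eq: "(\<And>y. cinner u y = cinner v y) \<Longrightarrow> u = (v::'e::chilbert_space)"
  by (rule E.eq_if_ip_eq) (simp_all add: cinner_commute[of _ u] cinner_commute[of _ v])

lemma sum_lessThan_4:
  "(\<Sum>k<4. f k) = f 0 + f 1 + f 2 + f (3::nat)" for f :: "nat \<Rightarrow> 'a::comm_monoid_add"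
  by (simp add: eval_nat_numeral add.assoc)

lemma i_power3: "\<i> ^ 3 = - \<i>"
  by (simp add: eval_nat_numeral)

definition sesquilinear :: "('v::complex_vector \<Rightarrow> 'v \<Rightarrow> complex) \<Rightarrow> bool" where
  "sesquilinear B \<longleftrightarrow>
    (\<forall>x y z. B (x + y) z = B x z + B y z) \<and> (\<forall>x y z. B x (y + z) = B x y + B x z) \<and>
    (\<forall>a x y. B (a *\<^sub>C x) y = a * B x y) \<and> (\<forall>a x y. B x (a *\<^sub>C y) = cnj a * B x y)"

lemma polarization:
  assumes "sesquilinear B"
  shows "(\<Sum>k<4. \<i> ^ k * B (x + \<i> ^ k *\<^sub>C y) (x + \<i> ^ k *\<^sub>C y)) / 4 = B x y"
proof -
  have "B (x + c *\<^sub>C y) (x + c *\<^sub>C y) = B x x + cnj c * B x y + c * B y x + c * cnj c * B y y" for c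
    using assms by (simp add: sesquilinear_def algebra_simps)
  then show ?thesis
    unfolding sum_lessThan_4 by (simp only:) (simp add: i_power3 algebra_simps)
qed

lemma sesquilinear_cinner_comp:
  assumes "bounded_operator UNIV cinner T"
  shows "sesquilinear (\<lambda>x y. cinner (T x) y)"
  using assms by (simp add: bounded_operator_def sesquilinear_def cinner_add_left cinner_scaleC_left
      E.ip_add_right E.ip_scale_right)

section \<open>Finite measures on the circle and integrals against complex measures\<close>

lemma circle_sets_Pow: "circle_sets \<subseteq> Pow circle"
  unfolding circle_sets_def by (auto simp: sets_restrict_space)

lemma sigma_algebra_circle_sets: "sigma_algebra circle circle_sets"
  unfolding circle_sets_def using sets.sigma_algebra_axioms[of "restrict_space borel circle"]
  by (simp add: space_restrict_space)

lemma circle_in_circle_sets: "circle \<in> circle_sets"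
  by (rule algebra.top[OF sigma_algebra.axioms(1)[OF sigma_algebra_circle_sets]])

lemma sets_measure_of_circle [simp]: "sets (measure_of circle circle_sets f) = circle_sets"
  by (simp add: circle_sets_Pow sigma_algebra.sigma_sets_eq[OF sigma_algebra_circle_sets])

lemma space_measure_of_circle [simp]: "space (measure_of circle circle_sets f) = circle"
  by (simp add: circle_sets_Pow space_measure_of)

lemma space_eq_circle: "sets M = circle_sets \<Longrightarrow> space M = circle"
  using sets_eq_imp_space_eq[of M "measure_of circle circle_sets (\<lambda>_. 0)"] by simp

lemma borel_measurable_circle:
  "f \<in> borel_measurable borel \<Longrightarrow> sets M = circle_sets \<Longrightarrow> f \<in> borel_measurable M"
  unfolding circle_sets_def by (metis measurable_cong_sets measurable_restrict_space1)

text \<open>Identifies the values of measures that are introduced through \<open>measure_of\<close>, namely the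
  measures \<open>A \<mapsto> \<langle>\<mu>(A)x, x\<rangle>\<close> and the positive variations of real measures.\<close>

lemma measure_measure_of_circle:
  assumes nonneg: "\<And>A. A \<in> circle_sets \<Longrightarrow> 0 \<le> f A"
    and cadd: "\<And>A :: nat \<Rightarrow> complex set. range A \<subseteq> circle_sets \<Longrightarrow> disjoint_family A \<Longrightarrow>
      (\<lambda>i. f (A i)) sums f (\<Union>i. A i)"
    and eq: "\<And>A. A \<in> circle_sets \<Longrightarrow> g A = ennreal (f A)"
  shows "finite_measure (measure_of circle circle_sets g)"
    and "A \<in> circle_sets \<Longrightarrow> measure (measure_of circle circle_sets g) A = f A"
proof -
  interpret sigma_algebra circle circle_sets by (rule sigma_algebra_circle_sets)
  let ?M = "measure_of circle circle_sets g"
  have empty: "f {} = 0"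
  proof -
    have "(\<lambda>i::nat. f {}) sums f (\<Union>i::nat. {})"
      by (rule cadd) (auto simp: disjoint_family_on_def)
    then have "summable (\<lambda>i::nat. f {})" by (rule sums_summable)
    then show ?thesis by (simp add: summable_const_iff)
  qed
  have em: "emeasure ?M A = ennreal (f A)" if A: "A \<in> circle_sets" for A
  proof -
    have "emeasure ?M A = g A"
    proof (rule emeasure_measure_of[OF refl circle_sets_Pow])
      show "positive (sets ?M) g"
        by (simp add: positive_def eq empty)
      show "countably_additive (sets ?M) g"
        unfolding countably_additive_def sets_measure_of_circle
      proof (intro allI impI)
        fix A :: "nat \<Rightarrow> complex set"
        assume A: "range A \<subseteq> circle_sets" and d: "disjoint_family A" and U: "\<Union> (range A) \<in> circle_sets"
        have Ai: "A i \<in> circle_sets" for i using A by auto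
        have "(\<lambda>i. ennreal (f (A i))) sums ennreal (f (\<Union>i. A i))"
          using cadd[OF A d] nonneg Ai U by simp
        then show "(\<Sum>i. g (A i)) = g (\<Union> (range A))"
          using Ai U by (simp add: eq sums_iff)
      qed
    qed (use A in simp)
    then show ?thesis using eq[OF A] by simp
  qed
  show "finite_measure ?M"
    by (rule finite_measureI) (simp add: em)
  show "A \<in> circle_sets \<Longrightarrow> measure ?M A = f A"
    by (simp add: measure_def em nonneg)
qed

text \<open>A linear relation between finitely many finite measures passes to integrals of bounded
  functions, since it does so for simple functions.  The linear identities between integrals
  against the measures \<open>\<langle>\<mu>(\<cdot>)x, y\<rangle>\<close> below are instances of this.\<close>

lemma integral_linear_relation:
  fixes \<alpha> :: "'i \<Rightarrow> complex" and M :: "'i \<Rightarrow> 'a measure" and g :: "'a \<Rightarrow> complex"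
  assumes I: "finite I" and fin: "\<And>i. i \<in> I \<Longrightarrow> finite_measure (M i)"
    and sets: "\<And>i. i \<in> I \<Longrightarrow> sets (M i) = sets N"
    and rel: "\<And>A. A \<in> sets N \<Longrightarrow> (\<Sum>i\<in>I. \<alpha> i * of_real (measure (M i) A)) = 0"
    and g: "g \<in> borel_measurable N" and bound: "\<And>x. x \<in> space N \<Longrightarrow> cmod (g x) \<le> B"
  shows "(\<Sum>i\<in>I. \<alpha> i * (LINT x|M i. g x)) = 0"
proof -
  obtain s where s: "\<And>n. simple_function N (s n)"
    and lim: "\<And>x. x \<in> space N \<Longrightarrow> (\<lambda>n. s n x) \<longlonglongrightarrow> g x"
    and s_le: "\<And>n x. x \<in> space N \<Longrightarrow> dist (s n x) 0 \<le> 2 * dist (g x) 0"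
    using borel_measurable_implies_sequence_metric[OF g, of 0] by blast
  have space: "space (M i) = space N" if "i \<in> I" for i
    using sets[OF that] by (rule sets_eq_imp_space_eq)
  have int_s: "(LINT x|M i. s n x) =
      (\<Sum>y\<in>s n ` space N. measure (M i) {x\<in>space N. s n x = y} *\<^sub>R y)" if i: "i \<in> I" for i n
  proof -
    interpret finite_measure "M i" by (rule fin[OF i])
    have "simple_function (M i) (s n)"
      using s[of n] space[OF i] sets[OF i] by (simp add: simple_function_def)
    then have "Bochner_Integration.simple_bochner_integrable (M i) (s n)"
      by (simp add: simple_bochner_integrable.simps)
    then show ?thesis
      by (simp add: simple_bochner_integral_def space[OF i] flip: simple_bochner_integrable_eq_integral)
  qed
  have zero: "(\<Sum>i\<in>I. \<alpha> i * (LINT x|M i. s n x)) = 0" for n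
  proof -
    have "(\<Sum>i\<in>I. \<alpha> i * (LINT x|M i. s n x)) =
        (\<Sum>i\<in>I. \<Sum>y\<in>s n ` space N. \<alpha> i * of_real (measure (M i) {x\<in>space N. s n x = y}) * y)"
      by (intro sum.cong refl) (simp add: int_s sum_distrib_left scaleR_conv_of_real mult.assoc)
    also have "\<dots> = (\<Sum>y\<in>s n ` space N.
        (\<Sum>i\<in>I. \<alpha> i * of_real (measure (M i) {x\<in>space N. s n x = y})) * y)"
      by (subst sum.swap) (simp add: sum_distrib_right)
    also have "\<dots> = 0"
    proof (rule sum.neutral, rule ballI)
      fix y
      have "{x\<in>space N. s n x = y} = s n -` {y} \<inter> space N" by auto
      then have "{x\<in>space N. s n x = y} \<in> sets N"
        using s[of n] by (simp add: simple_functionD)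
      then show "(\<Sum>i\<in>I. \<alpha> i * of_real (measure (M i) {x\<in>space N. s n x = y})) * y = 0"
        by (simp add: rel)
    qed
    finally show ?thesis .
  qed
  have conv: "(\<lambda>n. LINT x|M i. s n x) \<longlonglongrightarrow> (LINT x|M i. g x)" if i: "i \<in> I" for i
  proof (rule integral_dominated_convergence[where w="\<lambda>_. 2 * B"])
    interpret finite_measure "M i" by (rule fin[OF i])
    show "g \<in> borel_measurable (M i)"
      using g sets[OF i] by (metis measurable_cong_sets)
    show "s n \<in> borel_measurable (M i)" for n
      using borel_measurable_simple_function[OF s] sets[OF i] by (metis measurable_cong_sets)
    show "integrable (M i) (\<lambda>_. 2 * B)" by simp
    show "AE x in M i. (\<lambda>n. s n x) \<longlonglongrightarrow> g x"
      using lim space[OF i] by (intro AE_I2) simp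
    show "AE x in M i. cmod (s n x) \<le> 2 * B" for n
    proof (rule AE_I2)
      fix x assume "x \<in> space (M i)"
      then have x: "x \<in> space N" by (simp add: space[OF i])
      show "cmod (s n x) \<le> 2 * B" using s_le[OF x, of n] bound[OF x] by simp
    qed
  qed
  have "(\<lambda>n. \<Sum>i\<in>I. \<alpha> i * (LINT x|M i. s n x)) \<longlonglongrightarrow> (\<Sum>i\<in>I. \<alpha> i * (LINT x|M i. g x))"
    by (intro tendsto_sum tendsto_mult tendsto_const conv)
  then show ?thesis by (simp add: zero LIMSEQ_const_iff)
qed

text \<open>On a Hahn set \<open>Y\<close> of \<open>\<nu>\<close> the positive variation is \<open>B \<mapsto> \<nu> (B \<inter> Y)\<close>: passing from
  \<open>A \<subseteq> B\<close> to \<open>B \<inter> Y\<close> removes a part where \<open>\<nu>\<close> is at most 0 and adds one where it is at least 0.\<close>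

lemma positive_variation_Hahn:
  assumes M: "finite_measure M" "finite_measure N" "sets M = circle_sets" "sets N = circle_sets"
    and \<nu>: "\<And>A. A \<in> circle_sets \<Longrightarrow> \<nu> A = c * (measure M A - measure N A)" and c: "c \<ge> 0"
    and Y: "Y \<in> circle_sets"
    and pos: "\<And>A. A \<in> circle_sets \<Longrightarrow> A \<subseteq> Y \<Longrightarrow> measure N A \<le> measure M A"
    and neg: "\<And>A. A \<in> circle_sets \<Longrightarrow> A \<inter> Y = {} \<Longrightarrow> measure M A \<le> measure N A"
  shows "finite_measure (positive_variation \<nu>)" "sets (positive_variation \<nu>) = circle_sets"
    and "A \<in> circle_sets \<Longrightarrow> measure (positive_variation \<nu>) A = \<nu> (A \<inter> Y)"
proof -
  interpret sigma_algebra circle circle_sets by (rule sigma_algebra_circle_sets)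
  interpret M: finite_measure M by fact
  interpret N: finite_measure N by fact
  have nonneg: "0 \<le> \<nu> (A \<inter> Y)" if "A \<in> circle_sets" for A
    using pos[of "A \<inter> Y"] Int[OF that Y] c by (simp add: \<nu>)
  have sup: "(SUP A \<in> {A \<in> circle_sets. A \<subseteq> B}. ennreal (\<nu> A)) = ennreal (\<nu> (B \<inter> Y))"
    if B: "B \<in> circle_sets" for B
  proof (rule antisym)
    show "(SUP A \<in> {A \<in> circle_sets. A \<subseteq> B}. ennreal (\<nu> A)) \<le> ennreal (\<nu> (B \<inter> Y))"
    proof (rule SUP_least, clarify)
      fix A assume A: "A \<in> circle_sets" "A \<subseteq> B"
      have "\<nu> (B \<inter> Y) - \<nu> A = c * (measure M ((B - A) \<inter> Y) - measure N ((B - A) \<inter> Y))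
          + c * (measure N (A - Y) - measure M (A - Y))"
      proof -
        have *: "measure K (B \<inter> Y) - measure K A = measure K ((B - A) \<inter> Y) - measure K (A - Y)"
          if "finite_measure K" "sets K = circle_sets" for K
        proof -
          interpret K: finite_measure K by fact
          have "measure K (B \<inter> Y) = measure K (A \<inter> Y) + measure K ((B - A) \<inter> Y)"
            using A B Y that by (subst K.finite_measure_Union[symmetric]) (auto intro!: arg_cong[of _ _ "measure K"])
          moreover have "measure K A = measure K (A \<inter> Y) + measure K (A - Y)"
            using A B Y that by (subst K.finite_measure_Union[symmetric]) (auto intro!: arg_cong[of _ _ "measure K"])
          ultimately show ?thesis by simp
        qed
        have "\<nu> (B \<inter> Y) - \<nu> A = c * ((measure M (B \<inter> Y) - measure M A) - (measure N (B \<inter> Y) - measure N A))"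
          using A Int[OF B Y] by (simp add: \<nu> algebra_simps)
        then show ?thesis
          unfolding *[OF M(1,3)] *[OF M(2,4)] by (simp add: algebra_simps)
      qed
      also have "\<dots> \<ge> 0"
        using pos[of "(B - A) \<inter> Y"] neg[of "A - Y"] A B Y c
        by (intro add_nonneg_nonneg mult_nonneg_nonneg) auto
      finally show "ennreal (\<nu> A) \<le> ennreal (\<nu> (B \<inter> Y))" by (intro ennreal_leI) simp
    qed
    show "ennreal (\<nu> (B \<inter> Y)) \<le> (SUP A \<in> {A \<in> circle_sets. A \<subseteq> B}. ennreal (\<nu> A))"
      using B Y by (intro SUP_upper) auto
  qed
  have cadd: "(\<lambda>i. \<nu> (A i \<inter> Y)) sums \<nu> ((\<Union>i. A i) \<inter> Y)"
    if A: "range A \<subseteq> circle_sets" "disjoint_family A" for A :: "nat \<Rightarrow> complex set"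
  proof -
    have AY: "A i \<inter> Y \<in> circle_sets" for i using A Y by auto
    have d: "disjoint_family (\<lambda>i. A i \<inter> Y)" using A by (auto simp: disjoint_family_on_def)
    have eq: "(\<Union>i. A i) \<inter> Y = (\<Union>i. A i \<inter> Y)" by auto
    have "(\<lambda>i. c * (measure M (A i \<inter> Y) - measure N (A i \<inter> Y)))
        sums (c * (measure M (\<Union>i. A i \<inter> Y) - measure N (\<Union>i. A i \<inter> Y)))"
      using AY d M by (intro sums_mult sums_diff measure_UNION) (auto simp: M.emeasure_finite N.emeasure_finite)
    moreover have "(\<Union>i. A i \<inter> Y) \<in> circle_sets" by (rule countable_UN) (use AY in auto)
    ultimately show ?thesis unfolding eq by (simp add: \<nu> AY)
  qed
  note mm = measure_measure_of_circle[of "\<lambda>B. \<nu> (B \<inter> Y)"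
      "\<lambda>B. SUP A \<in> {A \<in> circle_sets. A \<subseteq> B}. ennreal (\<nu> A)", folded positive_variation_def]
  show "finite_measure (positive_variation \<nu>)" by (rule mm(1)) (fact nonneg cadd sup)+
  show "A \<in> circle_sets \<Longrightarrow> measure (positive_variation \<nu>) A = \<nu> (A \<inter> Y)"
    by (rule mm(2)) (simp_all add: nonneg cadd sup)
  show "sets (positive_variation \<nu>) = circle_sets" by (simp add: positive_variation_def)
qed

text \<open>A Hahn set for \<open>M - N\<close> and its complement compute both variations of \<open>\<nu>\<close>, so that
  \<open>c M + \<nu>\<^sup>-\<close> and \<open>c N + \<nu>\<^sup>+\<close> agree on all Borel sets, hence on integrals.\<close>

lemma signed_integral_difference:
  assumes M: "finite_measure M" "finite_measure N" "sets M = circle_sets" "sets N = circle_sets"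
    and \<nu>: "\<And>A. A \<in> circle_sets \<Longrightarrow> \<nu> A = c * (measure M A - measure N A)" and c: "c \<ge> 0"
    and g: "g \<in> borel_measurable borel" and bound: "\<And>x. x \<in> circle \<Longrightarrow> \<bar>g x\<bar> \<le> B"
  shows "signed_integral \<nu> g = c * ((LINT \<zeta>|M. g \<zeta>) - (LINT \<zeta>|N. g \<zeta>))"
proof -
  interpret sigma_algebra circle circle_sets by (rule sigma_algebra_circle_sets)
  interpret M: finite_measure M by fact
  interpret N: finite_measure N by fact
  obtain Y where Y: "Y \<in> circle_sets"
    and pos: "\<And>A. A \<in> circle_sets \<Longrightarrow> A \<subseteq> Y \<Longrightarrow> measure N A \<le> measure M A"
    and neg: "\<And>A. A \<in> circle_sets \<Longrightarrow> A \<inter> Y = {} \<Longrightarrow> measure M A \<le> measure N A"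
  proof -
    obtain Y where "Y \<in> sets M" "\<forall>X\<in>sets M. X \<subseteq> Y \<longrightarrow> N X \<le> M X"
        "\<forall>X\<in>sets M. X \<inter> Y = {} \<longrightarrow> M X \<le> N X"
      using finite_unsigned_Hahn_decomposition[of M N] M by auto
    then show ?thesis
      using M by (intro that[of Y]) (auto simp: M.emeasure_eq_measure N.emeasure_eq_measure)
  qed
  let ?P = "positive_variation \<nu>" and ?N = "positive_variation (\<lambda>A. - \<nu> A)"
  note P = positive_variation_Hahn[OF M \<nu> c Y pos neg]
  have \<nu>': "- \<nu> A = c * (measure N A - measure M A)" if "A \<in> circle_sets" for A
    using that by (simp add: \<nu> algebra_simps)
  have Y': "circle - Y \<in> circle_sets" using Y by auto
  have pos': "measure M A \<le> measure N A" if "A \<in> circle_sets" "A \<subseteq> circle - Y" for A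
    using that by (intro neg) auto
  have neg': "measure N A \<le> measure M A" if "A \<in> circle_sets" "A \<inter> (circle - Y) = {}" for A
    using that sets_into_space[OF that(1)] by (intro pos) auto
  note N = positive_variation_Hahn[OF M(2,1,4,3) \<nu>' c Y' pos' neg']
  define K where "K i = (if i = 0 then M else if i = 1 then N else if i = 2 then ?P else ?N)" for i :: nat
  define \<alpha> where "\<alpha> i = (if i = 0 then of_real c else if i = 1 then - of_real c
    else if i = 2 then -1 else 1 :: complex)" for i :: nat
  have rel: "(\<Sum>i<4. \<alpha> i * of_real (measure (K i) A)) = 0" if A: "A \<in> circle_sets" for A
  proof -
    have "measure L A = measure L (A \<inter> Y) + measure L (A \<inter> (circle - Y))"
      if "finite_measure L" "sets L = circle_sets" for L
    proof -
      interpret L: finite_measure L by fact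
      have "A \<subseteq> circle" using A sets_into_space by auto
      then show ?thesis
        using A Y that by (subst L.finite_measure_Union[symmetric]) (auto intro!: arg_cong[of _ _ "measure L"])
    qed
    from this[OF M(1,3)] this[OF M(2,4)]
    have "c * (measure M A - measure N A) - measure ?P A + measure ?N A = 0"
      using A Y Int[OF A Y] Int[OF A Y'] by (simp add: P N \<nu> algebra_simps)
    then have "complex_of_real (c * (measure M A - measure N A) - measure ?P A + measure ?N A) = 0"
      by (simp only: of_real_0)
    then show ?thesis by (simp add: sum_lessThan_4 K_def \<alpha>_def algebra_simps)
  qed
  have "(\<Sum>i<4. \<alpha> i * (LINT \<zeta>|K i. complex_of_real (g \<zeta>))) = 0"
  proof (rule integral_linear_relation[where N = M and B = B and \<alpha> = \<alpha> and M = K and I = "{..<4}"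
        and g = "\<lambda>\<zeta>. complex_of_real (g \<zeta>)"])
    show "finite_measure (K i)" for i
      by (simp add: K_def M(1,2) P(1) N(1))
    show "sets (K i) = sets M" for i
      by (simp add: K_def M(3,4) P(2) N(2))
    show "(\<lambda>\<zeta>. complex_of_real (g \<zeta>)) \<in> borel_measurable M"
      using borel_measurable_circle[OF g M(3)] by measurable
    show "(\<Sum>i<4. \<alpha> i * of_real (measure (K i) A)) = 0" if "A \<in> sets M" for A
      by (rule rel) (use that M in simp)
    show "cmod (complex_of_real (g x)) \<le> B" if "x \<in> space M" for x
      using bound[of x] that by (simp add: space_eq_circle[OF M(3)])
  qed simp
  then have "complex_of_real (c * (LINT \<zeta>|M. g \<zeta>) - c * (LINT \<zeta>|N. g \<zeta>)
      - (LINT \<zeta>|?P. g \<zeta>) + (LINT \<zeta>|?N. g \<zeta>)) = 0"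
    by (simp add: sum_lessThan_4 K_def \<alpha>_def algebra_simps)
  then have "c * (LINT \<zeta>|M. g \<zeta>) - c * (LINT \<zeta>|N. g \<zeta>)
      - (LINT \<zeta>|?P. g \<zeta>) + (LINT \<zeta>|?N. g \<zeta>) = 0"
    by (simp only: of_real_eq_0_iff)
  then show ?thesis by (simp add: signed_integral_def algebra_simps)
qed

section \<open>The form of a semi-spectral measure and its Poisson integral\<close>

definition diag_measure :: "(complex set \<Rightarrow> 'e::chilbert_space \<Rightarrow> 'e) \<Rightarrow> 'e \<Rightarrow> complex measure"
  where "diag_measure \<mu> x = measure_of circle circle_sets (\<lambda>A. ennreal (Re (cinner (\<mu> A x) x)))"

definition poisson_kernel :: "complex \<Rightarrow> complex \<Rightarrow> real"
  where "poisson_kernel z \<zeta> = (1 - (cmod z)\<^sup>2) / (cmod (z - \<zeta>))\<^sup>2"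

locale semi_spectral =
  fixes \<mu> :: "complex set \<Rightarrow> 'e::chilbert_space \<Rightarrow> 'e"
  assumes semi_spectral: "semi_spectral_measure \<mu>"
begin

lemma bounded_operator_\<mu>: "A \<in> circle_sets \<Longrightarrow> bounded_operator UNIV cinner (\<mu> A)"
  using semi_spectral by (simp add: semi_spectral_measure_def positive_operator_def)

lemmas sesquilinear_\<mu> = sesquilinear_cinner_comp[OF bounded_operator_\<mu>]

lemma \<mu>_nonneg: "A \<in> circle_sets \<Longrightarrow> 0 \<le> Re (cinner (\<mu> A x) x)"
  and \<mu>_diag_real: "A \<in> circle_sets \<Longrightarrow> of_real (Re (cinner (\<mu> A x) x)) = cinner (\<mu> A x) x"
  using semi_spectral
  by (simp_all add: semi_spectral_measure_def positive_operator_def complex_nonneg_Reals_iff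
      complex_eq_iff)

lemma \<mu>_sums:
  assumes "range A \<subseteq> circle_sets" "disjoint_family A"
  shows "(\<lambda>i::nat. cinner (\<mu> (A i) x) y) sums cinner (\<mu> (\<Union>i. A i) x) y"
  using semi_spectral assms by (simp add: semi_spectral_measure_def complex_borel_measure_def)

lemma finite_diag_measure: "finite_measure (diag_measure \<mu> x)"
  and measure_diag_measure:
    "A \<in> circle_sets \<Longrightarrow> measure (diag_measure \<mu> x) A = Re (cinner (\<mu> A x) x)"
proof -
  have s: "(\<lambda>i. Re (cinner (\<mu> (A i) x) x)) sums Re (cinner (\<mu> (\<Union>i. A i) x) x)"
    if "range A \<subseteq> circle_sets" "disjoint_family A" for A :: "nat \<Rightarrow> complex set"
    using sums_Re[OF \<mu>_sums[OF that]] .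
  show "finite_measure (diag_measure \<mu> x)"
    unfolding diag_measure_def
    by (rule measure_measure_of_circle(1)[where f = "\<lambda>A. Re (cinner (\<mu> A x) x)"])
      (simp_all add: \<mu>_nonneg s)
  show "A \<in> circle_sets \<Longrightarrow> measure (diag_measure \<mu> x) A = Re (cinner (\<mu> A x) x)"
    unfolding diag_measure_def
    by (rule measure_measure_of_circle(2)[where f = "\<lambda>A. Re (cinner (\<mu> A x) x)"])
      (simp_all add: \<mu>_nonneg s)
qed

lemma sets_diag_measure [simp]: "sets (diag_measure \<mu> x) = circle_sets"
  by (simp add: diag_measure_def)

lemma space_diag_measure [simp]: "space (diag_measure \<mu> x) = circle"
  by (simp add: diag_measure_def)

text \<open>\<open>\<integral> g d\<langle>\<mu>(\<cdot>)x, y\<rangle>\<close>, written by polarisation with the positive measures \<open>\<langle>\<mu>(\<cdot>)x, x\<rangle>\<close>, for which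
  Fubini's theorem and dominated convergence are at hand.\<close>

definition form :: "'e \<Rightarrow> 'e \<Rightarrow> (complex \<Rightarrow> complex) \<Rightarrow> complex"
  where "form x y g = (\<Sum>k<4. \<i> ^ k * (LINT \<zeta>|diag_measure \<mu> (x + \<i> ^ k *\<^sub>C y). g \<zeta>)) / 4"

lemma form_measure:
  assumes A: "A \<in> circle_sets"
  shows "(\<Sum>k<4. \<i> ^ k * of_real (measure (diag_measure \<mu> (x + \<i> ^ k *\<^sub>C y)) A)) / 4 = cinner (\<mu> A x) y"
  using polarization[OF sesquilinear_\<mu>[OF A]] by (simp add: measure_diag_measure[OF A] \<mu>_diag_real[OF A])

text \<open>The measures live on the circle, so the values of \<open>g\<close> elsewhere are left unrestricted.\<close>

definition circle_bounded :: "(complex \<Rightarrow> complex) \<Rightarrow> real \<Rightarrow> bool"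
  where "circle_bounded g B \<longleftrightarrow> g \<in> borel_measurable borel \<and> (\<forall>\<zeta>\<in>circle. cmod (g \<zeta>) \<le> B)"

lemma circle_bounded_measurable: "circle_bounded g B \<Longrightarrow> g \<in> borel_measurable (diag_measure \<mu> x)"
  unfolding circle_bounded_def by (rule borel_measurable_circle) auto

lemma circle_bounded_integrable: "circle_bounded g B \<Longrightarrow> integrable (diag_measure \<mu> x) g"
  by (rule finite_measure.integrable_const_bound[OF finite_diag_measure, where f = g and B = B])
    (auto intro: circle_bounded_measurable simp: circle_bounded_def)

text \<open>Every linear relation between the measures \<open>\<langle>\<mu>(\<cdot>)x, y\<rangle>\<close> carries over to the forms.  In
  particular the forms are sesquilinear because the operators \<open>\<mu> A\<close> are linear.\<close>

lemma form_relation: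
  assumes J: "finite J" and g: "circle_bounded g B"
    and rel: "\<And>A. A \<in> circle_sets \<Longrightarrow> (\<Sum>j\<in>J. \<beta> j * cinner (\<mu> A (x j)) (y j)) = 0"
  shows "(\<Sum>j\<in>J. \<beta> j * form (x j) (y j) g) = 0"
proof -
  let ?\<alpha> = "\<lambda>p. \<beta> (fst p) * \<i> ^ snd p / 4"
  let ?M = "\<lambda>p. diag_measure \<mu> (x (fst p) + \<i> ^ snd p *\<^sub>C y (fst p))"
  have expand: "(\<Sum>j\<in>J. \<beta> j * ((\<Sum>k<4. \<i> ^ k * f (j, k)) / 4)) = (\<Sum>p\<in>J \<times> {..<4}. ?\<alpha> p * f p)"
    for f :: "_ \<times> nat \<Rightarrow> complex"
    by (simp add: sum.cartesian_product' sum_distrib_left sum_divide_distrib mult.assoc)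
  have "(\<Sum>p\<in>J \<times> {..<4}. ?\<alpha> p * (LINT \<zeta>|?M p. g \<zeta>)) = 0"
  proof (rule integral_linear_relation[where N = "diag_measure \<mu> 0" and B = B and g = g
        and \<alpha> = ?\<alpha> and M = ?M and I = "J \<times> {..<4}"])
    show "finite_measure (?M p)" for p by (rule finite_diag_measure)
    show "(\<Sum>p\<in>J \<times> {..<4}. ?\<alpha> p * of_real (measure (?M p) A)) = 0"
      if "A \<in> sets (diag_measure \<mu> 0)" for A
    proof -
      have A: "A \<in> circle_sets" using that by simp
      show ?thesis
        unfolding expand[of "\<lambda>p. of_real (measure (?M p) A)", symmetric] fst_conv snd_conv
          form_measure[OF A] by (rule rel[OF A])
    qed
    show "g \<in> borel_measurable (diag_measure \<mu> 0)" by (rule circle_bounded_measurable[OF g])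
    show "finite (J \<times> {..<4::nat})" using J by simp
    show "cmod (g \<zeta>) \<le> B" if "\<zeta> \<in> space (diag_measure \<mu> 0)" for \<zeta>
      using g that by (simp add: circle_bounded_def)
  qed simp
  then show ?thesis
    unfolding form_def expand[of "\<lambda>p. LINT \<zeta>|?M p. g \<zeta>", symmetric] fst_conv snd_conv .
qed

lemma sesquilinear_form:
  assumes g: "circle_bounded g B"
  shows "sesquilinear (\<lambda>x y. form x y g)"
  unfolding sesquilinear_def
proof (intro conjI allI)
  note sq = sesquilinear_\<mu>[unfolded sesquilinear_def]
  have three: "(\<Sum>j\<in>{0, 1, 2::nat}. f j) = f 0 + f 1 + f 2" for f :: "nat \<Rightarrow> complex" by simp
  have two: "(\<Sum>j\<in>{0, 1::nat}. f j) = f 0 + f 1" for f :: "nat \<Rightarrow> complex" by simp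
  fix x y z :: 'e and a :: complex
  show "form (x + y) z g = form x z g + form y z g"
    using form_relation[OF _ g, of "{0, 1, 2::nat}" "\<lambda>j. if j = 0 then 1 else -1"
        "\<lambda>j. if j = 0 then x + y else if j = 1 then x else y" "\<lambda>_. z"]
    unfolding three by (simp add: sq algebra_simps)
  show "form x (y + z) g = form x y g + form x z g"
    using form_relation[OF _ g, of "{0, 1, 2::nat}" "\<lambda>j. if j = 0 then 1 else -1" "\<lambda>_. x"
        "\<lambda>j. if j = 0 then y + z else if j = 1 then y else z"]
    unfolding three by (simp add: sq algebra_simps)
  show "form (a *\<^sub>C x) y g = a * form x y g"
    using form_relation[OF _ g, of "{0, 1::nat}" "\<lambda>j. if j = 0 then 1 else - a"
        "\<lambda>j. if j = 0 then a *\<^sub>C x else x" "\<lambda>_. y"]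
    unfolding two by (simp add: sq)
  show "form x (a *\<^sub>C y) g = cnj a * form x y g"
    using form_relation[OF _ g, of "{0, 1::nat}" "\<lambda>j. if j = 0 then 1 else - cnj a" "\<lambda>_. x"
        "\<lambda>j. if j = 0 then a *\<^sub>C y else y"]
    unfolding two by (simp add: sq)
qed

lemma form_self:
  assumes g: "circle_bounded g B"
  shows "form x x g = (LINT \<zeta>|diag_measure \<mu> x. g \<zeta>)"
proof -
  let ?\<alpha> = "\<lambda>k::nat. if k = 4 then -1 else \<i> ^ k / 4"
  let ?M = "\<lambda>k. if k = 4 then diag_measure \<mu> x else diag_measure \<mu> (x + \<i> ^ k *\<^sub>C x)"
  have split: "(\<Sum>k<Suc 4. ?\<alpha> k * f k) = (\<Sum>k<4. \<i> ^ k * f k) / 4 - f 4" for f :: "nat \<Rightarrow> complex"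
    by (simp only: sum.lessThan_Suc) (simp add: sum_divide_distrib)
  have rel: "(\<Sum>k<Suc 4. ?\<alpha> k * of_real (measure (?M k) A)) = 0" if A: "A \<in> circle_sets" for A
    unfolding split using form_measure[OF A, of x x]
    by (simp add: measure_diag_measure[OF A] \<mu>_diag_real[OF A])
  have "(\<Sum>k<Suc 4. ?\<alpha> k * (LINT \<zeta>|?M k. g \<zeta>)) = 0"
  proof (rule integral_linear_relation[where N = "diag_measure \<mu> 0" and B = B and g = g
        and \<alpha> = ?\<alpha> and M = ?M and I = "{..<Suc 4}"])
    show "finite_measure (?M k)" for k by (simp add: finite_diag_measure)
    show "(\<Sum>k<Suc 4. ?\<alpha> k * of_real (measure (?M k) A)) = 0"
      if "A \<in> sets (diag_measure \<mu> 0)" for A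
      by (rule rel) (use that in simp)
    show "g \<in> borel_measurable (diag_measure \<mu> 0)" by (rule circle_bounded_measurable[OF g])
    show "cmod (g \<zeta>) \<le> B" if "\<zeta> \<in> space (diag_measure \<mu> 0)" for \<zeta>
      using g that by (simp add: circle_bounded_def)
  qed simp_all
  then show ?thesis unfolding split by (simp add: form_def)
qed

lemma form_cnj:
  assumes g: "circle_bounded g B"
  shows "cnj (form x y g) = form y x (\<lambda>\<zeta>. cnj (g \<zeta>))"
proof -
  have "cnj \<in> borel_measurable borel"
    by (intro borel_measurable_continuous_onI continuous_intros)
  then have g': "circle_bounded (\<lambda>\<zeta>. cnj (g \<zeta>)) B"
    using g unfolding circle_bounded_def by (auto intro: measurable_compose[of g borel borel])
  have "sesquilinear (\<lambda>x y. cnj (form y x (\<lambda>\<zeta>. cnj (g \<zeta>))))"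
    using sesquilinear_form[OF g'] by (simp add: sesquilinear_def)
  from polarization[OF this, of x y] polarization[OF sesquilinear_form[OF g], of x y]
  have "form x y g = cnj (form y x (\<lambda>\<zeta>. cnj (g \<zeta>)))"
    by (simp add: form_self[OF g] form_self[OF g'] integral_cnj)
  then show ?thesis by simp
qed

text \<open>An operator norm bound for \<open>\<mu>(circle)\<close>, which controls all the measures at once.\<close>

definition mass :: real
  where "mass = (SOME K. 0 \<le> K \<and> (\<forall>x. norm (\<mu> circle x) \<le> K * norm x))"

lemma mass_nonneg: "0 \<le> mass" and mass_bound: "norm (\<mu> circle x) \<le> mass * norm x"
proof -
  obtain K where K: "\<And>x. norm (\<mu> circle x) \<le> K * norm x"
    using bounded_operator_\<mu>[OF circle_in_circle_sets]
    by (auto simp: bounded_operator_def ip_norm_cinner)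
  have "norm (\<mu> circle x) \<le> max K 0 * norm x" for x
    by (rule order_trans[OF K mult_right_mono]) auto
  then have "0 \<le> max K 0 \<and> (\<forall>x. norm (\<mu> circle x) \<le> max K 0 * norm x)" by simp
  then have *: "0 \<le> mass \<and> (\<forall>x. norm (\<mu> circle x) \<le> mass * norm x)"
    unfolding mass_def by (rule someI)
  show "0 \<le> mass" "norm (\<mu> circle x) \<le> mass * norm x" using * by auto
qed

lemma diag_measure_circle_le: "measure (diag_measure \<mu> x) circle \<le> mass * (norm x)\<^sup>2"
proof -
  have "measure (diag_measure \<mu> x) circle \<le> cmod (cinner (\<mu> circle x) x)"
    by (simp add: measure_diag_measure[OF circle_in_circle_sets] complex_Re_le_cmod)
  also have "\<dots> \<le> norm (\<mu> circle x) * norm x" by (rule cmod_cinner_le)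
  also have "\<dots> \<le> (mass * norm x) * norm x" by (intro mult_right_mono mass_bound) simp
  finally show ?thesis by (simp add: power2_eq_square mult.assoc)
qed

lemma circle_bounded_bound_nonneg: "circle_bounded g B \<Longrightarrow> 0 \<le> B"
  by (rule order_trans[of _ "cmod (g 1)"]) (auto simp: circle_bounded_def)

lemma diag_integral_bound:
  assumes g: "circle_bounded g B"
  shows "cmod (LINT \<zeta>|diag_measure \<mu> x. g \<zeta>) \<le> B * mass * (norm x)\<^sup>2"
proof -
  interpret finite_measure "diag_measure \<mu> x" by (rule finite_diag_measure)
  have "cmod (LINT \<zeta>|diag_measure \<mu> x. g \<zeta>) \<le> (LINT \<zeta>|diag_measure \<mu> x. cmod (g \<zeta>))"
    by (rule integral_norm_bound)
  also have "\<dots> \<le> (LINT \<zeta>|diag_measure \<mu> x. B)"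
    by (rule integral_mono) (use g circle_bounded_integrable[OF g] in \<open>auto simp: circle_bounded_def\<close>)
  also have "\<dots> = B * measure (diag_measure \<mu> x) circle" by (simp add: mult.commute)
  also have "\<dots> \<le> B * (mass * (norm x)\<^sup>2)"
    by (intro mult_left_mono diag_measure_circle_le circle_bounded_bound_nonneg[OF g])
  finally show ?thesis by (simp add: mult.assoc)
qed

text \<open>The crude bound from polarisation is quadratic in \<open>\<parallel>x\<parallel> + \<parallel>y\<parallel>\<close>; applied to unit vectors
  it yields a bound proportional to \<open>\<parallel>x\<parallel> \<parallel>y\<parallel>\<close>.\<close>

lemma form_bound:
  assumes g: "circle_bounded g B"
  shows "cmod (form x y g) \<le> 4 * B * mass * norm x * norm y"
proof -
  have crude: "cmod (form u v g) \<le> B * mass * (norm u + norm v)\<^sup>2" for u v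
  proof -
    have "cmod (form u v g) \<le> (\<Sum>k<4. cmod (\<i> ^ k * (LINT \<zeta>|diag_measure \<mu> (u + \<i> ^ k *\<^sub>C v). g \<zeta>))) / 4"
      unfolding form_def by (simp add: norm_divide norm_sum divide_right_mono)
    also have "\<dots> \<le> (\<Sum>k<4::nat. B * mass * (norm u + norm v)\<^sup>2) / 4"
    proof (intro divide_right_mono sum_mono)
      fix k :: nat
      have "norm (u + \<i> ^ k *\<^sub>C v) \<le> norm u + norm v"
        using norm_triangle_ineq[of u "\<i> ^ k *\<^sub>C v"] by (simp add: norm_power)
      then have "(norm (u + \<i> ^ k *\<^sub>C v))\<^sup>2 \<le> (norm u + norm v)\<^sup>2" by (simp add: power_mono)
      then have "B * mass * (norm (u + \<i> ^ k *\<^sub>C v))\<^sup>2 \<le> B * mass * (norm u + norm v)\<^sup>2"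
        using circle_bounded_bound_nonneg[OF g] mass_nonneg by (intro mult_left_mono) auto
      then show "cmod (\<i> ^ k * (LINT \<zeta>|diag_measure \<mu> (u + \<i> ^ k *\<^sub>C v). g \<zeta>))
          \<le> B * mass * (norm u + norm v)\<^sup>2"
        using diag_integral_bound[OF g, of "u + \<i> ^ k *\<^sub>C v"] by (simp add: norm_mult norm_power)
    qed simp
    finally show ?thesis by simp
  qed
  note sq = sesquilinear_form[OF g, unfolded sesquilinear_def]
  show ?thesis
  proof (cases "x = 0 \<or> y = 0")
    case True
    have "form 0 y g = 0" "form x 0 g = 0"
      using sq by (metis add_cancel_right_right)+
    with True show ?thesis by auto
  next
    case False
    define u where "u = complex_of_real (1 / norm x) *\<^sub>C x"
    define v where "v = complex_of_real (1 / norm y) *\<^sub>C y"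
    have uv: "norm u = 1" "norm v = 1" using False by (simp_all add: u_def v_def norm_divide)
    have xy: "x = complex_of_real (norm x) *\<^sub>C u" "y = complex_of_real (norm y) *\<^sub>C v"
      using False by (simp_all add: u_def v_def scaleC_scaleC)
    have "form x y g = norm x * norm y * form u v g"
      by (subst xy(1), subst xy(2)) (simp add: sq)
    then have "cmod (form x y g) = norm x * norm y * cmod (form u v g)"
      by (simp add: norm_mult)
    also have "\<dots> \<le> norm x * norm y * (B * mass * (norm u + norm v)\<^sup>2)"
      by (intro mult_left_mono crude) auto
    finally show ?thesis by (simp add: uv mult_ac)
  qed
qed

text \<open>The real and imaginary parts of \<open>\<langle>\<mu>(\<cdot>)x, y\<rangle>\<close> are, up to the factor \<open>1/4\<close>, differences of two of
  the positive measures used for polarisation, so \<open>signed_integral_difference\<close> applies to both.\<close>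

lemma complex_measure_integral_form:
  assumes g: "g \<in> borel_measurable borel" and bound: "\<And>\<zeta>. \<zeta> \<in> circle \<Longrightarrow> \<bar>g \<zeta>\<bar> \<le> B"
  shows "complex_measure_integral (\<lambda>A. cinner (\<mu> A x) y) g = form x y (\<lambda>\<zeta>. of_real (g \<zeta>))"
proof -
  let ?d = "\<lambda>k::nat. diag_measure \<mu> (x + \<i> ^ k *\<^sub>C y)"
  have diff: "signed_integral \<nu> g = 1/4 * ((LINT \<zeta>|?d j. g \<zeta>) - (LINT \<zeta>|?d k. g \<zeta>))"
    if "\<And>A. A \<in> circle_sets \<Longrightarrow> \<nu> A = 1/4 * (measure (?d j) A - measure (?d k) A)" for \<nu> j k
    by (rule signed_integral_difference[OF finite_diag_measure finite_diag_measure _ _ that _ g bound])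
      simp_all
  have Re: "signed_integral (\<lambda>A. Re (cinner (\<mu> A x) y)) g
      = 1/4 * ((LINT \<zeta>|?d 0. g \<zeta>) - (LINT \<zeta>|?d 2. g \<zeta>))"
    by (rule diff, subst form_measure[symmetric]) (simp_all add: sum_lessThan_4 i_power3)
  have Im: "signed_integral (\<lambda>A. Im (cinner (\<mu> A x) y)) g
      = 1/4 * ((LINT \<zeta>|?d 1. g \<zeta>) - (LINT \<zeta>|?d 3. g \<zeta>))"
    by (rule diff, subst form_measure[symmetric]) (simp_all add: sum_lessThan_4 i_power3)
  have "form x y (\<lambda>\<zeta>. of_real (g \<zeta>)) = (\<Sum>k<4. \<i> ^ k * of_real (LINT \<zeta>|?d k. g \<zeta>)) / 4"
    by (simp add: form_def)
  also have "\<dots> = complex_measure_integral (\<lambda>A. cinner (\<mu> A x) y) g"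
    unfolding complex_measure_integral_def Re Im sum_lessThan_4
    by (simp add: complex_eq_iff i_power3 field_simps)
  finally show ?thesis by simp
qed

text \<open>A bounded sesquilinear form is given by a bounded operator, by Riesz representation in the
  second argument.\<close>

lemma operator_of_form:
  assumes g: "circle_bounded g B"
  shows "\<exists>P. bounded_operator UNIV cinner P \<and> (\<forall>x y. cinner (P x) y = form x y g)"
proof -
  note sq = sesquilinear_form[OF g, unfolded sesquilinear_def]
  have "\<exists>w. \<forall>y. cnj (form x y g) = cinner y w" for x
  proof -
    obtain w where "\<And>y. cnj (form x y g) = cinner y w"
      by (rule E.riesz_representation[of "\<lambda>y. cnj (form x y g)" "4 * B * mass * norm x"])
        (use form_bound[OF g] in \<open>simp_all add: sq ip_norm_cinner\<close>)
    then show ?thesis by blast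
  qed
  then obtain P where P': "\<And>x y. cnj (form x y g) = cinner y (P x)" by metis
  have P: "cinner (P x) y = form x y g" for x y
    using P'[of x y] cnj_cinner[of y "P x"] by (metis complex_cnj_cnj)
  have "bounded_operator UNIV cinner P"
    unfolding bounded_operator_def
  proof (intro conjI ballI allI exI[of _ "4 * B * mass"])
    fix x y :: 'e and a :: complex
    show "P (x + y) = P x + P y"
      by (rule eq_if_cinner_eq) (simp add: P cinner_add_left sq)
    show "P (a *\<^sub>C x) = a *\<^sub>C P x"
      by (rule eq_if_cinner_eq) (simp add: P cinner_scaleC_left sq)
    have "(norm (P x))\<^sup>2 = cmod (form x (P x) g)"
      by (simp add: P[symmetric] cinner_self_real norm_power)
    also have "\<dots> \<le> (4 * B * mass * norm x) * norm (P x)" by (rule form_bound[OF g])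
    finally show "ip_norm cinner (P x) \<le> 4 * B * mass * ip_norm cinner x"
      using circle_bounded_bound_nonneg[OF g] mass_nonneg
      by (cases "norm (P x) = 0") (simp_all add: ip_norm_cinner power2_eq_square)
  qed simp
  with P show ?thesis by blast
qed

lemma poisson_kernel_bound:
  assumes z: "cmod z \<le> r" "r < 1" and \<zeta>: "\<zeta> \<in> circle"
  shows "0 \<le> poisson_kernel z \<zeta>" "poisson_kernel z \<zeta> \<le> 1 / (1 - r)\<^sup>2"
proof -
  have zz: "(cmod z)\<^sup>2 \<le> 1" using z by (simp add: power_le_one)
  then show "0 \<le> poisson_kernel z \<zeta>" by (simp add: poisson_kernel_def)
  have "1 - r \<le> cmod (z - \<zeta>)"
    using norm_triangle_ineq3[of z \<zeta>] z \<zeta> by simp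
  then have "(1 - r)\<^sup>2 \<le> (cmod (z - \<zeta>))\<^sup>2" using z by (intro power_mono) auto
  then show "poisson_kernel z \<zeta> \<le> 1 / (1 - r)\<^sup>2"
    unfolding poisson_kernel_def using z zz by (intro frac_le) auto
qed

lemma poisson_kernel_measurable [measurable]:
  "poisson_kernel z \<in> borel_measurable borel"
  "(\<lambda>p. poisson_kernel (fst p) (snd p)) \<in> borel_measurable (borel \<Otimes>\<^sub>M borel)"
  unfolding poisson_kernel_def by measurable

lemma circle_bounded_poisson_kernel:
  assumes "cmod z \<le> r" "r < 1"
  shows "circle_bounded (\<lambda>\<zeta>. of_real (poisson_kernel z \<zeta>)) (1 / (1 - r)\<^sup>2)"
  unfolding circle_bounded_def
proof
  show "(\<lambda>\<zeta>. complex_of_real (poisson_kernel z \<zeta>)) \<in> borel_measurable borel" by measurable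
  show "\<forall>\<zeta>\<in>circle. cmod (of_real (poisson_kernel z \<zeta>)) \<le> 1 / (1 - r)\<^sup>2"
    using poisson_kernel_bound[OF assms] by simp
qed

text \<open>The definite description that defines the Poisson integral has a witness by
  \<open>operator_of_form\<close>, and an operator is determined by its form.\<close>

lemma poisson_integral:
  assumes z: "cmod z < 1"
  shows "bounded_operator UNIV cinner (poisson_integral \<mu> z)"
    and "cinner (poisson_integral \<mu> z x) y = form x y (\<lambda>\<zeta>. of_real (poisson_kernel z \<zeta>))"
proof -
  note bm = circle_bounded_poisson_kernel[OF order_refl z]
  obtain P where P: "bounded_operator UNIV cinner P"
    and eq: "\<And>x y. cinner (P x) y = form x y (\<lambda>\<zeta>. of_real (poisson_kernel z \<zeta>))"
    using operator_of_form[OF bm] by blast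
  have cmi: "complex_measure_integral (\<lambda>A. cinner (\<mu> A x) y)
      (\<lambda>\<zeta>. (1 - (cmod z)\<^sup>2) / (cmod (z - \<zeta>))\<^sup>2) = form x y (\<lambda>\<zeta>. of_real (poisson_kernel z \<zeta>))" for x y
    using complex_measure_integral_form[of "poisson_kernel z" "1 / (1 - cmod z)\<^sup>2" x y]
      poisson_kernel_bound[OF order_refl z] by (simp flip: poisson_kernel_def)
  have "poisson_integral \<mu> z = P"
    unfolding poisson_integral_def cmi
  proof (rule the_equality)
    fix Q assume Q: "bounded_operator UNIV cinner Q \<and>
      (\<forall>x y. cinner (Q x) y = form x y (\<lambda>\<zeta>. of_real (poisson_kernel z \<zeta>)))"
    show "Q = P" by (rule ext, rule eq_if_cinner_eq) (simp add: Q eq)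
  qed (use P eq in auto)
  with P eq show "bounded_operator UNIV cinner (poisson_integral \<mu> z)"
    and "cinner (poisson_integral \<mu> z x) y = form x y (\<lambda>\<zeta>. of_real (poisson_kernel z \<zeta>))"
    by simp_all
qed

lemma poisson_integral_nonneg:
  assumes z: "cmod z < 1"
  shows "0 \<le> Re (cinner (poisson_integral \<mu> z x) x)"
proof -
  note bm = circle_bounded_poisson_kernel[OF order_refl z]
  have "cinner (poisson_integral \<mu> z x) x = of_real (LINT \<zeta>|diag_measure \<mu> x. poisson_kernel z \<zeta>)"
    by (simp add: poisson_integral[OF z] form_self[OF bm])
  moreover have "0 \<le> (LINT \<zeta>|diag_measure \<mu> x. poisson_kernel z \<zeta>)"
    by (rule integral_nonneg_AE) (use poisson_kernel_bound[OF order_refl z] in auto)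
  ultimately show ?thesis by simp
qed

end

section \<open>Area integrals over the disc\<close>

text \<open>Uniqueness of Haar measure, in the form needed: evaluating
  \<open>\<integral>\<integral> 1\<^sub>A(x + y) 1\<^sub>B(y)\<close> with \<open>B\<close> the unit disc in both orders gives
  \<open>\<nu>(A) \<lambda>(B) = \<lambda>(A) \<nu>(B)\<close>.\<close>

lemma translation_invariant_eq_lborel:
  fixes \<nu> :: "complex measure"
  assumes sets: "sets \<nu> = sets borel" and sf: "sigma_finite_measure \<nu>"
    and trans: "\<And>a. distr \<nu> borel ((+) a) = \<nu>" and sym: "distr \<nu> borel uminus = \<nu>"
    and ball: "emeasure \<nu> disc = emeasure lborel disc"
  shows "\<nu> = lborel"
proof (rule measure_eqI)
  fix A assume "A \<in> sets \<nu>"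
  then have A [measurable]: "A \<in> sets borel" using sets by simp
  interpret N: sigma_finite_measure \<nu> by (rule sf)
  interpret P: pair_sigma_finite \<nu> "lborel :: complex measure" ..
  have [measurable_cong]: "sets \<nu> = sets borel" by (rule sets)
  have [measurable]: "disc \<in> sets borel" by simp
  have sp: "space \<nu> = UNIV" using sets_eq_imp_space_eq[OF sets] by simp
  have nA: "(\<integral>\<^sup>+x. indicator A (x + y) \<partial>\<nu>) = emeasure \<nu> A" for y
  proof -
    have "emeasure \<nu> A = (\<integral>\<^sup>+x. indicator A x \<partial>distr \<nu> borel ((+) y))"
      using sets by (simp add: trans)
    also have "\<dots> = (\<integral>\<^sup>+x. indicator A (y + x) \<partial>\<nu>)"
      by (subst nn_integral_distr) auto
    finally show ?thesis by (simp add: add.commute)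
  qed
  have lA: "(\<integral>\<^sup>+y. indicator A (x + y) * indicator disc y \<partial>lborel)
      = (\<integral>\<^sup>+y. indicator A y * indicator disc (y - x) \<partial>lborel)" for x :: complex
  proof -
    have "(\<integral>\<^sup>+y. indicator A y * indicator disc (y - x) \<partial>lborel)
        = (\<integral>\<^sup>+y. indicator A y * indicator disc (y - x) \<partial>distr lborel borel ((+) x))"
      by (simp add: lborel_distr_plus)
    also have "\<dots> = (\<integral>\<^sup>+y. indicator A (x + y) * indicator disc y \<partial>lborel)"
      by (subst nn_integral_distr) auto
    finally show ?thesis by simp
  qed
  have nB: "(\<integral>\<^sup>+x. indicator disc (y - x) \<partial>\<nu>) = emeasure \<nu> disc" for y :: complex
  proof -
    have "emeasure \<nu> disc = (\<integral>\<^sup>+x. indicator disc x \<partial>distr \<nu> borel ((+) y))"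
      using sets by (simp add: trans)
    also have "\<dots> = (\<integral>\<^sup>+x. indicator disc (y + x) \<partial>distr \<nu> borel uminus)"
      unfolding sym by (subst nn_integral_distr) auto
    also have "\<dots> = (\<integral>\<^sup>+x. indicator disc (y - x) \<partial>\<nu>)"
      by (subst nn_integral_distr) auto
    finally show ?thesis by simp
  qed
  have "(\<integral>\<^sup>+y. \<integral>\<^sup>+x. indicator A (x + y) * indicator disc y \<partial>\<nu> \<partial>lborel)
      = emeasure \<nu> A * emeasure lborel disc"
    by (simp add: nn_integral_multc nA nn_integral_cmult)
  moreover have "(\<integral>\<^sup>+y. \<integral>\<^sup>+x. indicator A (x + y) * indicator disc y \<partial>\<nu> \<partial>lborel)
      = (\<integral>\<^sup>+x. \<integral>\<^sup>+y. indicator A (x + y) * indicator disc y \<partial>lborel \<partial>\<nu>)"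
    by (rule P.Fubini') measurable
  moreover have "\<dots> = (\<integral>\<^sup>+y. \<integral>\<^sup>+x. indicator A y * indicator disc (y - x) \<partial>\<nu> \<partial>lborel)"
    unfolding lA by (rule P.Fubini'[symmetric]) measurable
  moreover have "\<dots> = emeasure lborel A * emeasure \<nu> disc"
    by (simp add: nn_integral_cmult nB nn_integral_multc)
  ultimately have eq: "emeasure \<nu> A * emeasure lborel disc = emeasure lborel A * emeasure lborel disc"
    by (simp add: ball)
  have "emeasure lborel disc = ennreal pi"
    by (simp add: emeasure_ball unit_ball_vol_2)
  then show "emeasure \<nu> A = emeasure lborel A"
    using arg_cong[OF eq, of "\<lambda>x. x / ennreal pi"] by (simp add: mult_divide_eq_ennreal)
qed (simp add: sets)

lemma lborel_distr_rotation:
  assumes w: "cmod w = 1"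
  shows "distr lborel borel (\<lambda>z. w * z) = (lborel :: complex measure)"
proof (rule translation_invariant_eq_lborel)
  have w0: "w \<noteq> 0" using w by auto
  let ?R = "distr lborel borel (\<lambda>z. w * z) :: complex measure"
  show "sigma_finite_measure ?R"
  proof (rule sigma_finite_measure_distr[where f = "\<lambda>z. z / w" and N = borel])
    have "distr ?R borel (\<lambda>z. z / w) = distr lborel borel (\<lambda>z. z)"
      using w0 by (simp add: distr_distr comp_def)
    also have "\<dots> = lborel" using distr_id2[of borel lborel] by simp
    finally show "sigma_finite_measure (distr ?R borel (\<lambda>z. z / w))"
      by (simp add: lborel.sigma_finite_measure_axioms)
  qed simp
  show "distr ?R borel ((+) a) = ?R" for a
  proof -
    have "distr ?R borel ((+) a) = distr lborel borel (\<lambda>z. w * (a / w + z))"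
      using w0 by (simp add: distr_distr comp_def distrib_left)
    also have "\<dots> = distr (distr lborel borel ((+) (a / w))) borel (\<lambda>z. w * z)"
      by (subst distr_distr) (simp_all add: comp_def)
    finally show ?thesis by (simp add: lborel_distr_plus)
  qed
  show "distr ?R borel uminus = ?R"
  proof -
    have "distr ?R borel uminus = distr lborel borel (\<lambda>z. w * (- z))"
      by (simp add: distr_distr comp_def)
    also have "\<dots> = distr (distr lborel borel uminus) borel (\<lambda>z. w * z)"
      by (subst distr_distr) (simp_all add: comp_def)
    also have "distr lborel borel uminus = (lborel :: complex measure)"
      using lborel_affine[of "-1" "0::complex"] by (simp add: density_1)
    finally show ?thesis .
  qed
  show "emeasure ?R disc = emeasure lborel disc"
  proof -
    have "(\<lambda>z. w * z) -` disc = disc" using w by (auto simp: norm_mult)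
    then show ?thesis by (simp add: emeasure_distr)
  qed
qed simp

abbreviation disc_area :: "complex measure"
  where "disc_area \<equiv> uniform_measure lborel disc"

lemma emeasure_lborel_disc: "emeasure lborel disc = ennreal pi"
  by (simp add: emeasure_ball unit_ball_vol_2)

lemma finite_measure_disc_area: "finite_measure disc_area"
  by (rule finite_measureI) (simp add: emeasure_lborel_disc ennreal_divide_eq_top_iff)

lemma AE_disc_area: "(\<And>z. cmod z < 1 \<Longrightarrow> P z) \<Longrightarrow> AE z in disc_area. P z"
  by (rule AE_uniform_measureI) auto

lemma disc_area_rotation:
  fixes f :: "complex \<Rightarrow> complex"
  assumes w: "cmod w = 1" and f [measurable]: "f \<in> borel_measurable borel"
  shows "(LINT z|disc_area. f (w * z)) = (LINT z|disc_area. f z)"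
proof -
  have "distr disc_area borel (\<lambda>z. w * z) = disc_area"
  proof (rule measure_eqI)
    fix A assume "A \<in> sets (distr disc_area borel (\<lambda>z. w * z))"
    then have A [measurable]: "A \<in> sets borel" by simp
    have "emeasure lborel (disc \<inter> A) = emeasure (distr lborel borel (\<lambda>z. w * z)) (disc \<inter> A)"
      by (simp add: lborel_distr_rotation[OF w])
    also have "\<dots> = emeasure lborel ((\<lambda>z. w * z) -` (disc \<inter> A))"
      by (simp add: emeasure_distr)
    also have "(\<lambda>z. w * z) -` (disc \<inter> A) = disc \<inter> (\<lambda>z. w * z) -` A"
      using w by (auto simp: norm_mult)
    finally have "emeasure lborel (disc \<inter> A) = emeasure lborel (disc \<inter> (\<lambda>z. w * z) -` A)" .
    moreover have "(\<lambda>z. w * z) -` A \<in> sets borel"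
      by (rule measurable_sets_borel[of _ borel]) auto
    ultimately show "emeasure (distr disc_area borel (\<lambda>z. w * z)) A = emeasure disc_area A"
      by (simp add: emeasure_distr)
  qed simp
  then have "(LINT z|disc_area. f z) = (LINT z|distr disc_area borel (\<lambda>z. w * z). f z)" by simp
  also have "\<dots> = (LINT z|disc_area. f (w * z))"
    by (subst integral_distr) auto
  finally show ?thesis by simp
qed

text \<open>The disc \<open>|z|\<^sup>2 \<le> u\<close> has normalised area \<open>u\<close>.\<close>

lemma distr_disc_area_cmod_sq:
  "distr disc_area borel (\<lambda>z. (cmod z)\<^sup>2) = uniform_measure lborel {0..1::real}"
proof (rule measure_eqI_lessThan)
  interpret finite_measure disc_area by (rule finite_measure_disc_area)
  fix u :: real
  let ?S = "(\<lambda>z. (cmod z)\<^sup>2) -` {u<..} :: complex set"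
  have [measurable]: "?S \<in> sets borel" by (rule measurable_sets_borel[of _ borel]) auto
  have em: "emeasure (distr disc_area borel (\<lambda>z. (cmod z)\<^sup>2)) {u<..}
      = emeasure lborel (disc \<inter> ?S) / ennreal pi"
    by (simp add: emeasure_distr emeasure_lborel_disc)
  show "emeasure (distr disc_area borel (\<lambda>z. (cmod z)\<^sup>2)) {u<..} < \<infinity>"
    by (simp add: emeasure_distr emeasure_eq_measure)
  show "emeasure (distr disc_area borel (\<lambda>z. (cmod z)\<^sup>2)) {u<..}
      = emeasure (uniform_measure lborel {0..1}) {u<..}"
  proof (cases "u < 0")
    case True
    then have "disc \<inter> ?S = disc" "{0..1} \<inter> {u<..} = {0..1}" 
      by (auto intro: less_le_trans[OF _ zero_le_power2])
    then show ?thesis unfolding em by (simp add: emeasure_lborel_disc ennreal_divide_self)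
  next
    case u0: False
    show ?thesis
    proof (cases "u < 1")
      case True
      have S: "disc \<inter> ?S = disc - cball 0 (sqrt u)"
      proof -
        have "u < (cmod z)\<^sup>2 \<longleftrightarrow> sqrt u < cmod z" for z
          using real_sqrt_less_iff[of u "(cmod z)\<^sup>2"] by simp
        then show ?thesis by (auto simp: not_le)
      qed
      have sub: "cball 0 (sqrt u) \<subseteq> (disc :: complex set)"
      proof
        fix x :: complex assume "x \<in> cball 0 (sqrt u)"
        then have "cmod x \<le> sqrt u" by simp
        also have "sqrt u < 1" using True by simp
        finally show "x \<in> disc" by simp
      qed
      have cb: "emeasure lborel (cball (0::complex) (sqrt u)) = ennreal (pi * u)"
        using u0 by (simp add: emeasure_cball unit_ball_vol_2)
      have "emeasure lborel (disc \<inter> ?S) = ennreal pi - ennreal (pi * u)"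
        unfolding S using sub by (subst emeasure_Diff) (simp_all add: cb emeasure_lborel_disc)
      also have "\<dots> = ennreal (pi * (1 - u))"
        using u0 True by (simp add: ennreal_minus right_diff_distrib)
      finally have "emeasure lborel (disc \<inter> ?S) / ennreal pi = ennreal (1 - u)"
        using True by (simp add: divide_ennreal)
      moreover have "{0..1} \<inter> {u<..} = {u<..1}" using u0 by auto
      ultimately show ?thesis unfolding em using True divide_ennreal[of "1 - u" 1] by simp
    next
      case False
      have "disc \<inter> ?S = {}"
      proof -
        have "(cmod z)\<^sup>2 \<le> u" if "cmod z < 1" for z
          using that False power_le_one[of "cmod z" 2] by simp
        then show ?thesis by force
      qed
      moreover have "{0..1} \<inter> {u<..} = {}" using False by auto
      ultimately show ?thesis unfolding em by simp
    qed
  qed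
qed simp_all

text \<open>Cutting the weight \<open>(1 - |z|\<^sup>2)\<^sup>s\<close> down to \<open>(t - |z|\<^sup>2)\<^sub>+\<^sup>s\<close> with \<open>t < 1\<close> makes all integrands below
  bounded, is monotone in \<open>t\<close>, and still has explicit moments.\<close>

definition radial_weight :: "real \<Rightarrow> nat \<Rightarrow> complex \<Rightarrow> real"
  where "radial_weight t s z = (if (cmod z)\<^sup>2 < t then (t - (cmod z)\<^sup>2) ^ s else 0)"

lemma radial_weight_measurable [measurable]: "radial_weight t s \<in> borel_measurable borel"
  unfolding radial_weight_def by measurable

lemma radial_weight_nonneg: "0 \<le> radial_weight t s z"
  by (simp add: radial_weight_def)

lemma radial_weight_le_1: "t \<le> 1 \<Longrightarrow> radial_weight t s z \<le> 1"
proof -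
  assume "t \<le> 1"
  then have "t - (cmod z)\<^sup>2 \<le> 1" using zero_le_power2[of "cmod z"] by linarith
  then show ?thesis by (simp add: radial_weight_def power_le_one)
qed

text \<open>The Beta integral \<open>\<integral>\<^sub>0\<^sup>t u\<^sup>p (t - u)\<^sup>s du\<close>\<close>

definition beta_coeff :: "real \<Rightarrow> nat \<Rightarrow> nat \<Rightarrow> real"
  where "beta_coeff t p s = t ^ (p + s + 1) * fact p * fact s / fact (p + s + 1)"

lemma beta_integral:
  assumes t: "0 \<le> t"
  shows "has_bochner_integral lborel (\<lambda>u. (u ^ p * (t - u) ^ s) * indicator {0..t} u) (beta_coeff t p s)"
proof (induction s arbitrary: p)
  case 0
  have "has_bochner_integral lborel (\<lambda>u. (u ^ p * (t - u) ^ 0) * indicator {0..t} u)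
      (t ^ Suc p / Suc p - 0 ^ Suc p / Suc p)"
    by (rule has_bochner_integral_FTC_Icc_real[OF t])
      (auto intro!: derivative_eq_intros continuous_intros simp del: power_Suc)
  then show ?case by (simp add: beta_coeff_def)
next
  case (Suc s)
  \<comment> \<open>Integration by parts: \<open>?f\<close> is the derivative of \<open>u\<^sup>p\<^sup>+\<^sup>1 (t - u)\<^sup>s\<^sup>+\<^sup>1\<close>, which vanishes at both ends.\<close>
  let ?f = "\<lambda>u::real. Suc p * u ^ p * (t - u) ^ Suc s - Suc s * u ^ Suc p * (t - u) ^ s"
  have "has_bochner_integral lborel (\<lambda>u. ?f u * indicator {0..t} u)
      (t ^ Suc p * (t - t) ^ Suc s - 0 ^ Suc p * (t - 0) ^ Suc s)"
    by (rule has_bochner_integral_FTC_Icc_real[OF t])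
      (auto intro!: derivative_eq_intros continuous_intros simp del: power_Suc of_nat_Suc)
  then have "has_bochner_integral lborel (\<lambda>u. (?f u * indicator {0..t} u
      + Suc s * ((u ^ Suc p * (t - u) ^ s) * indicator {0..t} u)) / Suc p)
      ((0 + Suc s * beta_coeff t (Suc p) s) / Suc p)"
    by (intro has_bochner_integral_divide_zero has_bochner_integral_add
        has_bochner_integral_mult_right Suc.IH) simp_all
  moreover have "(?f u * indicator {0..t} u
      + Suc s * ((u ^ Suc p * (t - u) ^ s) * indicator {0..t} u)) / Suc p
      = (u ^ p * (t - u) ^ Suc s) * indicator {0..t} u" for u
    by (auto simp: field_simps split: split_indicator simp del: of_nat_Suc)
  moreover have "(0 + Suc s * beta_coeff t (Suc p) s) / Suc p = beta_coeff t p (Suc s)"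
    by (simp add: beta_coeff_def divide_simps del: of_nat_Suc) 
  ultimately show ?case by simp
qed

lemma disc_area_radial_moment:
  assumes t: "0 \<le> t" "t \<le> 1"
  shows "(LINT z|disc_area. ((cmod z)\<^sup>2) ^ p * radial_weight t s z) = beta_coeff t p s"
proof -
  let ?h = "\<lambda>u::real. u ^ p * (if u < t then (t - u) ^ s else 0)"
  have "(LINT z|disc_area. ((cmod z)\<^sup>2) ^ p * radial_weight t s z)
      = (LINT z|disc_area. ?h ((cmod z)\<^sup>2))"
    by (simp add: radial_weight_def)
  also have "\<dots> = (LINT u|distr disc_area borel (\<lambda>z. (cmod z)\<^sup>2). ?h u)"
    by (subst integral_distr) auto
  also have "\<dots> = (LINT u|density lborel (\<lambda>u. ennreal (indicator {0..1} u)). ?h u)"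
  proof -
    have "uniform_measure lborel {0..1::real} = density lborel (\<lambda>u. ennreal (indicator {0..1} u))"
      unfolding uniform_measure_def by (simp add: ennreal_indicator divide_ennreal_def)
    then show ?thesis by (simp only: distr_disc_area_cmod_sq)
  qed
  also have "\<dots> = (LINT u|lborel. indicator {0..1} u *\<^sub>R ?h u)"
    by (rule integral_density) auto
  also have "\<dots> = (LINT u|lborel. (u ^ p * (t - u) ^ s) * indicator {0..t} u)"
  proof (rule integral_cong_AE)
    have "AE u in lborel. u \<noteq> t" by (rule AE_lborel_singleton)
    then show "AE u in lborel. indicator {0..1} u *\<^sub>R ?h u = (u ^ p * (t - u) ^ s) * indicator {0..t} u"
      by eventually_elim (use t in \<open>auto split: split_indicator\<close>)
  qed auto
  also have "\<dots> = beta_coeff t p s"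
    by (rule has_bochner_integral_integral_eq[OF beta_integral[OF t(1)]])
  finally show ?thesis .
qed

definition monomial_weight :: "real \<Rightarrow> nat \<Rightarrow> nat \<Rightarrow> nat \<Rightarrow> complex \<Rightarrow> complex"
  where "monomial_weight t s p q z = z ^ p * cnj z ^ q * of_real (radial_weight t s z)"

lemma cnj_measurable [measurable]: "cnj \<in> borel_measurable borel"
  by (intro borel_measurable_continuous_onI continuous_intros)

lemma monomial_weight_measurable [measurable]: "monomial_weight t s p q \<in> borel_measurable borel"
  unfolding monomial_weight_def
  by (intro borel_measurable_times borel_measurable_power measurable_compose[OF _ cnj_measurable]) auto

lemma monomial_weight_le:
  assumes "t \<le> 1" "cmod z \<le> 1"
  shows "cmod (monomial_weight t s p q z) \<le> 1"
proof -
  have "cmod z ^ p * cmod z ^ q * radial_weight t s z \<le> 1 * 1 * 1"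
    using assms radial_weight_le_1[of t s z] radial_weight_nonneg[of t s z]
    by (intro mult_mono power_le_one mult_nonneg_nonneg) auto
  then show ?thesis
    by (simp add: monomial_weight_def norm_mult norm_power radial_weight_nonneg)
qed

lemma monomial_weight_integrable:
  assumes "t \<le> 1"
  shows "integrable disc_area (monomial_weight t s p q)"
proof (rule finite_measure.integrable_const_bound[OF finite_measure_disc_area, where B = 1])
  show "AE z in disc_area. cmod (monomial_weight t s p q z) \<le> 1"
    by (rule AE_disc_area) (simp add: monomial_weight_le[OF assms])
qed simp

text \<open>For \<open>p \<noteq> q\<close> a rotation by the angle \<open>\<pi> / (p - q)\<close> preserves area and the weight but changes the
  sign of the monomial.\<close>

lemma monomial_weight_integral:
  assumes t: "0 \<le> t" "t \<le> 1"
  shows "(LINT z|disc_area. monomial_weight t s p q z) = (if p = q then of_real (beta_coeff t p s) else 0)"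
proof (cases "p = q")
  case True
  have *: "monomial_weight t s p p z = of_real (((cmod z)\<^sup>2) ^ p * radial_weight t s z)" for z
  proof -
    have "z ^ p * cnj z ^ p = (of_real ((cmod z)\<^sup>2)) ^ p"
      by (simp only: complex_norm_square power_mult_distrib)
    then show ?thesis by (simp add: monomial_weight_def)
  qed
  have "(LINT z|disc_area. monomial_weight t s p p z) = of_real (beta_coeff t p s)"
    unfolding * integral_complex_of_real disc_area_radial_moment[OF t] ..
  with True show ?thesis by simp
next
  case False
  let ?J = "LINT z|disc_area. monomial_weight t s p q z"
  have rot: "?J = w ^ p * cnj w ^ q * ?J" if w: "cmod w = 1" for w
  proof -
    have "monomial_weight t s p q (w * z) = w ^ p * cnj w ^ q * monomial_weight t s p q z" for z
      using w by (simp add: monomial_weight_def radial_weight_def norm_mult power_mult_distrib)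
    then show ?thesis
      using disc_area_rotation[OF w monomial_weight_measurable, of t s p q] by simp
  qed
  let ?d = "real_of_int (int p - int q)"
  define \<alpha> where "\<alpha> = pi / ?d"
  define w where "w = cis \<alpha>"
  have "w ^ p * cnj w ^ q = cis (\<alpha> * ?d)"
    by (simp add: w_def cis_cnj Complex.DeMoivre cis_mult algebra_simps)
  also have "\<dots> = -1" using False by (simp add: \<alpha>_def)
  finally have "?J = - ?J" using rot[of w] by (simp add: w_def)
  then show ?thesis using False by simp
qed

text \<open>The Fourier expansion of the Poisson kernel, with \<open>z cnj \<zeta> = r e\<^sup>i\<^sup>\<theta>\<close>.\<close>

lemma poisson_kernel_series:
  assumes z: "cmod z < 1" and \<zeta>: "\<zeta> \<in> circle"
  shows "(\<lambda>k. (z * cnj \<zeta>) ^ k + cnj (z * cnj \<zeta>) ^ k) sums (of_real (poisson_kernel z \<zeta>) + 1)"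
proof -
  define v where "v = z * cnj \<zeta>"
  have \<zeta>1: "cmod \<zeta> = 1" using \<zeta> by simp
  then have \<zeta>\<zeta>: "\<zeta> * cnj \<zeta> = 1" by (simp flip: complex_norm_square)
  have v: "cmod v = cmod z" using \<zeta>1 by (simp add: v_def norm_mult)
  have ne: "1 - v \<noteq> 0" "1 - cnj v \<noteq> 0"
    using v z by (auto simp: complex_eq_iff cmod_def)
  have "z - \<zeta> = \<zeta> * (v - 1)"
    using \<zeta>\<zeta> by (simp add: v_def algebra_simps)
  then have "cmod (z - \<zeta>) = cmod (1 - v)"
    using \<zeta>1 by (simp add: norm_mult norm_minus_commute)
  then have "complex_of_real (poisson_kernel z \<zeta>) = of_real (1 - (cmod v)\<^sup>2) / of_real ((cmod (1 - v))\<^sup>2)"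
    by (simp add: poisson_kernel_def v)
  also have "\<dots> = (1 - v * cnj v) / ((1 - v) * (1 - cnj v))"
    unfolding of_real_diff complex_norm_square by simp
  also have "\<dots> = 1 / (1 - v) + 1 / (1 - cnj v) - 1"
    using ne by (simp add: divide_simps) (simp add: algebra_simps)
  finally have "of_real (poisson_kernel z \<zeta>) + 1 = 1 / (1 - v) + 1 / (1 - cnj v)" by simp
  moreover have "(\<lambda>k. v ^ k + cnj v ^ k) sums (1 / (1 - v) + 1 / (1 - cnj v))"
    using v z by (intro sums_add geometric_sums) simp_all
  ultimately show ?thesis by (simp add: v_def)
qed

lemma norm_geometric_partial_le:
  assumes "cmod v \<le> r" "r < 1"
  shows "cmod (\<Sum>k<N. v ^ k) \<le> 1 / (1 - r)"
proof -
  have r: "0 \<le> r" using norm_ge_zero[of v] assms(1) by linarith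
  have "cmod (\<Sum>k<N. v ^ k) \<le> (\<Sum>k<N. r ^ k)"
    using assms by (intro sum_norm_le) (simp add: norm_power power_mono)
  also have "\<dots> \<le> (\<Sum>k. r ^ k)"
    using r assms by (intro sum_le_suminf summable_geometric) auto
  also have "\<dots> = 1 / (1 - r)" using r assms by (intro suminf_geometric) auto
  finally show ?thesis .
qed

lemma radial_weight_eq_0: "sqrt t \<le> cmod z \<Longrightarrow> 0 \<le> t \<Longrightarrow> radial_weight t s z = 0"
proof -
  assume "sqrt t \<le> cmod z" "0 \<le> t"
  then have "(sqrt t)\<^sup>2 \<le> (cmod z)\<^sup>2" by (intro power_mono) auto
  then show ?thesis using \<open>0 \<le> t\<close> by (simp add: radial_weight_def)
qed

text \<open>Only the term of the Fourier expansion of matching angular frequency survives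
  integration against a monomial.\<close>

lemma poisson_kernel_moment:
  assumes t: "0 \<le> t" "t < 1" and \<zeta>: "\<zeta> \<in> circle"
  shows "(LINT z|disc_area. of_real (poisson_kernel z \<zeta>) * monomial_weight t s p q z)
    = \<zeta> ^ p * cnj \<zeta> ^ q * of_real (beta_coeff t (max p q) s)"
proof -
  define S where "S N z = (\<Sum>k<N. (z * cnj \<zeta>) ^ k + cnj (z * cnj \<zeta>) ^ k) - 1" for N z
  let ?m = "monomial_weight t s"
  have rt: "sqrt t < 1" using t by simp
  have \<zeta>1: "cmod \<zeta> = 1" using \<zeta> by simp
  then have \<zeta>\<zeta>: "\<zeta> * cnj \<zeta> = 1" by (simp flip: complex_norm_square)
  have S_expand: "S N z * ?m p q z
      = (\<Sum>k<N. cnj \<zeta> ^ k * ?m (p + k) q z + \<zeta> ^ k * ?m p (q + k) z) - ?m p q z" for N z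
  proof -
    have "((z * cnj \<zeta>) ^ k + cnj (z * cnj \<zeta>) ^ k) * ?m p q z
        = cnj \<zeta> ^ k * ?m (p + k) q z + \<zeta> ^ k * ?m p (q + k) z" for k
      by (simp add: monomial_weight_def power_mult_distrib power_add algebra_simps)
    then show ?thesis by (simp only: S_def left_diff_distrib sum_distrib_right mult_1)
  qed
  have int: "(LINT z|disc_area. S N z * ?m p q z) = (\<Sum>k<N. cnj \<zeta> ^ k * (LINT z|disc_area. ?m (p + k) q z)
      + \<zeta> ^ k * (LINT z|disc_area. ?m p (q + k) z)) - (LINT z|disc_area. ?m p q z)" for N
  proof -
    note i = monomial_weight_integrable[OF less_imp_le[OF t(2)]]
    have 1: "integrable disc_area (\<lambda>z. cnj \<zeta> ^ k * ?m (p + k) q z)"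
      and 2: "integrable disc_area (\<lambda>z. \<zeta> ^ k * ?m p (q + k) z)" for k
      using i by (intro integrable_mult_right; blast)+
    show ?thesis
      unfolding S_expand
      using 1 2 i by simp
  qed
  have val: "(LINT z|disc_area. S N z * ?m p q z)
      = \<zeta> ^ p * cnj \<zeta> ^ q * of_real (beta_coeff t (max p q) s)" if N: "max p q < N" for N
  proof -
    let ?b = "\<lambda>p. complex_of_real (beta_coeff t p s)"
    have 1: "(\<Sum>k<N. cnj \<zeta> ^ k * (if p + k = q then ?b (p + k) else 0))
        = (if p \<le> q then cnj \<zeta> ^ (q - p) * ?b q else 0)"
    proof -
      have "(\<Sum>k<N. cnj \<zeta> ^ k * (if p + k = q then ?b (p + k) else 0))
          = (\<Sum>k<N. if k = q - p then (if p \<le> q then cnj \<zeta> ^ (q - p) * ?b q else 0) else 0)"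
        by (rule sum.cong) auto
      then show ?thesis using N by (simp add: sum.delta less_imp_diff_less)
    qed
    have 2: "(\<Sum>k<N. \<zeta> ^ k * (if p = q + k then ?b p else 0))
        = (if q \<le> p then \<zeta> ^ (p - q) * ?b p else 0)"
    proof -
      have "(\<Sum>k<N. \<zeta> ^ k * (if p = q + k then ?b p else 0))
          = (\<Sum>k<N. if k = p - q then (if q \<le> p then \<zeta> ^ (p - q) * ?b p else 0) else 0)"
        by (rule sum.cong) auto
      then show ?thesis using N by (simp add: sum.delta less_imp_diff_less)
    qed
    have le: "\<zeta> ^ p * cnj \<zeta> ^ q = cnj \<zeta> ^ (q - p)" if "p \<le> q"
    proof -
      have "\<zeta> ^ p * cnj \<zeta> ^ q = (\<zeta> * cnj \<zeta>) ^ p * cnj \<zeta> ^ (q - p)"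
        using that by (simp add: power_mult_distrib mult.assoc flip: power_add)
      then show ?thesis by (simp add: \<zeta>\<zeta>)
    qed
    have ge: "\<zeta> ^ p * cnj \<zeta> ^ q = \<zeta> ^ (p - q)" if "q \<le> p"
    proof -
      have "\<zeta> ^ p * cnj \<zeta> ^ q = \<zeta> ^ (p - q) * (\<zeta> * cnj \<zeta>) ^ q"
        using that by (simp add: power_mult_distrib mult.assoc[symmetric] flip: power_add)
      then show ?thesis by (simp add: \<zeta>\<zeta>)
    qed
    have "(LINT z|disc_area. S N z * ?m p q z)
        = (if p \<le> q then cnj \<zeta> ^ (q - p) * ?b q else 0) + (if q \<le> p then \<zeta> ^ (p - q) * ?b p else 0)
          - (if p = q then ?b p else 0)"
      unfolding int monomial_weight_integral[OF t(1) less_imp_le[OF t(2)]] sum.distrib 1 2 ..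
    also have "\<dots> = \<zeta> ^ p * cnj \<zeta> ^ q * ?b (max p q)"
      using le ge by (cases "p < q"; cases "p = q") (simp_all add: max_def)
    finally show ?thesis .
  qed
  have meas: "S N \<in> borel_measurable borel" for N
    unfolding S_def
    by (intro borel_measurable_continuous_onI continuous_intros)
  have "(\<lambda>N. LINT z|disc_area. S N z * ?m p q z)
      \<longlonglongrightarrow> (LINT z|disc_area. of_real (poisson_kernel z \<zeta>) * ?m p q z)"
  proof (rule integral_dominated_convergence[where w = "\<lambda>_. 2 / (1 - sqrt t) + 1"])
    show "(\<lambda>z. of_real (poisson_kernel z \<zeta>) * ?m p q z) \<in> borel_measurable disc_area"
      unfolding poisson_kernel_def by measurable
    show "(\<lambda>z. S N z * ?m p q z) \<in> borel_measurable disc_area" for N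
      using meas by measurable
    show "integrable disc_area (\<lambda>_. 2 / (1 - sqrt t) + 1)"
      using finite_measure_disc_area by (rule finite_measure.integrable_const)
    show "AE z in disc_area. (\<lambda>N. S N z * ?m p q z) \<longlonglongrightarrow> of_real (poisson_kernel z \<zeta>) * ?m p q z"
    proof (rule AE_disc_area)
      fix z :: complex assume "cmod z < 1"
      from poisson_kernel_series[OF this \<zeta>]
      have "(\<lambda>N. S N z) \<longlonglongrightarrow> (of_real (poisson_kernel z \<zeta>) + 1) - 1"
        unfolding sums_def S_def by (intro tendsto_diff tendsto_const)
      then show "(\<lambda>N. S N z * ?m p q z) \<longlonglongrightarrow> of_real (poisson_kernel z \<zeta>) * ?m p q z"
        by (intro tendsto_mult tendsto_const) simp
    qed
    show "AE z in disc_area. cmod (S N z * ?m p q z) \<le> 2 / (1 - sqrt t) + 1" for N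
    proof (rule AE_disc_area)
      fix z :: complex assume z: "cmod z < 1"
      show "cmod (S N z * ?m p q z) \<le> 2 / (1 - sqrt t) + 1"
      proof (cases "sqrt t \<le> cmod z")
        case True
        then show ?thesis using t rt by (simp add: monomial_weight_def radial_weight_eq_0)
      next
        case False
        have v: "cmod (z * cnj \<zeta>) \<le> sqrt t" "cmod (cnj (z * cnj \<zeta>)) \<le> sqrt t"
          using False by (simp_all add: norm_mult \<zeta>1)
        have "cmod (S N z) \<le> cmod (\<Sum>k<N. (z * cnj \<zeta>) ^ k) + cmod (\<Sum>k<N. (cnj (z * cnj \<zeta>)) ^ k) + cmod 1"
          unfolding S_def sum.distrib by (meson norm_triangle_ineq norm_triangle_ineq4 order_trans add_right_mono)
        also have "\<dots> \<le> 1 / (1 - sqrt t) + 1 / (1 - sqrt t) + 1"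
          using norm_geometric_partial_le[OF v(1) rt] norm_geometric_partial_le[OF v(2) rt]
          by (intro add_mono) simp_all
        finally have "cmod (S N z) \<le> 2 / (1 - sqrt t) + 1" by simp
        moreover have "cmod (?m p q z) \<le> 1" using t z by (intro monomial_weight_le) simp_all
        ultimately have "cmod (S N z) * cmod (?m p q z) \<le> (2 / (1 - sqrt t) + 1) * 1"
          using rt by (intro mult_mono) auto
        then show ?thesis by (simp add: norm_mult)
      qed
    qed
  qed
  moreover have "(\<lambda>N. LINT z|disc_area. S N z * ?m p q z)
      \<longlonglongrightarrow> \<zeta> ^ p * cnj \<zeta> ^ q * of_real (beta_coeff t (max p q) s)"
    by (rule tendsto_eventually, rule eventually_mono[OF eventually_gt_at_top[of "max p q"]]) (rule val)
  ultimately show ?thesis by (rule LIMSEQ_unique)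
qed

context semi_spectral
begin

text \<open>\<open>\<langle>P\<^sub>\<mu>(z)x, y\<rangle>\<close>\<close>

definition poisson_form :: "complex \<Rightarrow> 'e \<Rightarrow> 'e \<Rightarrow> complex"
  where "poisson_form z x y = form x y (\<lambda>\<zeta>. of_real (poisson_kernel z \<zeta>))"

lemma circle_bounded_monomial: "circle_bounded (\<lambda>\<zeta>. \<zeta> ^ p * cnj \<zeta> ^ q) 1"
  unfolding circle_bounded_def
  by (intro conjI borel_measurable_times borel_measurable_power measurable_compose[OF _ cnj_measurable])
    (auto simp: norm_mult norm_power)

text \<open>Fubini's theorem reduces the moments of the Poisson integral to those of the kernel; the
  integrand is bounded because the weight vanishes for \<open>|z|\<^sup>2 \<ge> t\<close>.\<close>

lemma diag_measure_poisson_moment: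
  assumes t: "0 \<le> t" "t < 1"
  shows "integrable disc_area (\<lambda>z. (LINT \<zeta>|diag_measure \<mu> x. of_real (poisson_kernel z \<zeta>))
      * monomial_weight t s p q z)"
    and "(LINT z|disc_area. (LINT \<zeta>|diag_measure \<mu> x. of_real (poisson_kernel z \<zeta>))
      * monomial_weight t s p q z)
    = (LINT \<zeta>|diag_measure \<mu> x. \<zeta> ^ p * cnj \<zeta> ^ q) * of_real (beta_coeff t (max p q) s)"
proof -
  let ?D = "diag_measure \<mu> x"
  let ?m = "monomial_weight t s p q"
  let ?f = "\<lambda>z \<zeta>. of_real (poisson_kernel z \<zeta>) * ?m z"
  have rt: "sqrt t < 1" using t by simp
  interpret D: finite_measure ?D by (rule finite_diag_measure)
  interpret U: finite_measure disc_area by (rule finite_measure_disc_area)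
  interpret P: pair_sigma_finite disc_area ?D ..
  interpret PF: finite_measure "disc_area \<Otimes>\<^sub>M ?D"
    by (rule finite_measure_pair_measure) (rule finite_measure_disc_area finite_diag_measure)+
  have id: "(\<lambda>\<zeta>. \<zeta>) \<in> borel_measurable ?D" by (rule borel_measurable_circle) auto
  have fst: "fst \<in> borel_measurable (disc_area \<Otimes>\<^sub>M ?D)"
    using measurable_fst[of disc_area ?D] by (simp add: measurable_cong_sets[OF refl sets_uniform_measure])
  have snd: "snd \<in> borel_measurable (disc_area \<Otimes>\<^sub>M ?D)"
    using measurable_compose[OF measurable_snd[of disc_area ?D] id] by simp
  have "integrable (disc_area \<Otimes>\<^sub>M ?D) (case_prod ?f)"
  proof (rule PF.integrable_const_bound[where B = "1 / (1 - sqrt t)\<^sup>2"])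
    show "case_prod ?f \<in> borel_measurable (disc_area \<Otimes>\<^sub>M ?D)"
      unfolding case_prod_beta'
      using measurable_compose[OF measurable_Pair[OF fst snd] poisson_kernel_measurable(2)]
        measurable_compose[OF fst monomial_weight_measurable[of t s p q]]
      by simp
    show "AE p in disc_area \<Otimes>\<^sub>M ?D. cmod (case p of (z, \<zeta>) \<Rightarrow> ?f z \<zeta>) \<le> 1 / (1 - sqrt t)\<^sup>2"
    proof (rule AE_I2, clarify)
      fix z \<zeta> assume "(z, \<zeta>) \<in> space (disc_area \<Otimes>\<^sub>M ?D)"
      then have \<zeta>: "\<zeta> \<in> circle" by (simp add: space_pair_measure)
      show "cmod (?f z \<zeta>) \<le> 1 / (1 - sqrt t)\<^sup>2"
      proof (cases "sqrt t \<le> cmod z")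
        case True
        then show ?thesis using t by (simp add: monomial_weight_def radial_weight_eq_0)
      next
        case False
        then have z: "cmod z \<le> sqrt t" by simp
        then have "cmod z \<le> 1" using rt by linarith
        then have "cmod (?m z) \<le> 1" using t by (intro monomial_weight_le) auto
        then have "cmod (?f z \<zeta>) \<le> 1 / (1 - sqrt t)\<^sup>2 * 1"
          using poisson_kernel_bound[OF z rt \<zeta>] unfolding norm_mult by (intro mult_mono) auto
        then show ?thesis by simp
      qed
    qed
  qed
  note int = P.integrable_fst[OF this] P.integral_fst[OF this] P.integral_snd[OF this]
  have inner: "(LINT \<zeta>|?D. ?f z \<zeta>) = (LINT \<zeta>|?D. of_real (poisson_kernel z \<zeta>)) * ?m z" for z
    by (rule integral_mult_left_zero)
  show "integrable disc_area (\<lambda>z. (LINT \<zeta>|?D. of_real (poisson_kernel z \<zeta>)) * ?m z)"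
    using int(1) by (simp only: inner)
  have "(LINT z|disc_area. (LINT \<zeta>|?D. of_real (poisson_kernel z \<zeta>)) * ?m z)
      = (LINT \<zeta>|?D. LINT z|disc_area. ?f z \<zeta>)"
    unfolding int(3) inner[symmetric] by (rule int(2))
  also have "\<dots> = (LINT \<zeta>|?D. \<zeta> ^ p * cnj \<zeta> ^ q * of_real (beta_coeff t (max p q) s))"
    by (rule Bochner_Integration.integral_cong) (simp_all add: poisson_kernel_moment[OF t])
  also have "\<dots> = (LINT \<zeta>|?D. \<zeta> ^ p * cnj \<zeta> ^ q) * of_real (beta_coeff t (max p q) s)"
    by (rule integral_mult_left_zero)
  finally show "(LINT z|disc_area. (LINT \<zeta>|?D. of_real (poisson_kernel z \<zeta>)) * ?m z)
    = (LINT \<zeta>|?D. \<zeta> ^ p * cnj \<zeta> ^ q) * of_real (beta_coeff t (max p q) s)" .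
qed

lemma poisson_form_moment:
  assumes t: "0 \<le> t" "t < 1"
  shows "integrable disc_area (\<lambda>z. poisson_form z x y * monomial_weight t s p q z)"
    and "(LINT z|disc_area. poisson_form z x y * monomial_weight t s p q z)
      = form x y (\<lambda>\<zeta>. \<zeta> ^ p * cnj \<zeta> ^ q) * of_real (beta_coeff t (max p q) s)"
proof -
  let ?I = "\<lambda>k::nat. \<lambda>z. (LINT \<zeta>|diag_measure \<mu> (x + \<i> ^ k *\<^sub>C y). of_real (poisson_kernel z \<zeta>))
      * monomial_weight t s p q z"
  note m = diag_measure_poisson_moment[OF t]
  have expand: "poisson_form z x y * monomial_weight t s p q z = (\<Sum>k<4. \<i> ^ k / 4 * ?I k z)" for z
    by (simp add: poisson_form_def form_def sum_divide_distrib sum_distrib_left sum_distrib_right mult_ac)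
  have int: "integrable disc_area (\<lambda>z. \<i> ^ k / 4 * ?I k z)" for k
    by (intro integrable_mult_right m)
  show "integrable disc_area (\<lambda>z. poisson_form z x y * monomial_weight t s p q z)"
    unfolding expand by (intro Bochner_Integration.integrable_sum int)
  have "(LINT z|disc_area. poisson_form z x y * monomial_weight t s p q z)
      = (\<Sum>k<4. \<i> ^ k / 4 * (LINT z|disc_area. ?I k z))"
    unfolding expand by (subst Bochner_Integration.integral_sum) (use int in auto)
  also have "\<dots> = form x y (\<lambda>\<zeta>. \<zeta> ^ p * cnj \<zeta> ^ q) * of_real (beta_coeff t (max p q) s)"
    unfolding m(2) form_def
    by (simp add: sum_divide_distrib sum_distrib_left sum_distrib_right mult_ac)
  finally show "(LINT z|disc_area. poisson_form z x y * monomial_weight t s p q z)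
      = form x y (\<lambda>\<zeta>. \<zeta> ^ p * cnj \<zeta> ^ q) * of_real (beta_coeff t (max p q) s)" .
qed

end

section \<open>Vector-valued power series on the disc\<close>

definition disc_convergent :: "(nat \<Rightarrow> 'e::chilbert_space) \<Rightarrow> bool"
  where "disc_convergent a \<longleftrightarrow> (\<forall>r. 0 \<le> r \<and> r < 1 \<longrightarrow> summable (\<lambda>j. norm (a j) * r ^ j))"

definition pseries :: "(nat \<Rightarrow> 'e::chilbert_space) \<Rightarrow> complex \<Rightarrow> 'e"
  where "pseries a z = (\<Sum>j. z ^ j *\<^sub>C a j)"

definition dcoeff :: "(nat \<Rightarrow> 'e::chilbert_space) \<Rightarrow> nat \<Rightarrow> 'e"
  where "dcoeff a j = of_nat (Suc j) *\<^sub>C a (Suc j)"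

lemma disc_convergent_dcoeff:
  assumes a: "disc_convergent a"
  shows "disc_convergent (dcoeff a)"
  unfolding disc_convergent_def
proof (intro allI impI)
  fix r :: real assume r: "0 \<le> r \<and> r < 1"
  have "summable (\<lambda>n. norm (a n) * x ^ n)" if "norm x < 1" for x :: real
  proof (rule summable_rabs_cancel)
    show "summable (\<lambda>n. \<bar>norm (a n) * x ^ n\<bar>)"
      using a that by (simp add: disc_convergent_def abs_mult power_abs)
  qed
  then have "summable (\<lambda>n. diffs (\<lambda>n. norm (a n)) n * r ^ n)"
    using r by (intro termdiff_converges[of r 1]) auto
  moreover have "norm (dcoeff a n) = diffs (\<lambda>n. norm (a n)) n" for n
    by (simp only: dcoeff_def diffs_def norm_scaleC norm_of_nat)
  ultimately show "summable (\<lambda>j. norm (dcoeff a j) * r ^ j)" by simp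
qed

lemma disc_convergent_dcoeff_funpow: "disc_convergent a \<Longrightarrow> disc_convergent ((dcoeff ^^ n) a)"
  by (induction n) (simp_all add: disc_convergent_dcoeff)

lemma dcoeff_funpow: "(dcoeff ^^ n) a j = of_real (fact (j + n) / fact j) *\<^sub>C a (j + n)"
proof (induction n arbitrary: j)
  case (Suc n)
  have "(dcoeff ^^ Suc n) a j = of_nat (Suc j) *\<^sub>C of_real (fact (Suc j + n) / fact (Suc j)) *\<^sub>C a (Suc j + n)"
    by (simp add: dcoeff_def Suc del: of_nat_Suc)
  also have "\<dots> = (of_real (real (Suc j) * (fact (Suc j + n) / fact (Suc j)))) *\<^sub>C a (Suc j + n)"
    unfolding scaleC_scaleC of_real_mult of_real_of_nat_eq ..
  also have "real (Suc j) * (fact (Suc j + n) / fact (Suc j)) = fact (j + Suc n) / fact j"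
    by (simp add: divide_simps del: of_nat_Suc) 
  finally show ?case by simp
qed simp

lemma disc_convergent_if_bounded:
  assumes "\<And>j. norm (a j) \<le> A"
  shows "disc_convergent a"
  unfolding disc_convergent_def
proof (intro allI impI)
  fix r :: real assume r: "0 \<le> r \<and> r < 1"
  show "summable (\<lambda>j. norm (a j) * r ^ j)"
  proof (rule summable_comparison_test)
    show "\<exists>N. \<forall>n\<ge>N. norm (norm (a n) * r ^ n) \<le> A * r ^ n"
      using assms r by (intro exI[of _ 0]) (simp add: mult_right_mono)
    show "summable (\<lambda>n. A * r ^ n)"
      using r by (intro summable_mult summable_geometric) auto
  qed
qed

lemma pseries_sums:
  assumes a: "disc_convergent a" and z: "cmod z < 1"
  shows "(\<lambda>j. z ^ j *\<^sub>C a j) sums pseries a z"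
  unfolding pseries_def
proof (rule summable_sums, rule summable_norm_cancel)
  have "norm (z ^ j *\<^sub>C a j) = norm (a j) * cmod z ^ j" for j
    by (simp add: norm_power)
  then show "summable (\<lambda>j. norm (z ^ j *\<^sub>C a j))"
    using a z by (simp add: disc_convergent_def del: norm_scaleC)
qed

lemma pseries_uniform:
  assumes a: "disc_convergent a" and r: "0 \<le> r" "r < 1"
  shows "uniform_limit (cball 0 r) (\<lambda>N z. \<Sum>j<N. z ^ j *\<^sub>C a j) (pseries a) sequentially"
  unfolding pseries_def
proof (rule Weierstrass_m_test)
  show "norm (z ^ j *\<^sub>C a j) \<le> norm (a j) * r ^ j" if "z \<in> cball 0 r" for j z
  proof -
    have "cmod z ^ j \<le> r ^ j" using that by (intro power_mono) auto
    then show ?thesis using mult_right_mono[of "cmod z ^ j" "r ^ j" "norm (a j)"]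
      by (simp add: norm_power mult.commute)
  qed
  show "summable (\<lambda>j. norm (a j) * r ^ j)"
    using a r by (simp add: disc_convergent_def)
qed

lemma pseries_partial_bound:
  assumes a: "disc_convergent a" and r: "0 \<le> r" "r < 1" and z: "cmod z \<le> r"
  shows "norm (\<Sum>j<N. z ^ j *\<^sub>C a j) \<le> (\<Sum>j. norm (a j) * r ^ j)"
proof -
  have "norm (\<Sum>j<N. z ^ j *\<^sub>C a j) \<le> (\<Sum>j<N. norm (a j) * r ^ j)"
  proof (rule sum_norm_le)
    fix j
    have "cmod z ^ j \<le> r ^ j" using z by (intro power_mono) auto
    then show "norm (z ^ j *\<^sub>C a j) \<le> norm (a j) * r ^ j"
      using mult_right_mono[of "cmod z ^ j" "r ^ j" "norm (a j)"]
      by (simp add: norm_power mult.commute)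
  qed
  also have "\<dots> \<le> (\<Sum>j. norm (a j) * r ^ j)"
    using a r by (intro sum_le_suminf) (auto simp: disc_convergent_def)
  finally show ?thesis .
qed

lemma has_derivative_power_scaleC:
  fixes c :: "'e::chilbert_space"
  shows "((\<lambda>z. z ^ n *\<^sub>C c) has_derivative (\<lambda>h. h *\<^sub>C ((of_nat n * z ^ (n - 1)) *\<^sub>C c))) (at z within S)"
proof -
  have "((\<lambda>z. z ^ n) has_derivative (\<lambda>h. h * (of_nat n * z ^ (n - 1)))) (at z within S)"
    by (auto intro!: derivative_eq_intros simp: fun_eq_iff mult_ac)
  from bounded_linear.has_derivative[OF bounded_bilinear.bounded_linear_left[OF bounded_bilinear_scaleC] this, of c]
  show ?thesis by (simp add: scaleC_scaleC)
qed

text \<open>Termwise differentiation: the differentiated series converges uniformly on smaller discs.\<close>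

lemma has_cderiv_pseries:
  assumes a: "disc_convergent a" and z: "cmod z < 1"
  shows "has_cderiv (pseries a) (pseries (dcoeff a) z) z"
proof -
  define r where "r = (1 + cmod z) / 2"
  have r: "0 \<le> r" "r < 1" "cmod z < r" using z by (simp_all add: r_def)
  let ?S = "ball (0::complex) r"
  have "\<exists>g. \<forall>x\<in>?S. (\<lambda>n. x ^ n *\<^sub>C a n) sums (g x) \<and>
      (g has_derivative (\<lambda>h. h *\<^sub>C pseries (dcoeff a) x)) (at x within ?S)"
  proof (rule has_derivative_series)
    show "convex ?S" by simp
    show "((\<lambda>x. x ^ n *\<^sub>C a n) has_derivative
        (\<lambda>h. h *\<^sub>C ((of_nat n * x ^ (n - 1)) *\<^sub>C a n))) (at x within ?S)" for n x
      by (rule has_derivative_power_scaleC)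
    show "0 \<in> ?S" using le_less_trans[OF norm_ge_zero r(3)] by simp
    show "(\<lambda>n. 0 ^ n *\<^sub>C a n) sums pseries a 0" by (rule pseries_sums[OF a]) simp
    fix e :: real assume e: "e > 0"
    have "\<forall>\<^sub>F N in sequentially. \<forall>x\<in>cball 0 r.
        dist (\<Sum>j<N. x ^ j *\<^sub>C dcoeff a j) (pseries (dcoeff a) x) < e"
      using pseries_uniform[OF disc_convergent_dcoeff[OF a] r(1,2)] e unfolding uniform_limit_iff by blast
    then obtain N where N: "\<And>n x. n \<ge> N \<Longrightarrow> x \<in> cball 0 r \<Longrightarrow>
        dist (\<Sum>j<n. x ^ j *\<^sub>C dcoeff a j) (pseries (dcoeff a) x) < e"
      unfolding eventually_sequentially by blast
    have "norm ((\<Sum>i<n. h *\<^sub>C ((of_nat i * x ^ (i - 1)) *\<^sub>C a i)) - h *\<^sub>C pseries (dcoeff a) x) \<le> e * norm h"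
      if n: "n \<ge> Suc N" and x: "x \<in> ?S" for n x h
    proof -
      obtain m where m: "n = Suc m" "m \<ge> N" using n by (cases n) auto
      have "(\<Sum>i<n. h *\<^sub>C ((of_nat i * x ^ (i - 1)) *\<^sub>C a i)) = h *\<^sub>C (\<Sum>j<m. x ^ j *\<^sub>C dcoeff a j)"
        unfolding m(1) sum.lessThan_Suc_shift
        by (simp add: dcoeff_def scaleC_scaleC scaleC_sum_right mult.commute)
      then have "norm ((\<Sum>i<n. h *\<^sub>C ((of_nat i * x ^ (i - 1)) *\<^sub>C a i)) - h *\<^sub>C pseries (dcoeff a) x)
          = norm h * dist (\<Sum>j<m. x ^ j *\<^sub>C dcoeff a j) (pseries (dcoeff a) x)"
        by (simp add: dist_norm flip: scaleC_diff_right)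
      also have "\<dots> \<le> norm h * e"
        using N[OF m(2), of x] x by (intro mult_left_mono) auto
      finally show ?thesis by (simp add: mult.commute)
    qed
    then show "\<forall>\<^sub>F n in sequentially. \<forall>x\<in>?S. \<forall>h.
        norm ((\<Sum>i<n. h *\<^sub>C ((of_nat i * x ^ (i - 1)) *\<^sub>C a i)) - h *\<^sub>C pseries (dcoeff a) x) \<le> e * norm h"
      unfolding eventually_sequentially by blast
  qed
  then obtain g where g: "\<And>x. x \<in> ?S \<Longrightarrow> (\<lambda>n. x ^ n *\<^sub>C a n) sums g x"
    and dg: "\<And>x. x \<in> ?S \<Longrightarrow> (g has_derivative (\<lambda>h. h *\<^sub>C pseries (dcoeff a) x)) (at x within ?S)"
    by blast
  have zS: "z \<in> ?S" using r by simp
  have "(g has_derivative (\<lambda>h. h *\<^sub>C pseries (dcoeff a) z)) (at z)"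
    using dg[OF zS] by (simp add: at_within_open[OF zS])
  moreover have "g x = pseries a x" if "x \<in> ?S" for x
    using sums_unique2[OF g[OF that] pseries_sums[OF a]] that r by simp
  ultimately show ?thesis
    unfolding has_cderiv_def
    using has_derivative_transform_within_open[of g _ z UNIV ?S "pseries a"] zS by simp
qed

lemma has_cderiv_unique:
  assumes "has_cderiv f d z" "has_cderiv f d' z"
  shows "d = d'"
proof -
  have "(\<lambda>h. h *\<^sub>C d) = (\<lambda>h. h *\<^sub>C d')"
    using assms unfolding has_cderiv_def by (rule has_derivative_unique)
  then have "(1::complex) *\<^sub>C d = 1 *\<^sub>C d'" by (rule fun_cong)
  then show ?thesis by simp
qed

lemma has_cderiv_if_eq_pseries:
  assumes a: "disc_convergent a" and eq: "\<And>z. z \<in> disc \<Longrightarrow> g z = pseries a z" and z: "z \<in> disc"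
  shows "has_cderiv g (pseries (dcoeff a) z) z"
  unfolding has_cderiv_def
proof (rule has_derivative_transform_within_open[where s = disc])
  show "(pseries a has_derivative (\<lambda>h. h *\<^sub>C pseries (dcoeff a) z)) (at z)"
    using has_cderiv_pseries[OF a] z by (simp add: has_cderiv_def)
qed (use eq z in auto)

lemma cderiv_funpow_if_eq_pseries:
  assumes a: "disc_convergent a" and eq: "\<And>z. z \<in> disc \<Longrightarrow> f z = pseries a z" and z: "z \<in> disc"
  shows "(cderiv ^^ n) f z = pseries ((dcoeff ^^ n) a) z"
  using z
proof (induction n arbitrary: z)
  case (Suc n)
  have "has_cderiv ((cderiv ^^ n) f) (pseries (dcoeff ((dcoeff ^^ n) a)) z) z"
    by (rule has_cderiv_if_eq_pseries[OF disc_convergent_dcoeff_funpow[OF a] Suc.IH Suc.prems])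
  then show ?case
    unfolding funpow.simps comp_apply cderiv_def[of _ z]
    by (intro the_equality) (auto intro: has_cderiv_unique)
qed (simp add: eq)

lemma pseries_0: "pseries a 0 = a 0"
proof -
  have "(\<lambda>j. (0::complex) ^ j *\<^sub>C a j) sums (\<Sum>j\<in>{0}. 0 ^ j *\<^sub>C a j)"
    by (rule sums_finite) (auto simp: power_0_left)
  then show ?thesis by (simp add: pseries_def sums_iff)
qed

text \<open>Convergence at one point of modulus \<open>\<rho>\<close> bounds \<open>\<parallel>a\<^sub>j\<parallel> \<rho>\<^sup>j\<close>, which gives absolute convergence for
  every \<open>r < \<rho>\<close> by comparison with a geometric series.\<close>

lemma disc_convergent_if_power_series:
  assumes "is_power_series f a"
  shows "disc_convergent a"
  unfolding disc_convergent_def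
proof (intro allI impI)
  fix r :: real assume r: "0 \<le> r \<and> r < 1"
  define \<rho> where "\<rho> = (1 + r) / 2"
  have \<rho>: "0 < \<rho>" "\<rho> < 1" "r < \<rho>" using r by (simp_all add: \<rho>_def)
  have "(\<lambda>j. of_real \<rho> ^ j *\<^sub>C a j) sums f (of_real \<rho>)"
    using assms \<rho> by (simp add: is_power_series_def)
  then have "(\<lambda>j. of_real \<rho> ^ j *\<^sub>C a j) \<longlonglongrightarrow> 0"
    by (intro summable_LIMSEQ_zero sums_summable)
  then obtain B where B: "\<And>j. norm (complex_of_real \<rho> ^ j *\<^sub>C a j) \<le> B"
    by (metis Bseq_def convergentI convergent_imp_Bseq)
  have "summable (\<lambda>j. B * (r / \<rho>) ^ j)"
    using r \<rho> by (intro summable_mult summable_geometric) simp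
  moreover have "norm (norm (a j) * r ^ j) \<le> B * (r / \<rho>) ^ j" for j
  proof -
    have "norm (a j) * r ^ j = (\<rho> ^ j * norm (a j)) * (r / \<rho>) ^ j"
      using \<rho> by (simp add: power_divide)
    also have "\<dots> \<le> B * (r / \<rho>) ^ j"
      using B[of j] r \<rho> by (intro mult_right_mono) (simp_all add: norm_power)
    finally show ?thesis using r by simp
  qed
  ultimately show "summable (\<lambda>j. norm (a j) * r ^ j)"
    by (rule summable_comparison_test'[where N = 0])
qed

text \<open>The \<open>n\<close>-th coefficient is determined by the \<open>n\<close>-th derivative at the origin.\<close>

lemma power_series_unique:
  assumes "is_power_series f a" "is_power_series f b"
  shows "a = b"
proof
  fix n
  have eq: "f z = pseries c z" if "is_power_series f c" "z \<in> disc" for c z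
    using that by (simp add: is_power_series_def pseries_def sums_iff)
  have "of_real (fact n) *\<^sub>C c n = (cderiv ^^ n) f 0" if c: "is_power_series f c" for c
    by (subst cderiv_funpow_if_eq_pseries[OF disc_convergent_if_power_series[OF c] eq[OF c]])
      (simp_all add: pseries_0 dcoeff_funpow)
  from this[OF assms(1)] this[OF assms(2)]
  have "of_real (1 / fact n) *\<^sub>C of_real (fact n) *\<^sub>C a n = of_real (1 / fact n) *\<^sub>C of_real (fact n) *\<^sub>C b n"
    by simp
  then show "a n = b n" by (simp add: scaleC_scaleC)
qed

text \<open>The function on \<open>complex\<close>, zero off the disc, with given Taylor coefficients.\<close>

definition psum :: "(nat \<Rightarrow> 'e::chilbert_space) \<Rightarrow> complex \<Rightarrow> 'e"
  where "psum a z = (if z \<in> disc then pseries a z else 0)"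

lemma is_power_series_psum: "disc_convergent a \<Longrightarrow> is_power_series (psum a) a"
  by (simp add: is_power_series_def psum_def pseries_sums)

lemma psum_inject: "disc_convergent a \<Longrightarrow> disc_convergent b \<Longrightarrow> psum a = psum b \<Longrightarrow> a = b"
  by (metis is_power_series_psum power_series_unique)

lemma psum_holomorphic: "disc_convergent a \<Longrightarrow> psum a \<in> holomorphic_disc"
  unfolding holomorphic_disc_def
  by (auto simp: psum_def intro!: exI has_cderiv_if_eq_pseries)

lemma cderiv_funpow_psum:
  "disc_convergent a \<Longrightarrow> cmod z < 1 \<Longrightarrow> (cderiv ^^ n) (psum a) z = pseries ((dcoeff ^^ n) a) z"
  by (rule cderiv_funpow_if_eq_pseries) (auto simp: psum_def)

lemma psum_add:
  assumes "disc_convergent a" "disc_convergent b"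
  shows "psum (a + b) = psum a + psum b"
proof
  fix z
  have "(\<lambda>j. z ^ j *\<^sub>C (a + b) j) sums (pseries a z + pseries b z)" if "cmod z < 1"
    using sums_add[OF pseries_sums[OF assms(1) that] pseries_sums[OF assms(2) that]]
    by (simp add: scaleC_add_right)
  then show "psum (a + b) z = (psum a + psum b) z"
    by (auto simp: psum_def pseries_def[of "a + b"] sums_iff)
qed

lemma psum_scaleC:
  assumes "disc_convergent a"
  shows "psum (c *\<^sub>C a) = c *\<^sub>C psum a"
proof
  fix z
  have "(\<lambda>j. z ^ j *\<^sub>C (c *\<^sub>C a) j) sums (c *\<^sub>C pseries a z)" if "cmod z < 1"
    using bounded_linear.sums[OF bounded_bilinear.bounded_linear_right[OF bounded_bilinear_scaleC]
        pseries_sums[OF assms that], of c]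
    by (simp add: scaleC_fun_def scaleC_scaleC mult.commute)
  then show "psum (c *\<^sub>C a) z = (c *\<^sub>C psum a) z"
    by (auto simp: psum_def pseries_def[of "\<lambda>j. c *\<^sub>C a j"] sums_iff scaleC_fun_def)
qed

definition rshift :: "(nat \<Rightarrow> 'e::chilbert_space) \<Rightarrow> nat \<Rightarrow> 'e"
  where "rshift a j = (case j of 0 \<Rightarrow> 0 | Suc i \<Rightarrow> a i)"

lemma rshift_simps [simp]: "rshift a 0 = 0" "rshift a (Suc i) = a i"
  by (simp_all add: rshift_def)

lemma mult_z_psum:
  assumes "disc_convergent a"
  shows "mult_z (psum a) = psum (rshift a)"
proof
  fix z
  have "(\<lambda>j. z ^ j *\<^sub>C rshift a j) sums (z *\<^sub>C pseries a z)" if "cmod z < 1"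
  proof -
    have "(\<lambda>j. z ^ Suc j *\<^sub>C rshift a (Suc j)) sums (z *\<^sub>C pseries a z)"
      using bounded_linear.sums[OF bounded_bilinear.bounded_linear_right[OF bounded_bilinear_scaleC]
          pseries_sums[OF assms that], of z]
      by (simp add: scaleC_scaleC)
    then show ?thesis by (subst (asm) sums_Suc_iff) simp
  qed
  then show "mult_z (psum a) z = psum (rshift a) z"
    by (auto simp: mult_z_def psum_def pseries_def[of "rshift a"] sums_iff)
qed

subsection \<open>Square summable sequences and the Hardy space\<close>

definition l2 :: "(nat \<Rightarrow> 'e::chilbert_space) \<Rightarrow> bool"
  where "l2 a \<longleftrightarrow> summable (\<lambda>j. (norm (a j))\<^sup>2)"

definition l2sq :: "(nat \<Rightarrow> 'e::chilbert_space) \<Rightarrow> real"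
  where "l2sq a = (\<Sum>j. (norm (a j))\<^sup>2)"

lemma l2sq_nonneg: "l2 a \<Longrightarrow> 0 \<le> l2sq a"
  by (simp add: l2_def l2sq_def suminf_nonneg)

lemma norm_le_l2sq: "l2 a \<Longrightarrow> (norm (a j))\<^sup>2 \<le> l2sq a"
  using sum_le_suminf[of "\<lambda>j. (norm (a j))\<^sup>2" "{j}"] by (simp add: l2_def l2sq_def)

lemma norm_le_sqrt_l2sq: "l2 a \<Longrightarrow> norm (a j) \<le> sqrt (l2sq a)"
  by (rule real_le_rsqrt) (rule norm_le_l2sq)

lemma disc_convergent_l2: "l2 a \<Longrightarrow> disc_convergent a"
  by (rule disc_convergent_if_bounded) (rule norm_le_sqrt_l2sq)

lemma norm_add_sq_le: "(norm (x + y))\<^sup>2 \<le> 2 * (norm x)\<^sup>2 + 2 * (norm (y::'a::real_normed_vector))\<^sup>2"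
proof -
  have "(norm (x + y))\<^sup>2 \<le> (norm x + norm y)\<^sup>2" by (intro power_mono norm_triangle_ineq) simp
  also have "\<dots> \<le> 2 * (norm x)\<^sup>2 + 2 * (norm y)\<^sup>2"
    using zero_le_power2[of "norm x - norm y"] by (simp add: power2_eq_square algebra_simps)
  finally show ?thesis .
qed

lemma l2_add: "l2 a \<Longrightarrow> l2 b \<Longrightarrow> l2 (a + b)"
  unfolding l2_def
  by (rule summable_comparison_test'[where N = 0 and g = "\<lambda>j. 2 * (norm (a j))\<^sup>2 + 2 * (norm (b j))\<^sup>2"])
    (auto intro: summable_add summable_mult simp: norm_add_sq_le)

lemma l2_scaleC: "l2 a \<Longrightarrow> l2 (c *\<^sub>C a)"
  by (simp add: l2_def scaleC_fun_def power_mult_distrib summable_mult)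

lemma l2_rshift: "l2 (rshift a) \<longleftrightarrow> l2 a" and l2sq_rshift: "l2 a \<Longrightarrow> l2sq (rshift a) = l2sq a"
proof -
  show *: "l2 (rshift a) \<longleftrightarrow> l2 a"
    unfolding l2_def using summable_Suc_iff[of "\<lambda>j. (norm (rshift a j))\<^sup>2"] by simp
  show "l2sq (rshift a) = l2sq a" if "l2 a"
    using suminf_split_head[of "\<lambda>j. (norm (rshift a j))\<^sup>2"] that * by (simp add: l2_def l2sq_def)
qed

lemma hardy_space_eq: "hardy_space = psum ` {a. l2 a}"
proof (intro set_eqI iffI)
  fix f :: "complex \<Rightarrow> 'a"
  assume "f \<in> hardy_space"
  then obtain a where f: "f \<in> holomorphic_disc" "is_power_series f a" "l2 a"
    by (auto simp: hardy_space_def l2_def)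
  have "f = psum a"
  proof
    fix z show "f z = psum a z"
      using f by (cases "z \<in> disc") (auto simp: psum_def holomorphic_disc_def is_power_series_def pseries_def sums_iff)
  qed
  with f show "f \<in> psum ` {a. l2 a}" by auto
next
  fix f :: "complex \<Rightarrow> 'a"
  assume "f \<in> psum ` {a. l2 a}"
  then show "f \<in> hardy_space"
    using psum_holomorphic is_power_series_psum disc_convergent_l2
    by (fastforce simp: hardy_space_def l2_def)
qed

lemma hardy_norm_sq_psum:
  assumes a: "l2 a"
  shows "hardy_norm_sq (psum a) = l2sq a"
proof -
  note ps = is_power_series_psum[OF disc_convergent_l2[OF a]]
  have "(THE b. is_power_series (psum a) b) = a"
    using ps power_series_unique[OF _ ps] by (rule the_equality)
  then show ?thesis by (simp add: hardy_norm_sq_def l2sq_def)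
qed

section \<open>The Dirichlet forms in terms of Taylor coefficients\<close>

lemma summable_poly_power:
  assumes "0 \<le> t" "t < (1::real)"
  shows "summable (\<lambda>M. real (Suc M) ^ k * t ^ M)"
proof -
  have "summable (\<lambda>M. real (Suc M) ^ k * x ^ M)" if "norm x < 1" for x :: real
    using that
  proof (induction k arbitrary: x)
    case 0
    then show ?case by (simp add: summable_geometric)
  next
    case (Suc k)
    have "summable (\<lambda>M. real M ^ k * y ^ M)" if y: "norm y < 1" for y :: real
    proof -
      have "summable (\<lambda>M. real (Suc M) ^ k * y ^ Suc M)"
        using summable_mult[OF Suc.IH[OF y], of y] by (simp add: mult_ac)
      then show ?thesis by (subst (asm) summable_Suc_iff)
    qed
    then have "summable (\<lambda>M. diffs (\<lambda>M. real M ^ k) M * x ^ M)"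
      by (rule termdiff_converges[OF Suc.prems])
    then show ?case by (simp add: diffs_def mult.assoc del: of_nat_Suc)
  qed
  then show ?thesis using assms by simp
qed

definition bounded_seq :: "(nat \<Rightarrow> 'e::chilbert_space) \<Rightarrow> bool"
  where "bounded_seq a \<longleftrightarrow> (\<exists>A. \<forall>j. norm (a j) \<le> A)"

lemma bounded_seqE:
  assumes "bounded_seq a"
  obtains A where "0 \<le> A" "\<And>j. norm (a j) \<le> A"
  using assms unfolding bounded_seq_def by (meson norm_ge_zero order_trans)

lemma disc_convergent_bounded_seq: "bounded_seq a \<Longrightarrow> disc_convergent a"
  by (auto simp: bounded_seq_def intro: disc_convergent_if_bounded)

lemma bounded_seq_l2: "l2 a \<Longrightarrow> bounded_seq a"
  using norm_le_sqrt_l2sq bounded_seq_def by blast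

lemma bounded_seq_add: "bounded_seq a \<Longrightarrow> bounded_seq b \<Longrightarrow> bounded_seq (a + b)"
proof (elim bounded_seqE)
  fix A B assume "\<And>j. norm (a j) \<le> A" "\<And>j. norm (b j) \<le> B"
  then have "\<And>j. norm ((a + b) j) \<le> A + B" by (simp add: norm_triangle_le add_mono)
  then show ?thesis unfolding bounded_seq_def by blast
qed

lemma bounded_seq_scaleC: "bounded_seq a \<Longrightarrow> bounded_seq (c *\<^sub>C a)"
proof (elim bounded_seqE)
  fix A assume "\<And>j. norm (a j) \<le> A"
  then have "\<And>j. norm ((c *\<^sub>C a) j) \<le> cmod c * A" by (simp add: scaleC_fun_def mult_left_mono)
  then show ?thesis unfolding bounded_seq_def by blast
qed

lemma bounded_seq_rshift: "bounded_seq a \<Longrightarrow> bounded_seq (rshift a)"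
proof (elim bounded_seqE)
  fix A assume "0 \<le> A" "\<And>j. norm (a j) \<le> A"
  then have "\<And>j. norm (rshift a j) \<le> A" by (simp add: rshift_def split: nat.split)
  then show ?thesis unfolding bounded_seq_def by blast
qed

lemma fun_scaleC_apply: "(c *\<^sub>C a) j = c *\<^sub>C (a j :: 'e::complex_vector)"
  by (simp add: scaleC_fun_def)

context semi_spectral
begin

definition moment :: "nat \<Rightarrow> nat \<Rightarrow> 'e \<Rightarrow> 'e \<Rightarrow> complex"
  where "moment i j x y = form x y (\<lambda>\<zeta>. \<zeta> ^ i * cnj \<zeta> ^ j)"

lemmas sesquilinear_moment = sesquilinear_form[OF circle_bounded_monomial, folded moment_def]

lemma moment_add_left: "moment i j (x + x') y = moment i j x y + moment i j x' y"
  and moment_scale_left: "moment i j (c *\<^sub>C x) y = c * moment i j x y"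
  and moment_scale_right: "moment i j x (c *\<^sub>C y) = cnj c * moment i j x y"
  using sesquilinear_moment[of i j] by (simp_all add: sesquilinear_def)

lemma moment_0 [simp]: "moment i j 0 y = 0" "moment i j x 0 = 0"
  using moment_scale_left[of i j 0 0 y] moment_scale_right[of i j x 0 0] by simp_all

lemma moment_bound: "cmod (moment i j x y) \<le> 4 * mass * norm x * norm y"
  using form_bound[OF circle_bounded_monomial[of i j], of x y] by (simp add: moment_def)

lemma moment_Suc: "moment (Suc i) (Suc j) x y = moment i j x y"
proof -
  have "(LINT \<zeta>|diag_measure \<mu> u. \<zeta> ^ Suc i * cnj \<zeta> ^ Suc j) = (LINT \<zeta>|diag_measure \<mu> u. \<zeta> ^ i * cnj \<zeta> ^ j)" for u
  proof (rule Bochner_Integration.integral_cong[OF refl])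
    fix \<zeta> assume "\<zeta> \<in> space (diag_measure \<mu> u)"
    then have "\<zeta> * cnj \<zeta> = 1" by (simp flip: complex_norm_square)
    then have "\<zeta> ^ i * cnj \<zeta> ^ j * (\<zeta> * cnj \<zeta>) = \<zeta> ^ i * cnj \<zeta> ^ j" by simp
    then show "\<zeta> ^ Suc i * cnj \<zeta> ^ Suc j = \<zeta> ^ i * cnj \<zeta> ^ j" by (simp add: mult_ac)
  qed
  then show ?thesis by (simp only: moment_def form_def)
qed

lemma moment_shift: "moment (i + n) (j + n) x y = moment i j x y"
  by (induction n) (simp_all add: moment_Suc)

lemma cnj_moment: "cnj (moment i j x y) = moment j i y x"
  unfolding moment_def form_cnj[OF circle_bounded_monomial] by (simp add: mult.commute)

text \<open>The terms with \<open>max i j = M\<close> of the double sum of \<open>(min i j choose n) c\<^sub>i\<^sub>-\<^sub>j(a\<^sub>i, b\<^sub>j)\<close>, where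
  \<open>c\<^sub>i\<^sub>-\<^sub>j\<close> is \<open>moment i j\<close>.  Grouping by \<open>M\<close> turns the double sum into a power series in \<open>t\<close> whose
  coefficients are finite sums.\<close>

definition block :: "nat \<Rightarrow> nat \<Rightarrow> (nat \<Rightarrow> 'e) \<Rightarrow> (nat \<Rightarrow> 'e) \<Rightarrow> complex"
  where "block n M a b = (\<Sum>i\<le>M. of_nat (i choose n) * moment i M (a i) (b M))
    + (\<Sum>j<M. of_nat (j choose n) * moment M j (a M) (b j))"

text \<open>For \<open>n \<ge> 1\<close> this is the sesquilinear form of \<open>D\<^sub>\<mu>\<^sub>,\<^sub>n\<close> with \<open>(1 - |z|\<^sup>2)\<^sup>n\<^sup>-\<^sup>1\<close> replaced by
  \<open>(t - |z|\<^sup>2)\<^sub>+\<^sup>n\<^sup>-\<^sup>1\<close>; for \<open>n = 0\<close> it is the mean of \<open>\<langle>P\<^sub>\<mu> f, f\<rangle>\<close> over the circle \<open>|z|\<^sup>2 = t\<close>.\<close>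

definition dform :: "nat \<Rightarrow> real \<Rightarrow> (nat \<Rightarrow> 'e) \<Rightarrow> (nat \<Rightarrow> 'e) \<Rightarrow> complex"
  where "dform n t a b = (\<Sum>M. of_real (t ^ M) * block n M a b)"

definition dquad :: "nat \<Rightarrow> real \<Rightarrow> (nat \<Rightarrow> 'e) \<Rightarrow> real"
  where "dquad n t a = Re (dform n t a a)"

text \<open>Blocks grow polynomially in \<open>M\<close>, so the series for \<open>dform\<close> converges absolutely for \<open>t < 1\<close>.\<close>

lemma block_bound:
  assumes A: "\<And>j. norm (a j) \<le> A" and B: "\<And>j. norm (b j) \<le> B"
  shows "cmod (block n M a b) \<le> 8 * mass * A * B * real (Suc M) ^ Suc n"
proof -
  have A0: "0 \<le> A" using A[of 0] norm_ge_zero order_trans by blast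
  let ?K = "real (Suc M) ^ n * (4 * mass * A * B)"
  have K0: "0 \<le> ?K" using A0 B[of 0] norm_ge_zero[of "b 0"] mass_nonneg
    by (intro mult_nonneg_nonneg) (auto simp del: norm_ge_zero)
  have bin: "real (i choose n) \<le> real (Suc M) ^ n" if "i \<le> M" for i
  proof (cases "n \<le> i")
    case True
    then have "real (i choose n) \<le> real i ^ n"
      using binomial_le_pow[OF True] by (metis of_nat_le_iff of_nat_power)
    also have "\<dots> \<le> real (Suc M) ^ n" using that by (intro power_mono) auto
    finally show ?thesis .
  qed (simp add: binomial_eq_0)
  have mom: "cmod (moment i j (a k) (b l)) \<le> 4 * mass * A * B" for i j k l
  proof -
    have "4 * mass * norm (a k) * norm (b l) \<le> 4 * mass * A * B"
      using A B A0 mass_nonneg by (intro mult_mono mult_nonneg_nonneg) auto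
    then show ?thesis using moment_bound order_trans by blast
  qed
  have summand: "cmod (of_nat (i choose n) * moment p q (a k) (b l)) \<le> ?K" if "i \<le> M" for i p q k l
    unfolding norm_mult norm_of_nat using bin[OF that] mom by (intro mult_mono) auto
  have "cmod (block n M a b) \<le> (\<Sum>i\<le>M. ?K) + (\<Sum>j<M. ?K)"
    unfolding block_def
    by (intro norm_triangle_le add_mono sum_norm_le summand) auto
  also have "(\<Sum>i\<le>M. ?K) = real (Suc M) * ?K" by simp
  also have "(\<Sum>j<M. ?K) \<le> real (Suc M) * ?K"
  proof -
    have "(\<Sum>j<M. ?K) = real M * ?K" by simp
    also have "\<dots> \<le> real (Suc M) * ?K" by (rule mult_right_mono[OF _ K0]) simp
    finally show ?thesis .
  qed
  finally show ?thesis by (simp add: mult_ac)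
qed

lemma dform_summable_norm:
  assumes t: "0 \<le> t" "t < 1" and a: "bounded_seq a" and b: "bounded_seq b"
  shows "summable (\<lambda>M. cmod (of_real (t ^ M) * block n M a b))"
proof -
  obtain A where A: "\<And>j. norm (a j) \<le> A" using a unfolding bounded_seq_def by blast
  obtain B where B: "\<And>j. norm (b j) \<le> B" using b unfolding bounded_seq_def by blast
  show ?thesis
  proof (rule summable_comparison_test'[where N = 0])
    show "summable (\<lambda>M. 8 * mass * A * B * (real (Suc M) ^ Suc n * t ^ M))"
      by (rule summable_mult) (rule summable_poly_power[OF t])
    show "norm (cmod (of_real (t ^ M) * block n M a b)) \<le> 8 * mass * A * B * (real (Suc M) ^ Suc n * t ^ M)" for M
    proof -
      have "t ^ M * cmod (block n M a b) \<le> t ^ M * (8 * mass * A * B * real (Suc M) ^ Suc n)"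
        using t by (intro mult_left_mono block_bound A B) auto
      then show ?thesis using t by (simp add: norm_mult norm_power mult_ac)
    qed
  qed
qed

lemmas dform_summable = summable_norm_cancel[OF dform_summable_norm]

lemma dform_sums:
  assumes "0 \<le> t" "t < 1" "bounded_seq a" "bounded_seq b"
  shows "(\<lambda>M. of_real (t ^ M) * block n M a b) sums dform n t a b"
  unfolding dform_def by (rule summable_sums[OF dform_summable[OF assms]])

lemma block_add_left: "block n M (a + a') b = block n M a b + block n M a' b"
  by (simp add: block_def moment_add_left distrib_left sum.distrib)

lemma block_scale_left: "block n M (c *\<^sub>C a) b = c * block n M a b"
  by (simp add: block_def moment_scale_left fun_scaleC_apply distrib_left sum_distrib_left mult_ac)

lemma cnj_block: "cnj (block n M a b) = block n M b a"
proof -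
  have "cnj (block n M a b) = (\<Sum>i\<le>M. of_nat (i choose n) * moment M i (b M) (a i))
      + (\<Sum>j<M. of_nat (j choose n) * moment j M (b j) (a M))"
    by (simp add: block_def cnj_moment)
  also have "\<dots> = block n M b a"
    by (simp add: block_def lessThan_Suc_atMost[symmetric])
  finally show ?thesis .
qed

lemma dform_add_left:
  assumes "0 \<le> t" "t < 1" "bounded_seq a" "bounded_seq a'" "bounded_seq b"
  shows "dform n t (a + a') b = dform n t a b + dform n t a' b"
proof (rule sums_unique2[OF dform_sums])
  show "(\<lambda>M. of_real (t ^ M) * block n M (a + a') b) sums (dform n t a b + dform n t a' b)"
    using sums_add[OF dform_sums[of t a b n] dform_sums[of t a' b n]] assms
    by (simp add: block_add_left distrib_left)
qed (use assms bounded_seq_add in auto)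

lemma dform_scale_left:
  assumes "0 \<le> t" "t < 1" "bounded_seq a" "bounded_seq b"
  shows "dform n t (c *\<^sub>C a) b = c * dform n t a b"
proof (rule sums_unique2[OF dform_sums])
  show "(\<lambda>M. of_real (t ^ M) * block n M (c *\<^sub>C a) b) sums (c * dform n t a b)"
    using sums_mult[OF dform_sums[of t a b n], of c] assms
    by (simp add: block_scale_left mult_ac)
qed (use assms bounded_seq_scaleC in auto)

lemma cnj_dform:
  assumes "0 \<le> t" "t < 1" "bounded_seq a" "bounded_seq b"
  shows "cnj (dform n t a b) = dform n t b a"
proof (rule sums_unique2)
  have "(\<lambda>M. cnj (of_real (t ^ M) * block n M a b)) sums cnj (dform n t a b)"
    unfolding sums_cnj by (rule dform_sums[OF assms])
  then show "(\<lambda>M. of_real (t ^ M) * block n M b a) sums cnj (dform n t a b)"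
    by (simp add: cnj_block)
qed (use dform_sums assms in auto)

lemma dform_self:
  assumes "0 \<le> t" "t < 1" "bounded_seq a"
  shows "dform n t a a = of_real (dquad n t a)"
  using cnj_dform[OF assms assms(3), of n] by (metis Reals_cnj_iff dquad_def of_real_Re)

lemma dform_add_right:
  assumes "0 \<le> t" "t < 1" "bounded_seq a" "bounded_seq b" "bounded_seq b'"
  shows "dform n t a (b + b') = dform n t a b + dform n t a b'"
  using dform_add_left[OF assms(1,2,4,5,3), of n] assms bounded_seq_add[OF assms(4,5)]
  by (metis cnj_dform complex_cnj_add)

lemma dform_scale_right:
  assumes "0 \<le> t" "t < 1" "bounded_seq a" "bounded_seq b"
  shows "dform n t a (c *\<^sub>C b) = cnj c * dform n t a b"
  using dform_scale_left[OF assms(1,2,4,3), of n c] assms bounded_seq_scaleC[OF assms(4)]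
  by (metis cnj_dform complex_cnj_mult)

text \<open>Pascal's rule turns the shift of coefficients, that is multiplication by \<open>z\<close>, into
  passage from order \<open>n\<close> to the orders \<open>n\<close> and \<open>n - 1\<close>.\<close>

lemma block_rshift_0: "block n 0 (rshift a) (rshift b) = 0"
  by (simp add: block_def)

lemma block_0_rshift: "block 0 (Suc M) (rshift a) (rshift b) = block 0 M a b"
  unfolding block_def sum.atMost_Suc_shift sum.lessThan_Suc_shift by (simp add: moment_Suc)

lemma block_Suc_rshift:
  "block (Suc n) (Suc M) (rshift a) (rshift b) = block (Suc n) M a b + block n M a b"
  unfolding block_def sum.atMost_Suc_shift sum.lessThan_Suc_shift
  by (simp add: moment_Suc distrib_right sum.distrib)

lemma dform_rshift_aux:
  assumes t: "0 \<le> t" "t < 1" and a: "bounded_seq a"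
    and B: "\<And>M. block n (Suc M) (rshift a) (rshift a) = B M"
    and s: "(\<lambda>M. of_real (t ^ M) * B M) sums S"
  shows "dform n t (rshift a) (rshift a) = of_real t * S"
proof (rule sums_unique2[OF dform_sums[OF t]])
  have "(\<lambda>M. of_real (t ^ Suc M) * block n (Suc M) (rshift a) (rshift a)) sums (of_real t * S)"
    using sums_mult[OF s, of "of_real t"] by (simp add: B mult.assoc)
  then show "(\<lambda>M. of_real (t ^ M) * block n M (rshift a) (rshift a)) sums (of_real t * S)"
    by (subst (asm) sums_Suc_iff) (simp add: block_rshift_0)
qed (use a bounded_seq_rshift in auto)

lemma dquad_0_rshift:
  assumes "0 \<le> t" "t < 1" "bounded_seq a"
  shows "dquad 0 t (rshift a) = t * dquad 0 t a"
  using dform_rshift_aux[OF assms block_0_rshift dform_sums[OF assms assms(3)]]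
  by (simp add: dquad_def)

lemma dquad_Suc_rshift:
  assumes "0 \<le> t" "t < 1" "bounded_seq a"
  shows "dquad (Suc n) t (rshift a) = t * (dquad (Suc n) t a + dquad n t a)"
proof -
  have "dform (Suc n) t (rshift a) (rshift a) = of_real t * (dform (Suc n) t a a + dform n t a a)"
    by (rule dform_rshift_aux[OF assms block_Suc_rshift])
      (use sums_add[OF dform_sums[OF assms assms(3), of "Suc n"] dform_sums[OF assms assms(3), of n]]
        in \<open>simp add: distrib_left\<close>)
  then show ?thesis by (simp add: dquad_def)
qed

text \<open>Orders \<open>n \<ge> 1\<close> do not see the constant term, as \<open>0 choose n = 0\<close>.\<close>

lemma dquad_Suc_cong:
  assumes "\<And>i. a (Suc i) = b (Suc i)"
  shows "dquad (Suc n) t a = dquad (Suc n) t b"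
proof -
  have eq: "a i = b i" if "i \<noteq> 0" for i using assms that by (cases i) auto
  have "block (Suc n) M a a = block (Suc n) M b b" for M
  proof (cases M)
    case (Suc k)
    have "of_nat (i choose Suc n) * moment i M (a i) (a M) = of_nat (i choose Suc n) * moment i M (b i) (b M)"
      "of_nat (i choose Suc n) * moment M i (a M) (a i) = of_nat (i choose Suc n) * moment M i (b M) (b i)" for i
      using eq[of i] eq[of M] Suc by (cases "i = 0"; simp)+
    then show ?thesis unfolding block_def by (simp only:)
  qed (simp add: block_def)
  then show ?thesis by (simp add: dquad_def dform_def)
qed

subsection \<open>Integral representation\<close>

lemma sum_square_eq_sum_block:
  "(\<Sum>i<N. \<Sum>j<N. of_nat (min i j choose n) * of_real (t ^ max i j) * moment i j (a i) (a j))
    = (\<Sum>M<N. of_real (t ^ M) * block n M a a)"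
proof (induction N)
  case (Suc N)
  let ?g = "\<lambda>i j. of_nat (min i j choose n) * of_real (t ^ max i j) * moment i j (a i) (a j)"
  have "(\<Sum>i<Suc N. \<Sum>j<Suc N. ?g i j) = (\<Sum>i<N. \<Sum>j<N. ?g i j) + ((\<Sum>i\<le>N. ?g i N) + (\<Sum>j<N. ?g N j))"
    by (simp add: sum.distrib lessThan_Suc_atMost[symmetric])
  also have "(\<Sum>i\<le>N. ?g i N) = of_real (t ^ N) * (\<Sum>i\<le>N. of_nat (i choose n) * moment i N (a i) (a N))"
    unfolding sum_distrib_left by (rule sum.cong) (simp_all add: min_def max_def mult_ac)
  also have "(\<Sum>j<N. ?g N j) = of_real (t ^ N) * (\<Sum>j<N. of_nat (j choose n) * moment N j (a N) (a j))"
    unfolding sum_distrib_left by (rule sum.cong) (simp_all add: min_def max_def mult_ac)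
  finally show ?case
    by (simp only: Suc.IH sum.lessThan_Suc[of "\<lambda>M. of_real (t ^ M) * block n M a a"]
        block_def[of n N] distrib_left)
qed simp

lemma bounded_bilinear_poisson_form:
  assumes z: "cmod z < 1"
  shows "bounded_bilinear (poisson_form z)"
proof -
  note bm = circle_bounded_poisson_kernel[OF order_refl z]
  note sq = sesquilinear_form[OF bm, unfolded sesquilinear_def, folded poisson_form_def]
  show ?thesis
  proof
    show "\<exists>K. \<forall>x y. norm (poisson_form z x y) \<le> norm x * norm y * K"
      using form_bound[OF bm] unfolding poisson_form_def
      by (intro exI[of _ "4 * (1 / (1 - cmod z)\<^sup>2) * mass"]) (simp add: mult_ac)
  qed (use sq in \<open>auto simp: scaleR_scaleC scaleR_conv_of_real\<close>)
qed

lemma poisson_form_scale: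
  assumes z: "cmod z < 1"
  shows "poisson_form z (a *\<^sub>C x) (b *\<^sub>C y) = a * cnj b * poisson_form z x y"
  using sesquilinear_form[OF circle_bounded_poisson_kernel[OF order_refl z]]
  by (simp add: sesquilinear_def poisson_form_def)

text \<open>\<open>\<langle>P\<^sub>\<mu> f\<^sup>(\<^sup>n\<^sup>), f\<^sup>(\<^sup>n\<^sup>)\<rangle>\<close> for the function \<open>f\<close> with Taylor coefficients \<open>a\<close>\<close>

definition density :: "nat \<Rightarrow> (nat \<Rightarrow> 'e) \<Rightarrow> complex \<Rightarrow> complex"
  where "density n a z = (if cmod z < 1
    then poisson_form z (pseries ((dcoeff ^^ n) a) z) (pseries ((dcoeff ^^ n) a) z) else 0)"

text \<open>The order is \<open>n = s + 1\<close>, so that \<open>s\<close> is the exponent of the weight.  For partial sums of the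
  power series the integral is a finite sum of moments; with the coefficients \<open>d\<^sub>i\<close> of \<open>f\<^sup>(\<^sup>n\<^sup>)\<close> the
  factorials from differentiation and from the Beta integral combine to
  \<open>n! s! (min i j + n choose n)\<close>.  Then the partial sums are replaced by their limit, with a
  bounded majorant because \<open>|z|\<^sup>2 < t\<close> on the support of the weight.\<close>

lemma dform_eq_integral:
  assumes t: "0 \<le> t" "t < 1" and a: "bounded_seq a"
  shows "integrable disc_area (\<lambda>z. density (Suc s) a z * of_real (radial_weight t s z))"
      (is "integrable _ ?h")
    and "(LINT z|disc_area. density (Suc s) a z * of_real (radial_weight t s z))
      = of_real (fact (Suc s) * fact s) * dform (Suc s) t a a"
proof -
  let ?n = "Suc s"
  define h where "h = ?h"
  define d where "d = (dcoeff ^^ ?n) a"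
  have dc: "disc_convergent d"
    unfolding d_def by (intro disc_convergent_dcoeff_funpow disc_convergent_bounded_seq a)
  define p where "p N z = (\<Sum>j<N. z ^ j *\<^sub>C d j)" for N z
  define g where "g N z = (\<Sum>i<N. \<Sum>j<N. poisson_form z (d i) (d j) * monomial_weight t s i j z)" for N z
  have rt: "0 \<le> sqrt t" "sqrt t < 1" using t by simp_all
  have g_eq: "g N z = poisson_form z (p N z) (p N z) * of_real (radial_weight t s z)" if z: "cmod z < 1" for N z
  proof -
    interpret bounded_bilinear "poisson_form z" by (rule bounded_bilinear_poisson_form[OF z])
    show ?thesis
      unfolding p_def sum_left sum_right poisson_form_scale[OF z] g_def sum_distrib_right
      by (subst sum.swap) (simp add: monomial_weight_def mult_ac)
  qed
  have g_out: "g N z = 0" if "sqrt t \<le> cmod z" for N z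
    using that t by (simp add: g_def monomial_weight_def radial_weight_eq_0)
  have g_int: "integrable disc_area (g N)" for N
    unfolding g_def by (intro Bochner_Integration.integrable_sum poisson_form_moment t)
  have g_lim: "(\<lambda>N. g N z) \<longlonglongrightarrow> h z" for z
  proof (cases "cmod z < 1")
    case True
    interpret bounded_bilinear "poisson_form z" by (rule bounded_bilinear_poisson_form[OF True])
    have "(\<lambda>N. p N z) \<longlonglongrightarrow> pseries d z"
      using pseries_sums[OF dc True] by (simp add: p_def sums_def)
    then have "(\<lambda>N. poisson_form z (p N z) (p N z) * of_real (radial_weight t s z))
        \<longlonglongrightarrow> poisson_form z (pseries d z) (pseries d z) * of_real (radial_weight t s z)"
      by (intro tendsto_mult tendsto_const tendsto)
    then show ?thesis using True by (simp add: g_eq h_def density_def d_def)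
  next
    case False
    then have "sqrt t \<le> cmod z" using rt by linarith
    then show ?thesis using False by (simp add: g_out h_def density_def)
  qed
  define C where "C = (\<Sum>j. norm (d j) * sqrt t ^ j)"
  define K where "K = 4 * (1 / (1 - sqrt t)\<^sup>2) * mass * C * C"
  have C0: "0 \<le> C"
    using pseries_partial_bound[OF dc rt, of 0 0] rt by (simp add: C_def)
  have K0: "0 \<le> K" using C0 mass_nonneg by (simp add: K_def)
  have g_bound: "cmod (g N z) \<le> K" for N z
  proof (cases "sqrt t \<le> cmod z")
    case False
    then have z: "cmod z \<le> sqrt t" "cmod z < 1" using rt by linarith+
    have pn: "norm (p N z) \<le> C"
      unfolding p_def C_def by (rule pseries_partial_bound[OF dc rt z(1)])
    have "cmod (poisson_form z (p N z) (p N z)) \<le> 4 * (1 / (1 - sqrt t)\<^sup>2) * mass * norm (p N z) * norm (p N z)"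
      unfolding poisson_form_def by (rule form_bound[OF circle_bounded_poisson_kernel[OF z(1) rt(2)]])
    also have "\<dots> \<le> K"
      unfolding K_def using pn C0 mass_nonneg by (intro mult_mono mult_nonneg_nonneg) auto
    finally have "cmod (poisson_form z (p N z) (p N z)) * radial_weight t s z \<le> K * 1"
      using t K0 by (intro mult_mono radial_weight_le_1 radial_weight_nonneg) auto
    then show ?thesis by (simp add: g_eq[OF z(2)] norm_mult radial_weight_nonneg)
  qed (simp add: g_out K0)
  have h_meas: "h \<in> borel_measurable disc_area"
    by (rule borel_measurable_LIMSEQ_metric[where f = g]) (use g_int g_lim in auto)
  have Kint: "integrable disc_area (\<lambda>_. K)"
    by (rule finite_measure.integrable_const[OF finite_measure_disc_area])
  show "integrable disc_area ?h"
    unfolding h_def[symmetric]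
    by (rule integrable_dominated_convergence[where s = g and w = "\<lambda>_. K"])
      (use h_meas g_int Kint g_lim g_bound in auto)
  have "(\<lambda>N. LINT z|disc_area. g N z) \<longlonglongrightarrow> (LINT z|disc_area. h z)"
    by (rule integral_dominated_convergence[where s = g and w = "\<lambda>_. K"])
      (use h_meas g_int Kint g_lim g_bound in auto)
  moreover have "(LINT z|disc_area. g N z)
      = of_real (fact ?n * fact s) * (\<Sum>M<N + ?n. of_real (t ^ M) * block ?n M a a)" for N
  proof -
    let ?G = "\<lambda>i j. of_nat (min i j choose ?n) * of_real (t ^ max i j) * moment i j (a i) (a j)"
    have coeff: "moment i j (d i) (d j) * of_real (beta_coeff t (max i j) s)
        = of_real (fact ?n * fact s) * ?G (i + ?n) (j + ?n)" for i j
    proof -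
      let ?c = "\<lambda>i. fact (i + ?n) / fact i :: real"
      have m1: "moment i j (d i) (d j) = of_real (?c i * ?c j) * moment i j (a (i + ?n)) (a (j + ?n))"
        unfolding d_def dcoeff_funpow moment_scale_left moment_scale_right
        by (simp add: mult_ac del: fact_Suc)
      have m2: "?c i * ?c j * beta_coeff t (max i j) s
          = fact ?n * fact s * (real (min (i + ?n) (j + ?n) choose ?n) * t ^ max (i + ?n) (j + ?n))"
      proof -
        have 1: "?c k * beta_coeff t k s = fact s * t ^ (k + ?n)" for k
          by (simp add: beta_coeff_def)
        have 2: "?c k = fact ?n * real ((k + ?n) choose ?n)" for k
          using binomial_fact[of ?n "k + ?n", where ?'a = real] by (simp del: fact_Suc)
        have "?c i * ?c j * beta_coeff t (max i j) s = ?c (min i j) * (?c (max i j) * beta_coeff t (max i j) s)"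
          by (cases "i \<le> j") (simp_all add: min_def max_def mult_ac)
        also have "\<dots> = fact ?n * real ((min i j + ?n) choose ?n) * (fact s * t ^ (max i j + ?n))"
          unfolding 1 by (subst 2) simp
        also have "\<dots> = fact ?n * fact s * (real (min (i + ?n) (j + ?n) choose ?n) * t ^ max (i + ?n) (j + ?n))"
          by (simp add: min_add_distrib_left max_add_distrib_left mult_ac)
        finally show ?thesis .
      qed
      have "moment i j (d i) (d j) * of_real (beta_coeff t (max i j) s)
          = of_real (?c i * ?c j * beta_coeff t (max i j) s) * moment i j (a (i + ?n)) (a (j + ?n))"
        unfolding m1 by (simp only: of_real_mult mult_ac)
      then show ?thesis
        unfolding m2 by (simp only: moment_shift of_real_mult of_real_of_nat_eq mult.assoc)
    qed
    \<comment> \<open>The added terms are those with \<open>min i j < ?n\<close>, whose binomial coefficients vanish.\<close>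
    have shift: "(\<Sum>i<N. f (i + k)) = (\<Sum>i<N + k. f i)" if "\<And>i. i < k \<Longrightarrow> f i = 0" for f :: "nat \<Rightarrow> complex" and k
    proof (induction N)
      case 0
      show ?case using that by (simp add: sum.neutral)
    qed simp
    have "(LINT z|disc_area. g N z) = (\<Sum>i<N. \<Sum>j<N. moment i j (d i) (d j) * of_real (beta_coeff t (max i j) s))"
      unfolding g_def moment_def poisson_form_moment(2)[OF t, symmetric]
      by (simp add: Bochner_Integration.integral_sum Bochner_Integration.integrable_sum poisson_form_moment(1)[OF t])
    also have "\<dots> = of_real (fact ?n * fact s) * (\<Sum>i<N. \<Sum>j<N. ?G (i + ?n) (j + ?n))"
      unfolding coeff sum_distrib_left ..
    also have "(\<Sum>i<N. \<Sum>j<N. ?G (i + ?n) (j + ?n)) = (\<Sum>i<N + ?n. \<Sum>j<N + ?n. ?G i j)"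
    proof -
      have inner: "(\<Sum>j<N. ?G i (j + ?n)) = (\<Sum>j<N + ?n. ?G i j)" for i
        by (rule shift) (auto simp: min_def)
      have "(\<Sum>i<N. \<Sum>j<N. ?G (i + ?n) (j + ?n)) = (\<Sum>i<N. \<Sum>j<N + ?n. ?G (i + ?n) j)"
        by (simp only: inner)
      also have "\<dots> = (\<Sum>i<N + ?n. \<Sum>j<N + ?n. ?G i j)"
      proof (rule shift[of _ "\<lambda>i. \<Sum>j<N + ?n. ?G i j"])
        show "(\<Sum>j<N + ?n. ?G i j) = 0" if "i < ?n" for i
          by (rule sum.neutral) (use that in \<open>auto simp: min_def binomial_eq_0\<close>)
      qed
      finally show ?thesis .
    qed
    finally show ?thesis unfolding sum_square_eq_sum_block .
  qed
  moreover have "(\<lambda>N. of_real (fact ?n * fact s) * (\<Sum>M<N + ?n. of_real (t ^ M) * block ?n M a a))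
      \<longlonglongrightarrow> of_real (fact ?n * fact s) * dform ?n t a a"
    using dform_sums[OF t a a, of ?n] unfolding sums_def
    by (intro tendsto_mult tendsto_const LIMSEQ_ignore_initial_segment)
  ultimately have "(LINT z|disc_area. h z) = of_real (fact ?n * fact s) * dform ?n t a a"
    by (simp only:) (rule LIMSEQ_unique)
  then show "(LINT z|disc_area. ?h z) = of_real (fact ?n * fact s) * dform ?n t a a"
    by (simp only: h_def)
qed

end

section \<open>Monotonicity, limits and comparison of orders\<close>

definition radius_seq :: "nat \<Rightarrow> real"
  where "radius_seq k = 1 - 1 / (real k + 2)"

lemma radius_seq_bounds: "0 < radius_seq k" "radius_seq k < 1" "0 \<le> radius_seq k"
  by (simp_all add: radius_seq_def field_simps)

lemma radius_seq_mono: "k \<le> l \<Longrightarrow> radius_seq k \<le> radius_seq l"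
  by (simp add: radius_seq_def frac_le)

lemma radius_seq_tendsto: "radius_seq \<longlonglongrightarrow> 1"
proof -
  have "(\<lambda>k. 1 - 1 / real (k + 2)) \<longlonglongrightarrow> 1 - 0"
    by (intro tendsto_diff tendsto_const LIMSEQ_ignore_initial_segment lim_1_over_n)
  then show ?thesis by (simp add: radius_seq_def[abs_def] add.commute)
qed

lemma radial_weight_mono: "t \<le> t' \<Longrightarrow> radial_weight t s z \<le> radial_weight t' s z"
  by (auto simp: radial_weight_def intro: power_mono)

definition lshift :: "(nat \<Rightarrow> 'e::chilbert_space) \<Rightarrow> nat \<Rightarrow> 'e"
  where "lshift a j = a (Suc j)"

lemma bounded_seq_lshift: "bounded_seq a \<Longrightarrow> bounded_seq (lshift a)"
  by (auto simp: bounded_seq_def lshift_def)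

lemma l2_lshift: "l2 a \<Longrightarrow> l2 (lshift a)"
  and l2sq_lshift_le: "l2 a \<Longrightarrow> l2sq (lshift a) \<le> l2sq a"
proof -
  assume a: "l2 a"
  show "l2 (lshift a)"
    using a summable_Suc_iff[of "\<lambda>j. (norm (a j))\<^sup>2"] by (simp add: l2_def lshift_def)
  show "l2sq (lshift a) \<le> l2sq a"
    using suminf_split_head[of "\<lambda>j. (norm (a j))\<^sup>2"] a by (simp add: l2_def l2sq_def lshift_def)
qed

context semi_spectral
begin

lemma poisson_form_self_nonneg:
  "cmod z < 1 \<Longrightarrow> 0 \<le> Re (poisson_form z x x)"
  using poisson_integral_nonneg[of z x] by (simp add: poisson_integral poisson_form_def)

lemma density_nonneg: "0 \<le> Re (density n a z)"
  by (simp add: density_def poisson_form_self_nonneg)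

lemma dquad_eq_integral:
  assumes "0 \<le> t" "t < 1" "bounded_seq a"
  shows "integrable disc_area (\<lambda>z. Re (density (Suc s) a z) * radial_weight t s z)"
    and "(LINT z|disc_area. Re (density (Suc s) a z) * radial_weight t s z)
      = fact (Suc s) * fact s * dquad (Suc s) t a"
proof -
  note i = dform_eq_integral[OF assms, of s]
  have eq: "Re (density (Suc s) a z * of_real (radial_weight t s z))
      = Re (density (Suc s) a z) * radial_weight t s z" for z by simp
  show "integrable disc_area (\<lambda>z. Re (density (Suc s) a z) * radial_weight t s z)"
    using integrable_Re[OF i(1)] unfolding eq .
  have "(LINT z|disc_area. Re (density (Suc s) a z) * radial_weight t s z)
      = Re (of_real (fact (Suc s) * fact s) * dform (Suc s) t a a)"
    unfolding i(2)[symmetric] eq[symmetric] by (rule integral_Re[OF i(1)])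
  also have "\<dots> = fact (Suc s) * fact s * dquad (Suc s) t a"
    unfolding dquad_def by (simp only: Re_complex_of_real Im_complex_of_real times_complex.sel)
  finally show "(LINT z|disc_area. Re (density (Suc s) a z) * radial_weight t s z)
      = fact (Suc s) * fact s * dquad (Suc s) t a" .
qed

lemma dquad_Suc_mono:
  assumes t: "0 \<le> t" "t \<le> t'" "t' < 1" and a: "bounded_seq a"
  shows "dquad (Suc s) t a \<le> dquad (Suc s) t' a"
proof -
  have t': "t < 1" "0 \<le> t'" using t by auto
  have "fact (Suc s) * fact s * dquad (Suc s) t a \<le> fact (Suc s) * fact s * dquad (Suc s) t' a"
    unfolding dquad_eq_integral(2)[OF t(1) t'(1) a, symmetric] dquad_eq_integral(2)[OF t'(2) t(3) a, symmetric]
    by (rule integral_mono[OF dquad_eq_integral(1)[OF t(1) t'(1) a] dquad_eq_integral(1)[OF t'(2) t(3) a]])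
      (intro mult_left_mono radial_weight_mono density_nonneg t)
  then show ?thesis by (subst (asm) mult_le_cancel_left_pos) (simp_all del: fact_Suc)
qed

lemma dquad_Suc_nonneg:
  assumes t: "0 \<le> t" "t < 1" and a: "bounded_seq a"
  shows "0 \<le> dquad (Suc s) t a"
proof -
  have "0 \<le> fact (Suc s) * fact s * dquad (Suc s) t a"
    unfolding dquad_eq_integral(2)[OF t a, symmetric]
    by (rule integral_nonneg_AE) (auto intro!: mult_nonneg_nonneg density_nonneg radial_weight_nonneg)
  moreover have "0 < (fact (Suc s) * fact s :: real)" by (intro mult_pos_pos fact_gt_zero)
  ultimately show ?thesis using mult_pos_neg not_le by blast
qed

lemma dquad_sums:
  assumes "0 \<le> t" "t < 1" "bounded_seq a"
  shows "(\<lambda>M. Re (block n M a a) * t ^ M) sums dquad n t a"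
  using sums_Re[OF dform_sums[OF assms assms(3), of n]]
  by (simp add: dquad_def mult.commute flip: of_real_power)

text \<open>The order-zero form is \<open>d/dt\<close> of the order-one form of the antiderivative, and the
  latter is increasing in \<open>t\<close>.\<close>

lemma dquad_0_nonneg:
  assumes t: "0 < t" "t < 1" and a: "bounded_seq a"
  shows "0 \<le> dquad 0 t a"
proof -
  \<comment> \<open>the coefficients of the antiderivative\<close>
  define b where "b j = (case j of 0 \<Rightarrow> 0 | Suc i \<Rightarrow> of_real (1 / real (Suc i)) *\<^sub>C a i)" for j
  have b_simps: "b 0 = 0" "b (Suc i) = of_real (1 / real (Suc i)) *\<^sub>C a i" for i
    by (simp_all add: b_def)
  obtain A where A: "0 \<le> A" "\<And>j. norm (a j) \<le> A" using a by (rule bounded_seqE) blast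
  have "norm (b j) \<le> A" for j
  proof (cases j)
    case (Suc i)
    have "1 / real (Suc i) * norm (a i) \<le> 1 * A" using A by (intro mult_mono) auto
    then show ?thesis using Suc by (simp add: b_simps norm_divide del: of_nat_Suc)
  qed (simp add: b_simps A)
  then have b: "bounded_seq b" unfolding bounded_seq_def by blast
  have blk: "of_nat (Suc M) * block (Suc 0) (Suc M) b b = block 0 M a a" for M
  proof -
    have 1: "of_nat (Suc i choose Suc 0) * moment (Suc i) (Suc M) (b (Suc i)) (b (Suc M))
        = of_real (1 / real (Suc M)) * moment i M (a i) (a M)"
      and 2: "of_nat (Suc i choose Suc 0) * moment (Suc M) (Suc i) (b (Suc M)) (b (Suc i))
        = of_real (1 / real (Suc M)) * moment M i (a M) (a i)" for i
      by (simp_all add: b_simps moment_Suc moment_scale_left moment_scale_right del: of_nat_Suc)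
    have "block (Suc 0) (Suc M) b b = of_real (1 / real (Suc M)) * block 0 M a a"
      unfolding block_def sum.atMost_Suc_shift sum.lessThan_Suc_shift 1 2
      by (simp add: b_simps sum_distrib_left distrib_left of_nat_1[unfolded One_nat_def] del: of_nat_Suc)
    then show ?thesis by (simp del: of_nat_Suc)
  qed
  let ?c = "\<lambda>M. Re (block (Suc 0) M b b)"
  define K where "K = (1 + t) / 2"
  have K: "0 \<le> K" "K < 1" "norm t < norm K" using t by (simp_all add: K_def)
  have "DERIV (\<lambda>x. \<Sum>M. ?c M * x ^ M) t :> (\<Sum>M. diffs ?c M * t ^ M)"
    by (rule termdiffs_strong[OF _ K(3)]) (rule sums_summable[OF dquad_sums[OF K(1,2) b]])
  moreover have "diffs ?c M = Re (block 0 M a a)" for M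
    unfolding blk[symmetric] diffs_def by (simp add: algebra_simps)
  then have "(\<Sum>M. diffs ?c M * t ^ M) = dquad 0 t a"
    using dquad_sums[of t a 0] t a by (simp add: sums_iff)
  ultimately have deriv: "DERIV (\<lambda>x. \<Sum>M. ?c M * x ^ M) t :> dquad 0 t a" by simp
  have "mono_on {0<..<1} (\<lambda>x. \<Sum>M. ?c M * x ^ M)"
  proof (rule mono_onI)
    fix x y :: real assume xy: "x \<in> {0<..<1}" "y \<in> {0<..<1}" "x \<le> y"
    then have "(\<Sum>M. ?c M * u ^ M) = dquad (Suc 0) u b" if "u \<in> {x, y}" for u
      using dquad_sums[of u b "Suc 0"] b that by (auto simp: sums_iff)
    then show "(\<Sum>M. ?c M * x ^ M) \<le> (\<Sum>M. ?c M * y ^ M)"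
      using dquad_Suc_mono[of x y b 0] xy b by simp
  qed
  then show ?thesis
    by (rule mono_on_imp_deriv_nonneg[OF _ deriv]) (use t in \<open>simp add: interior_open\<close>)
qed

lemma dquad_nonneg: "0 < t \<Longrightarrow> t < 1 \<Longrightarrow> bounded_seq a \<Longrightarrow> 0 \<le> dquad n t a"
  using dquad_0_nonneg dquad_Suc_nonneg by (cases n) auto

text \<open>Monotone convergence: the truncated weights increase to \<open>(1 - |z|\<^sup>2)\<^sup>s\<close> on the disc.\<close>

lemma dirichlet_integral_psum:
  assumes a: "bounded_seq a"
  shows "dirichlet_integral \<mu> (Suc s) (psum a) = (SUP k. ennreal (dquad (Suc s) (radius_seq k) a))"
proof -
  let ?n = "Suc s"
  note dc = disc_convergent_bounded_seq[OF a]
  let ?W = "\<lambda>k z. Re (density ?n a z) * radial_weight (radius_seq k) s z"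
  note int = dquad_eq_integral[OF radius_seq_bounds(3,2) a, of s]
  have inc: "incseq (\<lambda>k. ennreal (?W k z))" for z
    by (intro incseq_SucI ennreal_leI mult_left_mono radial_weight_mono radius_seq_mono density_nonneg) simp
  have sup: "(SUP k. ennreal (?W k z)) = ennreal (Re (density ?n a z) * (1 - (cmod z)\<^sup>2) ^ s)"
    if z: "cmod z < 1" for z
  proof (rule LIMSEQ_unique[OF LIMSEQ_SUP[OF inc]])
    have z1: "(cmod z)\<^sup>2 < 1" using z by (simp add: power_less_one_iff abs_square_less_1)
    have "(\<lambda>k. (radius_seq k - (cmod z)\<^sup>2) ^ s) \<longlonglongrightarrow> (1 - (cmod z)\<^sup>2) ^ s"
      by (intro tendsto_power tendsto_diff radius_seq_tendsto tendsto_const)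
    moreover have "\<forall>\<^sub>F k in sequentially. (cmod z)\<^sup>2 < radius_seq k"
      using order_tendstoD(1)[OF radius_seq_tendsto z1] .
    then have "\<forall>\<^sub>F k in sequentially. (radius_seq k - (cmod z)\<^sup>2) ^ s = radial_weight (radius_seq k) s z"
      by eventually_elim (simp add: radial_weight_def)
    ultimately have "(\<lambda>k. radial_weight (radius_seq k) s z) \<longlonglongrightarrow> (1 - (cmod z)\<^sup>2) ^ s"
      by (rule Lim_transform_eventually)
    then show "(\<lambda>k. ennreal (?W k z)) \<longlonglongrightarrow> ennreal (Re (density ?n a z) * (1 - (cmod z)\<^sup>2) ^ s)"
      by (intro tendsto_ennrealI tendsto_mult tendsto_const)
  qed
  have "(\<integral>\<^sup>+ z. ennreal (Re (cinner (poisson_integral \<mu> z ((cderiv ^^ ?n) (psum a) z)) ((cderiv ^^ ?n) (psum a) z))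
      * (1 - (cmod z)\<^sup>2) ^ (?n - 1)) \<partial>disc_area) = (\<integral>\<^sup>+ z. (SUP k. ennreal (?W k z)) \<partial>disc_area)"
  proof (rule nn_integral_cong_AE, rule AE_disc_area)
    fix z :: complex assume z: "cmod z < 1"
    have "cinner (poisson_integral \<mu> z ((cderiv ^^ ?n) (psum a) z)) ((cderiv ^^ ?n) (psum a) z)
        = density ?n a z"
      unfolding cderiv_funpow_psum[OF dc z] poisson_integral(2)[OF z] density_def poisson_form_def
      by (simp only: z if_True)
    then show "ennreal (Re (cinner (poisson_integral \<mu> z ((cderiv ^^ ?n) (psum a) z)) ((cderiv ^^ ?n) (psum a) z))
      * (1 - (cmod z)\<^sup>2) ^ (?n - 1)) = (SUP k. ennreal (?W k z))"
      by (simp only: sup[OF z] diff_Suc_1)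
  qed
  also have "\<dots> = (SUP k. \<integral>\<^sup>+ z. ennreal (?W k z) \<partial>disc_area)"
  proof (rule nn_integral_monotone_convergence_SUP)
    show "incseq (\<lambda>k z. ennreal (?W k z))" using inc by (auto simp: incseq_def le_fun_def)
    show "(\<lambda>z. ennreal (?W k z)) \<in> borel_measurable disc_area" for k
      using borel_measurable_integrable[OF int(1)[of k]] by (rule measurable_compose) simp
  qed
  also have "\<dots> = (SUP k. ennreal (fact ?n * fact s * dquad ?n (radius_seq k) a))"
  proof (rule SUP_cong[OF refl])
    fix k
    show "(\<integral>\<^sup>+ z. ennreal (?W k z) \<partial>disc_area) = ennreal (fact ?n * fact s * dquad ?n (radius_seq k) a)"
      unfolding int(2)[symmetric]
      by (rule nn_integral_eq_integral[OF int(1)])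
        (auto intro!: mult_nonneg_nonneg density_nonneg radial_weight_nonneg)
  qed
  finally have "dirichlet_integral \<mu> ?n (psum a) = ennreal (1 / (fact ?n * fact (?n - 1)))
      * (SUP k. ennreal (fact ?n * fact s * dquad ?n (radius_seq k) a))"
    unfolding dirichlet_integral_def by (simp only:)
  also have "\<dots> = (SUP k. ennreal (1 / (fact ?n * fact (?n - 1))) * ennreal (fact ?n * fact s * dquad ?n (radius_seq k) a))"
    by (rule SUP_mult_left_ennreal)
  also have "\<dots> = (SUP k. ennreal (dquad ?n (radius_seq k) a))"
    by (rule SUP_cong[OF refl], subst ennreal_mult'[symmetric]) (simp_all del: fact_Suc)
  finally show ?thesis .
qed

lemma dquad_plus_scale:
  assumes t: "0 \<le> t" "t < 1" and a: "bounded_seq a" and b: "bounded_seq b"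
  shows "dform n t (a + c *\<^sub>C b) (a + c *\<^sub>C b)
    = dform n t a a + cnj c * dform n t a b + c * dform n t b a + c * cnj c * dform n t b b"
  using assms by (simp add: dform_add_left dform_add_right dform_scale_left dform_scale_right
      bounded_seq_add bounded_seq_scaleC algebra_simps)

text \<open>The parallelogram law, with one of the two nonnegative terms dropped.\<close>

lemma dquad_add_le:
  assumes t: "0 < t" "t < 1" and a: "bounded_seq a" and b: "bounded_seq b"
  shows "dquad n t (a + b) \<le> 2 * dquad n t a + 2 * dquad n t b"
proof -
  have t0: "0 \<le> t" using t by simp
  have "dquad n t (a + 1 *\<^sub>C b) + dquad n t (a + (-1) *\<^sub>C b) = 2 * dquad n t a + 2 * dquad n t b"
    unfolding dquad_def dquad_plus_scale[OF t0 t(2) a b] by simp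
  moreover have "0 \<le> dquad n t (a + (-1) *\<^sub>C b)"
    by (intro dquad_nonneg t bounded_seq_add bounded_seq_scaleC a b)
  ultimately show ?thesis by simp
qed

lemma dquad_scale:
  assumes "0 \<le> t" "t < 1" "bounded_seq a"
  shows "dquad n t (c *\<^sub>C a) = (cmod c)\<^sup>2 * dquad n t a"
proof -
  have "dform n t (c *\<^sub>C a) (c *\<^sub>C a) = (c * cnj c) * dform n t a a"
    using assms by (simp add: dform_scale_left dform_scale_right bounded_seq_scaleC)
  then show ?thesis unfolding dquad_def complex_norm_square[symmetric] by simp
qed

lemma dquad_Suc_lshift:
  assumes "0 \<le> t" "t < 1" "bounded_seq a"
  shows "dquad (Suc n) t a = t * (dquad (Suc n) t (lshift a) + dquad n t (lshift a))"
proof -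
  have "dquad (Suc n) t a = dquad (Suc n) t (rshift (lshift a))"
    by (rule dquad_Suc_cong) (simp add: lshift_def)
  then show ?thesis using dquad_Suc_rshift assms bounded_seq_lshift by metis
qed

text \<open>Only here the constant term matters: it contributes at most a multiple of its squared norm, and
  \<open>D\<^sub>0(t, z g) = t D\<^sub>0(t, g) \<le> D\<^sub>1(t, z g)\<close> controls the rest.\<close>

lemma dquad_le_Suc_0:
  assumes t: "0 < t" "t < 1" and a: "bounded_seq a"
  shows "dquad 0 t a \<le> 8 * mass * (norm (a 0))\<^sup>2 + 2 * dquad (Suc 0) t a"
proof -
  have t0: "0 \<le> t" using t by simp
  define e where "e j = (if j = 0 then a 0 else 0)" for j :: nat
  have e: "bounded_seq e" unfolding bounded_seq_def e_def by (intro exI[of _ "norm (a 0)"]) simp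
  have "block 0 M e e = 0" if "M \<noteq> 0" for M using that by (simp add: block_def e_def)
  then have "(\<lambda>M. of_real (t ^ M) * block 0 M e e) sums (\<Sum>M\<in>{0}. of_real (t ^ M) * block 0 M e e)"
    by (intro sums_finite) auto
  then have "dform 0 t e e = moment 0 0 (a 0) (a 0)"
    by (simp add: dform_def sums_iff block_def e_def)
  then have de: "dquad 0 t e \<le> 4 * mass * (norm (a 0))\<^sup>2"
    using moment_bound[of 0 0 "a 0" "a 0"] complex_Re_le_cmod[of "moment 0 0 (a 0) (a 0)"]
    by (simp add: dquad_def power2_eq_square mult.assoc)
  have split: "a = e + rshift (lshift a)"
  proof
    fix j show "a j = (e + rshift (lshift a)) j" by (cases j) (simp_all add: e_def lshift_def)
  qed
  have "dquad 0 t a \<le> 2 * dquad 0 t e + 2 * dquad 0 t (rshift (lshift a))"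
    by (subst split) (intro dquad_add_le t e bounded_seq_rshift bounded_seq_lshift a)
  also have "dquad 0 t (rshift (lshift a)) = t * dquad 0 t (lshift a)"
    by (rule dquad_0_rshift[OF t0 t(2) bounded_seq_lshift[OF a]])
  also have "\<dots> \<le> dquad (Suc 0) t a"
    unfolding dquad_Suc_lshift[OF t0 t(2) a]
    using t dquad_nonneg[OF t bounded_seq_lshift[OF a], of "Suc 0"] by (simp add: distrib_left)
  finally show ?thesis using de by simp
qed

text \<open>Each order is dominated by the next one and the Hardy norm.  With \<open>L\<close> the backward
  shift, \<open>D\<^sub>n\<^sub>+\<^sub>1 f = t (D\<^sub>n\<^sub>+\<^sub>1 + D\<^sub>n) (L f)\<close> bounds the form of order \<open>n\<close> at \<open>L f\<close>, and the same identity
  one order below expresses the form of order \<open>n\<close> at \<open>f\<close> through \<open>L f\<close>.\<close>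

lemma dquad_le_Suc:
  "\<exists>C\<ge>0. \<forall>t a. 0 < t \<and> t < 1 \<and> l2 a \<longrightarrow> dquad n t a \<le> C * (dquad (Suc n) t a + l2sq a)"
proof (induction n)
  case 0
  have "dquad 0 t a \<le> (8 * mass + 2) * (dquad (Suc 0) t a + l2sq a)" if "0 < t" "t < 1" "l2 a" for t a
  proof -
    note b = bounded_seq_l2[OF \<open>l2 a\<close>]
    have "dquad 0 t a \<le> 8 * mass * (norm (a 0))\<^sup>2 + 2 * dquad (Suc 0) t a"
      by (rule dquad_le_Suc_0[OF that(1,2) b])
    also have "\<dots> \<le> 8 * mass * l2sq a + 2 * dquad (Suc 0) t a"
      using mass_nonneg norm_le_l2sq[OF that(3)] by (intro add_right_mono mult_left_mono) auto
    also have "\<dots> \<le> (8 * mass + 2) * l2sq a + (8 * mass + 2) * dquad (Suc 0) t a"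
      using mass_nonneg l2sq_nonneg[OF that(3)] dquad_nonneg[OF that(1,2) b, of "Suc 0"]
      by (intro add_mono mult_right_mono) auto
    finally show ?thesis by (simp add: algebra_simps)
  qed
  then show ?case using mass_nonneg by (intro exI[of _ "8 * mass + 2"]) simp
next
  case (Suc n)
  then obtain C where C: "C \<ge> 0"
    and le: "\<And>t a. 0 < t \<Longrightarrow> t < 1 \<Longrightarrow> l2 a \<Longrightarrow> dquad n t a \<le> C * (dquad (Suc n) t a + l2sq a)"
    by blast
  have "dquad (Suc n) t a \<le> (1 + C) * (dquad (Suc (Suc n)) t a + l2sq a)" if t: "0 < t" "t < 1" and a: "l2 a" for t a
  proof -
    note b = bounded_seq_l2[OF a] and La = l2_lshift[OF a]
    note bL = bounded_seq_l2[OF La]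
    have t0: "0 \<le> t" using t by simp
    have tL: "t * dquad (Suc n) t (lshift a) \<le> dquad (Suc (Suc n)) t a"
      unfolding dquad_Suc_lshift[OF t0 t(2) b, of "Suc n"]
      using t dquad_nonneg[OF t bL, of "Suc (Suc n)"] by (simp add: distrib_left)
    have "dquad (Suc n) t a = t * (dquad (Suc n) t (lshift a) + dquad n t (lshift a))"
      by (rule dquad_Suc_lshift[OF t0 t(2) b])
    also have "\<dots> \<le> t * (dquad (Suc n) t (lshift a) + C * (dquad (Suc n) t (lshift a) + l2sq (lshift a)))"
      using t by (intro mult_left_mono add_left_mono le La) auto
    also have "\<dots> = (1 + C) * (t * dquad (Suc n) t (lshift a)) + C * (t * l2sq (lshift a))"
      by (simp add: algebra_simps)
    also have "\<dots> \<le> (1 + C) * dquad (Suc (Suc n)) t a + C * (1 * l2sq a)"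
      using C tL t l2sq_lshift_le[OF a] l2sq_nonneg[OF La]
      by (intro add_mono mult_left_mono mult_mono) auto
    also have "\<dots> \<le> (1 + C) * (dquad (Suc (Suc n)) t a + l2sq a)"
      using l2sq_nonneg[OF a] by (simp add: algebra_simps)
    finally show ?thesis .
  qed
  then show ?case using C by (intro exI[of _ "1 + C"]) simp
qed

lemma dquad_le_order:
  assumes "k \<le> n"
  shows "\<exists>C\<ge>0. \<forall>t a. 0 < t \<and> t < 1 \<and> l2 a \<longrightarrow> dquad k t a \<le> C * (dquad n t a + l2sq a)"
  using assms
proof (induction n rule: dec_induct)
  case base
  have "dquad k t a \<le> 1 * (dquad k t a + l2sq a)" if "l2 a" for t a
    using l2sq_nonneg[OF that] by simp
  then show ?case by (intro exI[of _ 1]) auto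
next
  case (step n)
  then obtain C where C: "C \<ge> 0"
    and le: "\<And>t a. 0 < t \<Longrightarrow> t < 1 \<Longrightarrow> l2 a \<Longrightarrow> dquad k t a \<le> C * (dquad n t a + l2sq a)"
    by blast
  obtain C' where C': "C' \<ge> 0"
    and le': "\<And>t a. 0 < t \<Longrightarrow> t < 1 \<Longrightarrow> l2 a \<Longrightarrow> dquad n t a \<le> C' * (dquad (Suc n) t a + l2sq a)"
    using dquad_le_Suc[of n] by blast
  have "dquad k t a \<le> (C * (C' + 1)) * (dquad (Suc n) t a + l2sq a)" if t: "0 < t" "t < 1" and a: "l2 a" for t a
  proof -
    have "dquad k t a \<le> C * (dquad n t a + l2sq a)" by (rule le[OF t a])
    also have "\<dots> \<le> C * (C' * (dquad (Suc n) t a + l2sq a) + (dquad (Suc n) t a + l2sq a))"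
      using le'[OF t a] dquad_nonneg[OF t bounded_seq_l2[OF a], of "Suc n"] C
      by (intro mult_left_mono add_mono) auto
    finally show ?thesis by (simp add: algebra_simps)
  qed
  then show ?case using C C' by (intro exI[of _ "C * (C' + 1)"]) simp
qed

subsection \<open>Sequences of finite order and limits of the forms\<close>

definition finite_order :: "nat \<Rightarrow> (nat \<Rightarrow> 'e) \<Rightarrow> bool"
  where "finite_order n a \<longleftrightarrow> l2 a \<and> (\<exists>B. \<forall>k. dquad n (radius_seq k) a \<le> B)"

text \<open>For \<open>n \<ge> 1\<close> this is \<open>D\<^sub>\<mu>\<^sub>,\<^sub>n(f)\<close>; for \<open>n = 0\<close> it is the limit of the means of \<open>\<langle>P\<^sub>\<mu> f, f\<rangle>\<close> over
  circles.\<close>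

definition dlim :: "nat \<Rightarrow> (nat \<Rightarrow> 'e) \<Rightarrow> real"
  where "dlim n a = lim (\<lambda>k. dquad n (radius_seq k) a)"

lemma finite_order_l2: "finite_order n a \<Longrightarrow> l2 a"
  by (simp add: finite_order_def)

lemma finite_order_mono:
  assumes a: "finite_order n a" and k: "k \<le> n"
  shows "finite_order k a"
proof -
  obtain C where C: "C \<ge> 0"
    and le: "\<And>t a. 0 < t \<Longrightarrow> t < 1 \<Longrightarrow> l2 a \<Longrightarrow> dquad k t a \<le> C * (dquad n t a + l2sq a)"
    using dquad_le_order[OF k] by blast
  obtain B where B: "\<And>i. dquad n (radius_seq i) a \<le> B" using a by (auto simp: finite_order_def)
  have "dquad k (radius_seq i) a \<le> C * (B + l2sq a)" for i
  proof -
    have "dquad k (radius_seq i) a \<le> C * (dquad n (radius_seq i) a + l2sq a)"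
      by (intro le radius_seq_bounds finite_order_l2[OF a])
    also have "\<dots> \<le> C * (B + l2sq a)" using C B by (intro mult_left_mono) auto
    finally show ?thesis .
  qed
  then show ?thesis using a unfolding finite_order_def by blast
qed

lemma finite_order_add:
  assumes "finite_order n a" "finite_order n b"
  shows "finite_order n (a + b)"
proof -
  obtain A B where A: "\<And>i. dquad n (radius_seq i) a \<le> A" and B: "\<And>i. dquad n (radius_seq i) b \<le> B"
    using assms by (auto simp: finite_order_def)
  have ab: "l2 a" "l2 b" using assms finite_order_l2 by auto
  have "dquad n (radius_seq i) (a + b) \<le> 2 * A + 2 * B" for i
    using dquad_add_le[OF radius_seq_bounds(1,2) bounded_seq_l2[OF ab(1)] bounded_seq_l2[OF ab(2)], of n i] A[of i] B[of i]
    by linarith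
  then show ?thesis unfolding finite_order_def using l2_add[OF ab] by blast
qed

lemma finite_order_scale:
  assumes "finite_order n a"
  shows "finite_order n (c *\<^sub>C a)"
proof -
  obtain A where A: "\<And>i. dquad n (radius_seq i) a \<le> A"
    using assms by (auto simp: finite_order_def)
  have a: "l2 a" using assms finite_order_l2 by auto
  have "dquad n (radius_seq i) (c *\<^sub>C a) \<le> (cmod c)\<^sup>2 * A" for i
    unfolding dquad_scale[OF radius_seq_bounds(3,2) bounded_seq_l2[OF a]] by (intro mult_left_mono A) simp
  then show ?thesis unfolding finite_order_def using l2_scaleC[OF a] by blast
qed

lemma finite_order_rshift:
  assumes a: "finite_order (Suc n) a"
  shows "finite_order (Suc n) (rshift a)"
proof -
  note l = finite_order_l2[OF a] and b = bounded_seq_l2[OF finite_order_l2[OF a]]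
  obtain B where B: "\<And>i. dquad (Suc n) (radius_seq i) a \<le> B" using a by (auto simp: finite_order_def)
  obtain B' where B': "\<And>i. dquad n (radius_seq i) a \<le> B'"
    using finite_order_mono[OF a, of n] by (auto simp: finite_order_def)
  have "dquad (Suc n) (radius_seq i) (rshift a) \<le> B + B'" for i
  proof -
    let ?t = "radius_seq i"
    have "dquad (Suc n) ?t (rshift a) = ?t * (dquad (Suc n) ?t a + dquad n ?t a)"
      by (rule dquad_Suc_rshift[OF radius_seq_bounds(3,2) b])
    also have "\<dots> \<le> 1 * (dquad (Suc n) ?t a + dquad n ?t a)"
      using radius_seq_bounds[of i] dquad_nonneg[OF radius_seq_bounds(1,2) b, of _ i]
      by (intro mult_right_mono) auto
    finally show ?thesis using B[of i] B'[of i] by simp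
  qed
  then show ?thesis unfolding finite_order_def using l l2_rshift by blast
qed

lemma dlim_tendsto_Suc:
  assumes a: "finite_order (Suc n) a"
  shows "(\<lambda>i. dquad (Suc n) (radius_seq i) a) \<longlonglongrightarrow> dlim (Suc n) a"
proof -
  note b = bounded_seq_l2[OF finite_order_l2[OF a]]
  obtain B where B: "\<And>i. dquad (Suc n) (radius_seq i) a \<le> B" using a by (auto simp: finite_order_def)
  have "incseq (\<lambda>i. dquad (Suc n) (radius_seq i) a)"
    by (intro incseq_SucI dquad_Suc_mono radius_seq_bounds radius_seq_mono b) simp
  then obtain L where "(\<lambda>i. dquad (Suc n) (radius_seq i) a) \<longlonglongrightarrow> L"
    using B incseq_convergent[of "\<lambda>i. dquad (Suc n) (radius_seq i) a" B] by metis
  then have "convergent (\<lambda>i. dquad (Suc n) (radius_seq i) a)" by (rule convergentI)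
  then show ?thesis unfolding dlim_def by (simp add: convergent_LIMSEQ_iff)
qed

text \<open>Positive orders converge by monotonicity; for order zero convergence comes from
  \<open>D\<^sub>0(t, f) = D\<^sub>1(t, zf) / t - D\<^sub>1(t, f)\<close>.\<close>

lemma dlim_tendsto:
  assumes a: "finite_order (Suc n) a" and k: "k \<le> Suc n"
  shows "(\<lambda>i. dquad k (radius_seq i) a) \<longlonglongrightarrow> dlim k a"
proof (cases k)
  case 0
  note b = bounded_seq_l2[OF finite_order_l2[OF a]]
  have a1: "finite_order (Suc 0) a" by (rule finite_order_mono[OF a]) simp
  have "(\<lambda>i. dquad (Suc 0) (radius_seq i) (rshift a) / radius_seq i - dquad (Suc 0) (radius_seq i) a)
      \<longlonglongrightarrow> dlim (Suc 0) (rshift a) / 1 - dlim (Suc 0) a"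
    by (intro tendsto_diff tendsto_divide dlim_tendsto_Suc a1 finite_order_rshift radius_seq_tendsto) simp
  moreover have "dquad (Suc 0) (radius_seq i) (rshift a) / radius_seq i - dquad (Suc 0) (radius_seq i) a
      = dquad 0 (radius_seq i) a" for i
    unfolding dquad_Suc_rshift[OF radius_seq_bounds(3,2) b] using radius_seq_bounds(1)[of i] by simp
  ultimately have "convergent (\<lambda>i. dquad 0 (radius_seq i) a)" by (auto simp: convergent_def)
  then show ?thesis unfolding dlim_def 0 by (simp add: convergent_LIMSEQ_iff)
next
  case (Suc l)
  then show ?thesis using dlim_tendsto_Suc finite_order_mono[OF a k] by simp
qed

lemma dlim_0_rshift:
  assumes a: "finite_order (Suc n) a"
  shows "dlim 0 (rshift a) = dlim 0 a"
proof (rule LIMSEQ_unique)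
  note b = bounded_seq_l2[OF finite_order_l2[OF a]]
  show "(\<lambda>i. dquad 0 (radius_seq i) (rshift a)) \<longlonglongrightarrow> dlim 0 (rshift a)"
    by (rule dlim_tendsto[OF finite_order_rshift[OF a]]) simp
  have "(\<lambda>i. radius_seq i * dquad 0 (radius_seq i) a) \<longlonglongrightarrow> 1 * dlim 0 a"
    by (intro tendsto_mult radius_seq_tendsto dlim_tendsto[OF a]) simp
  then show "(\<lambda>i. dquad 0 (radius_seq i) (rshift a)) \<longlonglongrightarrow> dlim 0 a"
    by (simp add: dquad_0_rshift[OF radius_seq_bounds(3,2) b])
qed

lemma dlim_Suc_rshift:
  assumes a: "finite_order (Suc n) a" and k: "k \<le> n"
  shows "dlim (Suc k) (rshift a) = dlim (Suc k) a + dlim k a"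
proof (rule LIMSEQ_unique)
  note b = bounded_seq_l2[OF finite_order_l2[OF a]]
  show "(\<lambda>i. dquad (Suc k) (radius_seq i) (rshift a)) \<longlonglongrightarrow> dlim (Suc k) (rshift a)"
    by (rule dlim_tendsto[OF finite_order_rshift[OF a]]) (use k in simp)
  have "(\<lambda>i. radius_seq i * (dquad (Suc k) (radius_seq i) a + dquad k (radius_seq i) a))
      \<longlonglongrightarrow> 1 * (dlim (Suc k) a + dlim k a)"
    by (intro tendsto_mult tendsto_add radius_seq_tendsto dlim_tendsto[OF a]) (use k in auto)
  then show "(\<lambda>i. dquad (Suc k) (radius_seq i) (rshift a)) \<longlonglongrightarrow> dlim (Suc k) a + dlim k a"
    by (simp add: dquad_Suc_rshift[OF radius_seq_bounds(3,2) b])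
qed

end

lemma binomial_difference_Suc:
  fixes f :: "nat \<Rightarrow> real"
  shows "(\<Sum>j\<le>Suc m. real (Suc m choose j) * (-1) ^ (Suc m - j) * f j)
    = (\<Sum>j\<le>m. real (m choose j) * (-1) ^ (m - j) * (f (Suc j) - f j))"
proof -
  let ?g = "\<lambda>j. real (m choose j) * (-1) ^ (Suc m - j) * f j"
  have "(\<Sum>j\<le>Suc m. real (Suc m choose j) * (-1) ^ (Suc m - j) * f j)
      = ?g 0 + (\<Sum>j\<le>m. real (m choose j) * (-1) ^ (m - j) * f (Suc j) + ?g (Suc j))"
    unfolding sum.atMost_Suc_shift by (simp add: distrib_right)
  also have "\<dots> = (\<Sum>j\<le>m. real (m choose j) * (-1) ^ (m - j) * f (Suc j)) + (\<Sum>j\<le>Suc m. ?g j)"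
    unfolding sum.distrib sum.atMost_Suc_shift[of ?g] by simp
  also have "(\<Sum>j\<le>Suc m. ?g j) = (\<Sum>j\<le>m. - (real (m choose j) * (-1) ^ (m - j) * f j))"
    by (simp add: Suc_diff_le)
  finally show ?thesis by (simp add: right_diff_distrib sum_subtractf sum_negf)
qed

text \<open>If \<open>u k\<close> has first difference \<open>u (k - 1)\<close> and \<open>u 0\<close> is constant then \<open>u k\<close> is a polynomial
  of degree at most \<open>k\<close>, so its differences of higher order vanish.\<close>

lemma higher_difference_eq_0:
  fixes u :: "nat \<Rightarrow> nat \<Rightarrow> real"
  assumes u0: "\<And>s. u 0 (Suc s) = u 0 s"
    and uS: "\<And>k s. k < n \<Longrightarrow> u (Suc k) (Suc s) = u (Suc k) s + u k s"
    and "k \<le> n" "k < m"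
  shows "(\<Sum>j\<le>m. real (m choose j) * (-1) ^ (m - j) * u k j) = 0"
  using assms(3,4)
proof (induction k arbitrary: m)
  case 0
  then obtain m' where "m = Suc m'" by (cases m) auto
  then show ?case by (simp only: binomial_difference_Suc) (simp add: u0)
next
  case (Suc k)
  then obtain m' where m: "m = Suc m'" "k < m'" by (cases m) auto
  have "(\<Sum>j\<le>m. real (m choose j) * (-1) ^ (m - j) * u (Suc k) j)
      = (\<Sum>j\<le>m'. real (m' choose j) * (-1) ^ (m' - j) * u k j)"
    unfolding m(1) binomial_difference_Suc using Suc.prems by (simp add: uS)
  also have "\<dots> = 0" using Suc m by simp
  finally show ?case .
qed

context semi_spectral
begin

lemma finite_order_rshift_funpow: "finite_order (Suc n) a \<Longrightarrow> finite_order (Suc n) ((rshift ^^ j) a)"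
  by (induction j) (simp_all add: finite_order_rshift)

lemma dlim_difference_eq_0:
  assumes a: "finite_order (Suc n) a" and m: "Suc n < m"
  shows "(\<Sum>j\<le>m. real (m choose j) * (-1) ^ (m - j) * dlim (Suc n) ((rshift ^^ j) a)) = 0"
proof (rule higher_difference_eq_0[where u = "\<lambda>k j. dlim k ((rshift ^^ j) a)" and n = "Suc n"])
  show "dlim 0 ((rshift ^^ Suc s) a) = dlim 0 ((rshift ^^ s) a)" for s
    using dlim_0_rshift[OF finite_order_rshift_funpow[OF a]] by simp
  show "dlim (Suc k) ((rshift ^^ Suc s) a) = dlim (Suc k) ((rshift ^^ s) a) + dlim k ((rshift ^^ s) a)"
    if "k < Suc n" for k s
    using dlim_Suc_rshift[OF finite_order_rshift_funpow[OF a], of k] that by simp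
qed (use m in auto)

lemma dirichlet_integral_finite_iff:
  assumes a: "l2 a"
  shows "dirichlet_integral \<mu> (Suc n) (psum a) < \<infinity> \<longleftrightarrow> finite_order (Suc n) a"
    and "finite_order (Suc n) a \<Longrightarrow> enn2real (dirichlet_integral \<mu> (Suc n) (psum a)) = dlim (Suc n) a"
proof -
  note b = bounded_seq_l2[OF a]
  let ?d = "\<lambda>i. dquad (Suc n) (radius_seq i) a"
  have nn: "0 \<le> ?d i" for i by (intro dquad_nonneg radius_seq_bounds b)
  have inc: "incseq (\<lambda>i. ennreal (?d i))"
    by (intro incseq_SucI ennreal_leI dquad_Suc_mono radius_seq_bounds radius_seq_mono b) simp
  have eq: "dirichlet_integral \<mu> (Suc n) (psum a) = ennreal (dlim (Suc n) a)" if "finite_order (Suc n) a"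
    unfolding dirichlet_integral_psum[OF b]
    by (rule LIMSEQ_unique[OF LIMSEQ_SUP[OF inc]]) (intro tendsto_ennrealI dlim_tendsto_Suc that)
  have lim_nn: "0 \<le> dlim (Suc n) a" if "finite_order (Suc n) a"
    by (rule LIMSEQ_le_const[OF dlim_tendsto_Suc[OF that]]) (use nn in blast)
  show "enn2real (dirichlet_integral \<mu> (Suc n) (psum a)) = dlim (Suc n) a" if "finite_order (Suc n) a"
    using eq[OF that] lim_nn[OF that] by simp
  show "dirichlet_integral \<mu> (Suc n) (psum a) < \<infinity> \<longleftrightarrow> finite_order (Suc n) a"
  proof
    assume "dirichlet_integral \<mu> (Suc n) (psum a) < \<infinity>"
    then obtain B where B: "dirichlet_integral \<mu> (Suc n) (psum a) = ennreal B" "0 \<le> B"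
      by (cases "dirichlet_integral \<mu> (Suc n) (psum a)") auto
    have "ennreal (?d i) \<le> ennreal B" for i
      unfolding B(1)[symmetric] dirichlet_integral_psum[OF b] by (rule SUP_upper) simp
    then have "?d i \<le> B" for i using B(2) by simp
    then show "finite_order (Suc n) a" using a unfolding finite_order_def by blast
  qed (simp add: eq)
qed

end

section \<open>The inner product of square summable sequences\<close>

definition l2ip :: "(nat \<Rightarrow> 'e::chilbert_space) \<Rightarrow> (nat \<Rightarrow> 'e) \<Rightarrow> complex"
  where "l2ip a b = (\<Sum>j. cinner (a j) (b j))"

lemma l2ip_sums:
  assumes "l2 a" "l2 b"
  shows "(\<lambda>j. cinner (a j) (b j)) sums l2ip a b"
  unfolding l2ip_def
proof (rule summable_sums, rule summable_comparison_test'[where N = 0])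
  show "summable (\<lambda>j. (norm (a j))\<^sup>2 + (norm (b j))\<^sup>2)"
    using assms by (intro summable_add) (simp_all add: l2_def)
  show "norm (cinner (a j) (b j)) \<le> (norm (a j))\<^sup>2 + (norm (b j))\<^sup>2" for j
  proof -
    have "norm (a j) * norm (b j) \<le> (norm (a j))\<^sup>2 + (norm (b j))\<^sup>2"
    proof -
      have "2 * (norm (a j) * norm (b j)) \<le> (norm (a j))\<^sup>2 + (norm (b j))\<^sup>2"
        using zero_le_power2[of "norm (a j) - norm (b j)"] by (simp add: power2_diff)
      moreover have "0 \<le> norm (a j) * norm (b j)" by simp
      ultimately show ?thesis by linarith
    qed
    then show ?thesis using cmod_cinner_le order_trans by blast
  qed
qed

lemma l2ip_add_left: "l2 a \<Longrightarrow> l2 a' \<Longrightarrow> l2 b \<Longrightarrow> l2ip (a + a') b = l2ip a b + l2ip a' b"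
  using sums_add[OF l2ip_sums[of a b] l2ip_sums[of a' b]]
  by (simp add: l2ip_def[of "a + a'"] sums_iff cinner_add_left)

lemma l2ip_scale_left: "l2 a \<Longrightarrow> l2 b \<Longrightarrow> l2ip (c *\<^sub>C a) b = c * l2ip a b"
  using sums_mult[OF l2ip_sums[of a b], of c]
  by (simp add: l2ip_def[of "c *\<^sub>C a"] sums_iff fun_scaleC_apply cinner_scaleC_left)

lemma cnj_l2ip: "l2 a \<Longrightarrow> l2 b \<Longrightarrow> cnj (l2ip a b) = l2ip b a"
  using sums_cnj[THEN iffD2, OF l2ip_sums[of a b]]
  by (simp add: l2ip_def[of b a] sums_iff cnj_cinner)

lemma l2ip_self: "l2 a \<Longrightarrow> l2ip a a = of_real (l2sq a)"
proof -
  assume "l2 a"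
  then have "(\<lambda>j. complex_of_real ((norm (a j))\<^sup>2)) sums of_real (l2sq a)"
    unfolding sums_of_real_iff by (simp add: l2_def l2sq_def summable_sums)
  then show ?thesis by (simp add: l2ip_def cinner_self_real sums_iff)
qed

lemma fun_diff_eq_plus_scaleC: "a - b = a + (-1) *\<^sub>C (b :: 'v::complex_vector)"
  by (simp add: scaleC_minus_left)

lemma l2_diff: "l2 a \<Longrightarrow> l2 b \<Longrightarrow> l2 (a - b)"
  unfolding fun_diff_eq_plus_scaleC by (intro l2_add l2_scaleC)

lemma l2_zero: "l2 (0 :: nat \<Rightarrow> 'e::chilbert_space)"
  by (simp add: l2_def)

text \<open>The Cauchy estimate itself passes to the limit; the second conclusion keeps it in this form for the
  full norm of the space.\<close>

lemma l2_complete: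
  fixes c :: "nat \<Rightarrow> nat \<Rightarrow> 'e::chilbert_space"
  assumes c: "\<And>n. l2 (c n)"
    and cauchy: "\<And>e. e > 0 \<Longrightarrow> \<exists>N. \<forall>k\<ge>N. \<forall>l\<ge>N. l2sq (c k - c l) < e"
  obtains a where "l2 a"
    "\<And>e N k. \<forall>k\<ge>N. \<forall>l\<ge>N. l2sq (c k - c l) < e \<Longrightarrow> k \<ge> N \<Longrightarrow> l2sq (c k - a) \<le> e"
proof -
  have "Cauchy (\<lambda>n. c n j)" for j
  proof (rule metric_CauchyI)
    fix e :: real assume e: "e > 0"
    then obtain N where N: "\<And>k l. k \<ge> N \<Longrightarrow> l \<ge> N \<Longrightarrow> l2sq (c k - c l) < e\<^sup>2"
      using cauchy[of "e\<^sup>2"] by auto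
    have "dist (c k j) (c l j) < e" if "k \<ge> N" "l \<ge> N" for k l
    proof (rule power2_less_imp_less)
      have "(norm ((c k - c l) j))\<^sup>2 \<le> l2sq (c k - c l)" by (intro norm_le_l2sq l2_diff c)
      then show "(dist (c k j) (c l j))\<^sup>2 < e\<^sup>2" using N[OF that] by (simp add: dist_norm)
    qed (use e in simp)
    then show "\<exists>M. \<forall>k\<ge>M. \<forall>l\<ge>M. dist (c k j) (c l j) < e" by blast
  qed
  then have "\<exists>x. (\<lambda>n. c n j) \<longlonglongrightarrow> x" for j
    using Cauchy_convergent convergent_def by blast
  then obtain a where a: "\<And>j. (\<lambda>n. c n j) \<longlonglongrightarrow> a j" by metis
  have partial: "(\<Sum>j<J. (norm ((c k - a) j))\<^sup>2) \<le> e"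
    if N: "\<forall>k\<ge>N. \<forall>l\<ge>N. l2sq (c k - c l) < e" and k: "k \<ge> N" for e N k J
  proof (rule LIMSEQ_le_const2)
    show "(\<lambda>l. \<Sum>j<J. (norm ((c k - c l) j))\<^sup>2) \<longlonglongrightarrow> (\<Sum>j<J. (norm ((c k - a) j))\<^sup>2)"
      unfolding fun_diff_def by (intro tendsto_sum tendsto_power tendsto_norm tendsto_diff tendsto_const a)
    have "(\<Sum>j<J. (norm ((c k - c l) j))\<^sup>2) \<le> e" if l: "l \<ge> N" for l
    proof -
      have "(\<Sum>j<J. (norm ((c k - c l) j))\<^sup>2) \<le> l2sq (c k - c l)"
        unfolding l2sq_def using l2_diff[OF c c, of k l] by (intro sum_le_suminf) (auto simp: l2_def)
      then show ?thesis using N k l by fastforce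
    qed
    then show "\<exists>N. \<forall>l\<ge>N. (\<Sum>j<J. (norm ((c k - c l) j))\<^sup>2) \<le> e" by blast
  qed
  have l2d: "l2 (c k - a)" if "\<forall>k\<ge>N. \<forall>l\<ge>N. l2sq (c k - c l) < e" "k \<ge> N" for e N k
    unfolding l2_def by (rule summableI_nonneg_bounded[where x = e]) (use partial[OF that] in auto)
  obtain N where N: "\<forall>k\<ge>N. \<forall>l\<ge>N. l2sq (c k - c l) < 1" using cauchy[of 1] by auto
  have "l2 (c N - (c N - a))" by (intro l2_diff c l2d[OF N]) simp
  then have "l2 a" by simp
  moreover have "l2sq (c k - a) \<le> e" if "\<forall>k\<ge>N. \<forall>l\<ge>N. l2sq (c k - c l) < e" "k \<ge> N" for e N k
    unfolding l2sq_def
    by (rule suminf_le_const) (use partial[OF that] l2d[OF that] in \<open>auto simp: l2_def\<close>)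
  ultimately show ?thesis by (rule that)
qed

context semi_spectral
begin

lemma dquad_le_l2sq:
  assumes t: "0 \<le> t" "t < 1"
  obtains K where "K \<ge> 0" "\<And>a. l2 a \<Longrightarrow> dquad n t a \<le> K * l2sq a"
proof
  let ?S = "\<Sum>M. real (Suc M) ^ Suc n * t ^ M"
  note S = summable_poly_power[OF t, of "Suc n"]
  have "0 \<le> ?S" using t by (intro suminf_nonneg S) auto
  then show "0 \<le> 8 * mass * ?S" using mass_nonneg by simp
  fix a :: "nat \<Rightarrow> 'e" assume a: "l2 a"
  note b = bounded_seq_l2[OF a]
  have "dquad n t a \<le> cmod (dform n t a a)" unfolding dquad_def by (rule complex_Re_le_cmod)
  also have "\<dots> \<le> (\<Sum>M. cmod (of_real (t ^ M) * block n M a a))"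
    unfolding dform_def by (rule summable_norm[OF dform_summable_norm[OF t b b]])
  also have "\<dots> \<le> (\<Sum>M. 8 * mass * l2sq a * (real (Suc M) ^ Suc n * t ^ M))"
  proof (rule suminf_le[OF _ dform_summable_norm[OF t b b] summable_mult[OF S]])
    fix M
    have "cmod (block n M a a) \<le> 8 * mass * sqrt (l2sq a) * sqrt (l2sq a) * real (Suc M) ^ Suc n"
      by (intro block_bound norm_le_sqrt_l2sq a)
    also have "\<dots> = 8 * mass * l2sq a * real (Suc M) ^ Suc n"
      using l2sq_nonneg[OF a] by (simp add: mult.assoc)
    finally have "t ^ M * cmod (block n M a a) \<le> t ^ M * (8 * mass * l2sq a * real (Suc M) ^ Suc n)"
      using t by (intro mult_left_mono) auto
    then show "cmod (of_real (t ^ M) * block n M a a) \<le> 8 * mass * l2sq a * (real (Suc M) ^ Suc n * t ^ M)"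
      using t by (simp add: norm_mult norm_power mult_ac)
  qed
  also have "\<dots> = 8 * mass * l2sq a * ?S" by (rule suminf_mult[OF S])
  finally show "dquad n t a \<le> 8 * mass * ?S * l2sq a" by (simp add: mult_ac)
qed

lemma dquad_le_dlim:
  assumes a: "finite_order (Suc n) a"
  shows "dquad (Suc n) (radius_seq i) a \<le> dlim (Suc n) a"
proof -
  note b = bounded_seq_l2[OF finite_order_l2[OF a]]
  have "incseq (\<lambda>i. dquad (Suc n) (radius_seq i) a)"
    by (intro incseq_SucI dquad_Suc_mono radius_seq_bounds radius_seq_mono b) simp
  then show ?thesis using dlim_tendsto_Suc[OF a] by (rule incseq_le)
qed

lemma dlim_nonneg:
  assumes a: "finite_order (Suc n) a" and k: "k \<le> Suc n"
  shows "0 \<le> dlim k a"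
  by (rule LIMSEQ_le_const[OF dlim_tendsto[OF a k]])
    (use dquad_nonneg[OF radius_seq_bounds(1,2) bounded_seq_l2[OF finite_order_l2[OF a]]] in blast)

lemma dlim_le_Suc:
  obtains C where "C \<ge> 0"
    "\<And>a. finite_order (Suc n) a \<Longrightarrow> dlim n a \<le> C * (dlim (Suc n) a + l2sq a)"
proof -
  obtain C where C: "C \<ge> 0"
    and le: "\<And>t a. 0 < t \<Longrightarrow> t < 1 \<Longrightarrow> l2 a \<Longrightarrow> dquad n t a \<le> C * (dquad (Suc n) t a + l2sq a)"
    using dquad_le_Suc[of n] by blast
  have "dlim n a \<le> C * (dlim (Suc n) a + l2sq a)" if a: "finite_order (Suc n) a" for a
  proof (rule LIMSEQ_le)
    show "(\<lambda>i. dquad n (radius_seq i) a) \<longlonglongrightarrow> dlim n a" by (rule dlim_tendsto[OF a]) simp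
    show "(\<lambda>i. C * (dquad (Suc n) (radius_seq i) a + l2sq a)) \<longlonglongrightarrow> C * (dlim (Suc n) a + l2sq a)"
      by (intro tendsto_mult tendsto_add tendsto_const dlim_tendsto_Suc a)
    show "\<exists>N. \<forall>i\<ge>N. dquad n (radius_seq i) a \<le> C * (dquad (Suc n) (radius_seq i) a + l2sq a)"
      using le[OF radius_seq_bounds(1,2) finite_order_l2[OF a]] by blast
  qed
  with C that show ?thesis by blast
qed

text \<open>Completeness of the Dirichlet seminorm relative to convergence of coefficients.  For
  fixed \<open>t < 1\<close> the form is continuous on square summable sequences, so a bound on the
  differences \<open>c k - c l\<close> survives the limit in \<open>l\<close>, uniformly in \<open>t\<close>.\<close>

lemma dlim_limit:
  assumes c: "\<And>n. finite_order (Suc s) (c n)" and a: "l2 a"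
    and conv: "(\<lambda>n. l2sq (c n - a)) \<longlonglongrightarrow> 0"
    and N: "\<And>l. l \<ge> N \<Longrightarrow> dlim (Suc s) (c k - c l) \<le> e"
  shows "finite_order (Suc s) (c k - a)" "dlim (Suc s) (c k - a) \<le> 2 * e"
proof -
  have fo: "finite_order (Suc s) (c k - c l)" for l
    unfolding fun_diff_eq_plus_scaleC by (intro finite_order_add finite_order_scale c)
  have l2c: "l2 (c n)" for n by (rule finite_order_l2[OF c])
  have le: "dquad (Suc s) (radius_seq i) (c k - a) \<le> 2 * e" for i
  proof -
    obtain K where K: "K \<ge> 0" "\<And>a. l2 a \<Longrightarrow> dquad (Suc s) (radius_seq i) a \<le> K * l2sq a"
      using dquad_le_l2sq[OF radius_seq_bounds(3,2)] by blast
    have "dquad (Suc s) (radius_seq i) (c k - a) \<le> 2 * e + 2 * (K * l2sq (c l - a))" if l: "l \<ge> N" for l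
    proof -
      have "c k - a = (c k - c l) + (c l - a)" by simp
      then have "dquad (Suc s) (radius_seq i) (c k - a)
          \<le> 2 * dquad (Suc s) (radius_seq i) (c k - c l) + 2 * dquad (Suc s) (radius_seq i) (c l - a)"
        using dquad_add_le[OF radius_seq_bounds(1,2), of "c k - c l" "c l - a" "Suc s" i]
          bounded_seq_l2[OF l2_diff[OF l2c l2c]] bounded_seq_l2[OF l2_diff[OF l2c a]] by metis
      also have "dquad (Suc s) (radius_seq i) (c k - c l) \<le> e"
        using dquad_le_dlim[OF fo] N[OF l] order_trans by blast
      also have "dquad (Suc s) (radius_seq i) (c l - a) \<le> K * l2sq (c l - a)"
        by (intro K l2_diff l2c a)
      finally show ?thesis by simp
    qed
    moreover have "(\<lambda>l. 2 * e + 2 * (K * l2sq (c l - a))) \<longlonglongrightarrow> 2 * e + 2 * (K * 0)"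
      by (intro tendsto_add tendsto_mult tendsto_const conv)
    ultimately have "dquad (Suc s) (radius_seq i) (c k - a) \<le> 2 * e + 2 * (K * 0)"
      by (intro LIMSEQ_le_const[of _ "2 * e + 2 * (K * 0)"]) auto
    then show ?thesis by simp
  qed
  show fo': "finite_order (Suc s) (c k - a)"
    unfolding finite_order_def using le l2_diff[OF l2c a] by blast
  show "dlim (Suc s) (c k - a) \<le> 2 * e"
    by (rule LIMSEQ_le_const2[OF dlim_tendsto_Suc[OF fo']]) (use le in blast)
qed

end

lemma quadratic_polarization:
  fixes Q :: "complex \<Rightarrow> complex"
  assumes "\<And>c. Q c = p + cnj c * q + c * r + c * cnj c * s"
  shows "(\<Sum>k<4. \<i> ^ k * Q (\<i> ^ k)) / 4 = q"
  unfolding sum_lessThan_4 assms by (simp add: i_power3 algebra_simps)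

section \<open>The space of the tuple of measures\<close>

locale semi_spectral_tuple =
  fixes m :: nat and \<mu> :: "nat \<Rightarrow> complex set \<Rightarrow> 'e::chilbert_space \<Rightarrow> 'e"
  assumes semi_spectral_\<mu>: "s < m - 1 \<Longrightarrow> semi_spectral (\<mu> (Suc s))"
begin

text \<open>The tuple is indexed by the orders \<open>s + 1\<close> with \<open>s < m - 1\<close>.\<close>

abbreviation "fin s \<equiv> semi_spectral.finite_order (\<mu> (Suc s)) (Suc s)"
abbreviation "dl s \<equiv> semi_spectral.dlim (\<mu> (Suc s)) (Suc s)"

text \<open>Membership in the space and the squared norm, in terms of Taylor coefficients
  (see \<open>hmu_space_eq\<close> and \<open>hmu_norm_sq_psum\<close>).\<close>

definition admissible :: "(nat \<Rightarrow> 'e) \<Rightarrow> bool"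
  where "admissible a \<longleftrightarrow> l2 a \<and> (\<forall>s<m - 1. fin s a)"

definition energy :: "(nat \<Rightarrow> 'e) \<Rightarrow> real"
  where "energy a = l2sq a + (\<Sum>s<m - 1. dl s a)"

lemma admissible_l2: "admissible a \<Longrightarrow> l2 a"
  by (simp add: admissible_def)

lemma admissible_disc_convergent: "admissible a \<Longrightarrow> disc_convergent a"
  by (intro disc_convergent_l2 admissible_l2)

lemma admissible_add: "admissible a \<Longrightarrow> admissible b \<Longrightarrow> admissible (a + b)"
  using semi_spectral.finite_order_add[OF semi_spectral_\<mu>] l2_add by (auto simp: admissible_def)

lemma admissible_scale: "admissible a \<Longrightarrow> admissible (c *\<^sub>C a)"
  using semi_spectral.finite_order_scale[OF semi_spectral_\<mu>] l2_scaleC by (auto simp: admissible_def)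

lemma admissible_diff: "admissible a \<Longrightarrow> admissible b \<Longrightarrow> admissible (a - b)"
  unfolding fun_diff_eq_plus_scaleC by (intro admissible_add admissible_scale)

lemma admissible_zero: "admissible 0"
proof -
  have "fin s 0" if "s < m - 1" for s
  proof -
    interpret semi_spectral "\<mu> (Suc s)" by (rule semi_spectral_\<mu>[OF that])
    have "dquad (Suc s) t 0 = 0" for t by (simp add: dquad_def dform_def block_def)
    then show ?thesis unfolding finite_order_def using l2_zero by auto
  qed
  then show ?thesis by (simp add: admissible_def l2_zero)
qed

lemma admissible_rshift: "admissible a \<Longrightarrow> admissible (rshift a)"
  using semi_spectral.finite_order_rshift[OF semi_spectral_\<mu>] l2_rshift by (auto simp: admissible_def)

lemma admissible_rshift_funpow: "admissible a \<Longrightarrow> admissible ((rshift ^^ j) a)"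
  by (induction j) (simp_all add: admissible_rshift)

lemma dl_nonneg: "admissible a \<Longrightarrow> s < m - 1 \<Longrightarrow> 0 \<le> dl s a"
  using semi_spectral.dlim_nonneg[OF semi_spectral_\<mu>, of s s a "Suc s"] by (simp add: admissible_def)

lemma l2sq_le_energy: "admissible a \<Longrightarrow> l2sq a \<le> energy a"
  unfolding energy_def using sum_nonneg[of "{..<m - 1}" "\<lambda>s. dl s a"] dl_nonneg by force

lemma dl_le_energy:
  assumes a: "admissible a" and s: "s < m - 1"
  shows "dl s a \<le> energy a"
proof -
  have "dl s a \<le> (\<Sum>s<m - 1. dl s a)"
    using s dl_nonneg[OF a] by (intro member_le_sum) auto
  then show ?thesis unfolding energy_def using l2sq_nonneg[OF admissible_l2[OF a]] by simp
qed

lemma energy_nonneg: "admissible a \<Longrightarrow> 0 \<le> energy a"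
  using l2sq_le_energy l2sq_nonneg admissible_l2 order_trans by blast

lemma energy_eq_0:
  assumes "admissible a" "energy a = 0"
  shows "a = 0"
proof
  fix j
  have "(norm (a j))\<^sup>2 \<le> 0"
    using norm_le_l2sq[OF admissible_l2[OF assms(1)], of j] l2sq_le_energy[OF assms(1)] assms(2) by linarith
  then show "a j = 0 j" by simp
qed

lemma hmu_space_eq: "hmu_space m \<mu> = psum ` {a. admissible a}"
proof -
  have *: "psum a \<in> (\<Inter>j\<in>{1..m-1}. dirichlet_space (\<mu> j) j) \<longleftrightarrow> (\<forall>s<m - 1. fin s a)" if a: "l2 a" for a
  proof -
    have "psum a \<in> (\<Inter>j\<in>{1..m-1}. dirichlet_space (\<mu> j) j)
        \<longleftrightarrow> (\<forall>s<m - 1. psum a \<in> dirichlet_space (\<mu> (Suc s)) (Suc s))"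
    proof -
      have "{1..m-1} = Suc ` {..<m - 1}" by (simp add: image_Suc_lessThan)
      then show ?thesis by auto
    qed
    then show ?thesis
      using semi_spectral.dirichlet_integral_finite_iff(1)[OF semi_spectral_\<mu> a]
        psum_holomorphic[OF disc_convergent_l2[OF a]]
      by (simp add: dirichlet_space_def)
  qed
  show ?thesis
    unfolding hmu_space_def hardy_space_eq using * by (auto simp: admissible_def)
qed

lemma hmu_norm_sq_psum:
  assumes a: "admissible a"
  shows "hmu_norm_sq m \<mu> (psum a) = energy a"
proof -
  have "(\<Sum>j=1..m-1. enn2real (dirichlet_integral (\<mu> j) j (psum a)))
      = (\<Sum>s<m - 1. enn2real (dirichlet_integral (\<mu> (Suc s)) (Suc s) (psum a)))"
    by (simp add: sum.atLeast1_atMost_eq)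
  also have "\<dots> = (\<Sum>s<m - 1. dl s a)"
    using semi_spectral.dirichlet_integral_finite_iff(2)[OF semi_spectral_\<mu>] a
    by (intro sum.cong) (auto simp: admissible_def)
  finally show ?thesis
    unfolding hmu_norm_sq_def energy_def by (simp add: hardy_norm_sq_psum[OF admissible_l2[OF a]])
qed

lemma psum_combination:
  "admissible a \<Longrightarrow> admissible b \<Longrightarrow> psum a + c *\<^sub>C psum b = psum (a + c *\<^sub>C b)"
  by (simp add: psum_add psum_scaleC admissible_disc_convergent admissible_scale)

lemma hmu_inner_psum:
  assumes "admissible a" "admissible b"
  shows "hmu_inner m \<mu> (psum a) (psum b) = (\<Sum>k<4. \<i> ^ k * of_real (energy (a + \<i> ^ k *\<^sub>C b))) / 4"
  unfolding hmu_inner_def psum_combination[OF assms]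
  by (simp add: hmu_norm_sq_psum assms admissible_add admissible_scale)

text \<open>Polarisation of the norm is a sesquilinear form because it is the limit of the
  sesquilinear forms \<open>truncated i\<close>, in which the weights are supported in a smaller disc.\<close>

definition truncated :: "nat \<Rightarrow> (nat \<Rightarrow> 'e) \<Rightarrow> (nat \<Rightarrow> 'e) \<Rightarrow> complex"
  where "truncated i a b = l2ip a b + (\<Sum>s<m - 1. semi_spectral.dform (\<mu> (Suc s)) (Suc s) (radius_seq i) a b)"

lemma truncated_add_left:
  assumes "admissible a" "admissible a'" "admissible b"
  shows "truncated i (a + a') b = truncated i a b + truncated i a' b"
  using assms semi_spectral.dform_add_left[OF semi_spectral_\<mu> radius_seq_bounds(3,2)]
  by (simp add: truncated_def l2ip_add_left admissible_l2 bounded_seq_l2 sum.distrib)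

lemma truncated_scale_left:
  assumes "admissible a" "admissible b"
  shows "truncated i (c *\<^sub>C a) b = c * truncated i a b"
  using assms semi_spectral.dform_scale_left[OF semi_spectral_\<mu> radius_seq_bounds(3,2)]
  by (simp add: truncated_def l2ip_scale_left admissible_l2 bounded_seq_l2 sum_distrib_left distrib_left)

lemma cnj_truncated:
  assumes "admissible a" "admissible b"
  shows "cnj (truncated i a b) = truncated i b a"
  using assms semi_spectral.cnj_dform[OF semi_spectral_\<mu> radius_seq_bounds(3,2)]
  by (simp add: truncated_def cnj_l2ip admissible_l2 bounded_seq_l2)

lemma truncated_add_right:
  assumes "admissible a" "admissible b" "admissible b'"
  shows "truncated i a (b + b') = truncated i a b + truncated i a b'"
  using truncated_add_left[OF assms(2,3,1), of i] assms
  by (metis admissible_add cnj_truncated complex_cnj_add)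

lemma truncated_scale_right:
  assumes "admissible a" "admissible b"
  shows "truncated i a (c *\<^sub>C b) = cnj c * truncated i a b"
  using truncated_scale_left[OF assms(2,1), of i c] assms
  by (metis admissible_scale cnj_truncated complex_cnj_mult)

lemma truncated_self_tendsto:
  assumes a: "admissible a"
  shows "(\<lambda>i. truncated i a a) \<longlonglongrightarrow> of_real (energy a)"
proof -
  have eq: "truncated i a a = of_real (l2sq a + (\<Sum>s<m - 1. semi_spectral.dquad (\<mu> (Suc s)) (Suc s) (radius_seq i) a))" for i
    using semi_spectral.dform_self[OF semi_spectral_\<mu> radius_seq_bounds(3,2)] a
    by (simp add: truncated_def l2ip_self admissible_l2 bounded_seq_l2)
  show ?thesis
    unfolding eq energy_def
    using semi_spectral.dlim_tendsto_Suc[OF semi_spectral_\<mu>] a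
    by (intro tendsto_of_real tendsto_add tendsto_const tendsto_sum) (auto simp: admissible_def)
qed

lemma truncated_tendsto:
  assumes a: "admissible a" and b: "admissible b"
  shows "(\<lambda>i. truncated i a b) \<longlonglongrightarrow> hmu_inner m \<mu> (psum a) (psum b)"
proof -
  have "(\<Sum>k<4. \<i> ^ k * truncated i (a + \<i> ^ k *\<^sub>C b) (a + \<i> ^ k *\<^sub>C b)) / 4 = truncated i a b" for i
  proof (rule quadratic_polarization)
    show "truncated i (a + c *\<^sub>C b) (a + c *\<^sub>C b) = truncated i a a + cnj c * truncated i a b
        + c * truncated i b a + c * cnj c * truncated i b b" for c
      using a b by (simp add: truncated_add_left truncated_add_right truncated_scale_left
          truncated_scale_right admissible_add admissible_scale algebra_simps)
  qed
  moreover have "(\<lambda>i. (\<Sum>k<4. \<i> ^ k * truncated i (a + \<i> ^ k *\<^sub>C b) (a + \<i> ^ k *\<^sub>C b)) / 4)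
      \<longlonglongrightarrow> hmu_inner m \<mu> (psum a) (psum b)"
    unfolding hmu_inner_psum[OF a b]
    by (intro tendsto_divide tendsto_sum tendsto_mult tendsto_const truncated_self_tendsto
        admissible_add admissible_scale a b) simp
  ultimately show ?thesis by simp
qed

lemma hmu_inner_self:
  assumes "admissible a"
  shows "hmu_inner m \<mu> (psum a) (psum a) = of_real (energy a)"
  by (rule LIMSEQ_unique[OF truncated_tendsto truncated_self_tendsto]) (rule assms)+

lemma ip_norm_hmu:
  assumes "admissible a"
  shows "ip_norm (hmu_inner m \<mu>) (psum a) = sqrt (energy a)"
  by (simp add: ip_norm_def hmu_inner_self[OF assms])

lemma psum_zero: "psum (0 :: nat \<Rightarrow> 'e) = 0"
  by (rule ext) (simp add: psum_def pseries_def)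

lemma psum_diff: "admissible a \<Longrightarrow> admissible b \<Longrightarrow> psum a - psum b = psum (a - b)"
  unfolding fun_diff_eq_plus_scaleC by (rule psum_combination)

text \<open>A Cauchy sequence converges in the Hardy norm.  By \<open>dlim_limit\<close> the limit is admissible and
  is approached in each of the Dirichlet seminorms.\<close>

lemma hmu_complete:
  assumes X: "\<And>n. X n \<in> hmu_space m \<mu>"
    and cauchy: "\<And>e. e > 0 \<Longrightarrow> \<exists>N. \<forall>k\<ge>N. \<forall>l\<ge>N. ip_norm (hmu_inner m \<mu>) (X k - X l) < e"
  shows "\<exists>L\<in>hmu_space m \<mu>. (\<lambda>n. ip_norm (hmu_inner m \<mu>) (X n - L)) \<longlonglongrightarrow> 0"
proof -
  have "\<exists>a. admissible a \<and> X n = psum a" for n using X[of n] by (auto simp: hmu_space_eq)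
  then obtain c where c: "\<And>n. admissible (c n)" and Xc: "\<And>n. X n = psum (c n)" by metis
  have energy_cauchy: "\<exists>N. \<forall>k\<ge>N. \<forall>l\<ge>N. energy (c k - c l) < e" if e: "e > 0" for e
  proof -
    obtain N where N: "\<And>k l. k \<ge> N \<Longrightarrow> l \<ge> N \<Longrightarrow> ip_norm (hmu_inner m \<mu>) (X k - X l) < sqrt e"
      using cauchy[of "sqrt e"] e by auto
    have "energy (c k - c l) < e" if "k \<ge> N" "l \<ge> N" for k l
      using N[OF that] by (simp add: Xc psum_diff c ip_norm_hmu admissible_diff)
    then show ?thesis by blast
  qed
  have "\<exists>N. \<forall>k\<ge>N. \<forall>l\<ge>N. l2sq (c k - c l) < e" if "e > 0" for e
    using energy_cauchy[OF that] l2sq_le_energy[OF admissible_diff[OF c c]] le_less_trans by meson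
  then obtain a where a: "l2 a"
    and lim: "\<And>e N k. \<forall>k\<ge>N. \<forall>l\<ge>N. l2sq (c k - c l) < e \<Longrightarrow> k \<ge> N \<Longrightarrow> l2sq (c k - a) \<le> e"
    using l2_complete[of c] admissible_l2[OF c] by blast
  have key: "l2sq (c k - a) \<le> e \<and> (\<forall>s<m - 1. fin s (c k - a) \<and> dl s (c k - a) \<le> 2 * e)"
    if conv: "(\<lambda>n. l2sq (c n - a)) \<longlonglongrightarrow> 0"
      and N: "\<forall>k\<ge>N. \<forall>l\<ge>N. energy (c k - c l) < e" and k: "k \<ge> N" for e N k
  proof (intro conjI allI impI)
    have "\<forall>k\<ge>N. \<forall>l\<ge>N. l2sq (c k - c l) < e"
      using N l2sq_le_energy[OF admissible_diff[OF c c]] le_less_trans by meson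
    then show "l2sq (c k - a) \<le> e" using k by (rule lim)
    fix s assume s: "s < m - 1"
    interpret semi_spectral "\<mu> (Suc s)" by (rule semi_spectral_\<mu>[OF s])
    have fc: "fin s (c n)" for n using c s by (simp add: admissible_def)
    have e: "dl s (c k - c l) \<le> e" if "l \<ge> N" for l
      using dl_le_energy[OF admissible_diff[OF c c] s, of k l] N k that by fastforce
    show "fin s (c k - a)" "dl s (c k - a) \<le> 2 * e"
      by (rule dlim_limit[OF fc a conv e], assumption)+
  qed
  have conv: "(\<lambda>n. l2sq (c n - a)) \<longlonglongrightarrow> 0"
  proof (rule LIMSEQ_I)
    fix r :: real assume r: "r > 0"
    obtain N where N: "\<forall>k\<ge>N. \<forall>l\<ge>N. energy (c k - c l) < r / 2" using energy_cauchy[of "r / 2"] r by auto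
    have "\<forall>k\<ge>N. \<forall>l\<ge>N. l2sq (c k - c l) < r / 2"
      using N l2sq_le_energy[OF admissible_diff[OF c c]] le_less_trans by meson
    then have "norm (l2sq (c n - a) - 0) < r" if "n \<ge> N" for n
      using lim[of N "r / 2" n] that r l2sq_nonneg[OF l2_diff[OF admissible_l2[OF c] a], of n] by simp
    then show "\<exists>N. \<forall>n\<ge>N. norm (l2sq (c n - a) - 0) < r" by blast
  qed
  obtain N1 where N1: "\<forall>k\<ge>N1. \<forall>l\<ge>N1. energy (c k - c l) < 1" using energy_cauchy[of 1] by auto
  have "admissible (c N1 - a)"
    using key[OF conv N1] l2_diff[OF admissible_l2[OF c] a] by (simp add: admissible_def)
  then have "admissible (c N1 - (c N1 - a))" by (rule admissible_diff[OF c])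
  then have adm: "admissible a" by simp
  have "(\<lambda>n. energy (c n - a)) \<longlonglongrightarrow> 0"
  proof (rule LIMSEQ_I)
    fix r :: real assume r: "r > 0"
    define e where "e = r / (2 * real m + 2)"
    have e: "e > 0" using r by (simp add: e_def add_pos_pos zero_less_divide_iff)
    obtain N where N: "\<forall>k\<ge>N. \<forall>l\<ge>N. energy (c k - c l) < e" using energy_cauchy[OF e] by auto
    have "norm (energy (c n - a) - 0) < r" if n: "n \<ge> N" for n
    proof -
      note K = key[OF conv N n]
      have "energy (c n - a) \<le> e + (\<Sum>s<m - 1. 2 * e)"
        unfolding energy_def using K by (intro add_mono sum_mono) auto
      also have "\<dots> = (1 + 2 * real (m - 1)) * e" by (simp add: algebra_simps)
      also have "\<dots> < (2 * real m + 2) * e" using e by (intro mult_strict_right_mono) auto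
      also have "\<dots> = r" by (simp add: e_def add_nonneg_eq_0_iff)
      finally show ?thesis using energy_nonneg[OF admissible_diff[OF c adm], of n] by simp
    qed
    then show "\<exists>N. \<forall>n\<ge>N. norm (energy (c n - a) - 0) < r" by blast
  qed
  then have "(\<lambda>n. sqrt (energy (c n - a))) \<longlonglongrightarrow> 0"
    using tendsto_real_sqrt[of _ 0] by force
  then have "(\<lambda>n. ip_norm (hmu_inner m \<mu>) (X n - psum a)) \<longlonglongrightarrow> 0"
    by (simp add: Xc psum_diff c adm ip_norm_hmu admissible_diff)
  moreover have "psum a \<in> hmu_space m \<mu>" using adm by (auto simp: hmu_space_eq)
  ultimately show ?thesis by blast
qed

proposition complex_hilbert_space_hmu: "complex_hilbert_space (hmu_space m \<mu>) (hmu_inner m \<mu>)"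
proof
  let ?H = "hmu_space m \<mu>"
  have H: "f \<in> ?H \<Longrightarrow> \<exists>a. admissible a \<and> f = psum a" for f by (auto simp: hmu_space_eq)
  have HI: "admissible a \<Longrightarrow> psum a \<in> ?H" for a by (auto simp: hmu_space_eq)
  show "0 \<in> ?H" using HI[OF admissible_zero] by (simp add: psum_zero)
  fix f g assume "f \<in> ?H" "g \<in> ?H"
  then obtain a b where a: "admissible a" "f = psum a" and b: "admissible b" "g = psum b" using H by meson
  show "f + g \<in> ?H"
    using HI[OF admissible_add[OF a(1) b(1)]] a b by (simp add: psum_add admissible_disc_convergent)
  show "hmu_inner m \<mu> f g = cnj (hmu_inner m \<mu> g f)"
  proof (rule LIMSEQ_unique[OF truncated_tendsto[OF a(1) b(1), folded a(2) b(2)]])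
    have "(\<lambda>i. cnj (truncated i b a)) \<longlonglongrightarrow> cnj (hmu_inner m \<mu> g f)"
      unfolding a(2) b(2) by (intro tendsto_cnj truncated_tendsto a b)
    then show "(\<lambda>i. truncated i a b) \<longlonglongrightarrow> cnj (hmu_inner m \<mu> g f)"
      by (simp add: cnj_truncated a b)
  qed
  show "hmu_inner m \<mu> (f + h) g = hmu_inner m \<mu> f g + hmu_inner m \<mu> h g" if "h \<in> ?H" for h
  proof -
    obtain d where d: "admissible d" "h = psum d" using H \<open>h \<in> ?H\<close> by meson
    have fh: "f + h = psum (a + d)" using a d by (simp add: psum_add admissible_disc_convergent)
    show ?thesis
      unfolding fh
    proof (rule LIMSEQ_unique[OF truncated_tendsto[OF admissible_add[OF a(1) d(1)] b(1), folded b(2)]])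
      show "(\<lambda>i. truncated i (a + d) b) \<longlonglongrightarrow> hmu_inner m \<mu> f g + hmu_inner m \<mu> h g"
        unfolding truncated_add_left[OF a(1) d(1) b(1)] a(2) b(2) d(2)
        by (intro tendsto_add truncated_tendsto a b d)
    qed
  qed
  show "hmu_inner m \<mu> (c *\<^sub>C f) g = c * hmu_inner m \<mu> f g" for c
  proof -
    have cf: "c *\<^sub>C f = psum (c *\<^sub>C a)" using a by (simp add: psum_scaleC admissible_disc_convergent)
    show ?thesis
      unfolding cf
    proof (rule LIMSEQ_unique[OF truncated_tendsto[OF admissible_scale[OF a(1)] b(1), folded b(2)]])
      show "(\<lambda>i. truncated i (c *\<^sub>C a) b) \<longlonglongrightarrow> c * hmu_inner m \<mu> f g"
        unfolding truncated_scale_left[OF a(1) b(1)] a(2) b(2)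
        by (intro tendsto_mult tendsto_const truncated_tendsto a b)
    qed
  qed
next
  let ?H = "hmu_space m \<mu>"
  fix f assume "f \<in> ?H"
  then obtain a where a: "admissible a" "f = psum a" by (auto simp: hmu_space_eq)
  show "c *\<^sub>C f \<in> ?H" for c
    using admissible_scale[OF a(1), of c] a by (auto simp: hmu_space_eq psum_scaleC admissible_disc_convergent intro!: image_eqI)
  show "0 \<le> Re (hmu_inner m \<mu> f f)" using a energy_nonneg by (simp add: hmu_inner_self)
  show "f = 0" if "hmu_inner m \<mu> f f = 0"
    using that a energy_eq_0[OF a(1)] by (simp add: hmu_inner_self psum_zero)
next
  fix X :: "nat \<Rightarrow> complex \<Rightarrow> 'e" assume "\<forall>n. X n \<in> hmu_space m \<mu>"
    "\<forall>e>0. \<exists>N. \<forall>k\<ge>N. \<forall>l\<ge>N. ip_norm (hmu_inner m \<mu>) (X k - X l) < e"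
  then show "\<exists>L\<in>hmu_space m \<mu>. (\<lambda>n. ip_norm (hmu_inner m \<mu>) (X n - L)) \<longlonglongrightarrow> 0"
    by (intro hmu_complete) auto
qed

text \<open>\<open>D\<^sub>n(zf) = D\<^sub>n(f) + D\<^sub>n\<^sub>-\<^sub>1(f)\<close>, and lower orders are dominated by higher ones and the Hardy norm.\<close>

lemma energy_rshift_le: "\<exists>K. \<forall>a. admissible a \<longrightarrow> energy (rshift a) \<le> K * energy a"
proof -
  have "\<exists>C\<ge>0. \<forall>a. fin s a \<longrightarrow> semi_spectral.dlim (\<mu> (Suc s)) s a \<le> C * (dl s a + l2sq a)" if "s < m - 1" for s
    using semi_spectral.dlim_le_Suc[OF semi_spectral_\<mu>[OF that], of s] by metis
  then obtain C where C: "\<And>s. s < m - 1 \<Longrightarrow> 0 \<le> C s"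
    and le: "\<And>s a. s < m - 1 \<Longrightarrow> fin s a \<Longrightarrow> semi_spectral.dlim (\<mu> (Suc s)) s a \<le> C s * (dl s a + l2sq a)"
    by metis
  have "energy (rshift a) \<le> (1 + (\<Sum>s<m - 1. C s * 2)) * energy a" if a: "admissible a" for a
  proof -
    have "dl s (rshift a) \<le> dl s a + C s * 2 * energy a" if s: "s < m - 1" for s
    proof -
      have fs: "fin s a" using a s by (simp add: admissible_def)
      have "dl s (rshift a) = dl s a + semi_spectral.dlim (\<mu> (Suc s)) s a"
        by (rule semi_spectral.dlim_Suc_rshift[OF semi_spectral_\<mu>[OF s] fs]) simp
      also have "\<dots> \<le> dl s a + C s * (dl s a + l2sq a)" using le[OF s fs] by simp
      also have "\<dots> \<le> dl s a + C s * (energy a + energy a)"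
        using dl_le_energy[OF a s] l2sq_le_energy[OF a] C[OF s]
        by (intro add_left_mono mult_left_mono add_mono) auto
      finally show ?thesis by simp
    qed
    then have "energy (rshift a) \<le> l2sq a + (\<Sum>s<m - 1. dl s a + C s * 2 * energy a)"
      unfolding energy_def[of "rshift a"] l2sq_rshift[OF admissible_l2[OF a]]
      by (intro add_left_mono sum_mono) simp
    also have "\<dots> = energy a + (\<Sum>s<m - 1. C s * 2) * energy a"
      by (simp add: energy_def[of a] sum.distrib sum_distrib_right)
    finally show ?thesis by (simp add: distrib_right)
  qed
  then show ?thesis by blast
qed

proposition bounded_mult_z: "bounded_operator (hmu_space m \<mu>) (hmu_inner m \<mu>) mult_z"
proof -
  obtain K where K: "\<And>a. admissible a \<Longrightarrow> energy (rshift a) \<le> K * energy a"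
    using energy_rshift_le by blast
  have "mult_z f \<in> hmu_space m \<mu>" if "f \<in> hmu_space m \<mu>" for f
    using that by (auto simp: hmu_space_eq mult_z_psum admissible_disc_convergent intro: admissible_rshift)
  moreover have "mult_z (f + g) = mult_z f + mult_z g" for f g :: "complex \<Rightarrow> 'e"
    by (rule ext) (simp add: mult_z_def scaleC_add_right)
  moreover have "mult_z (c *\<^sub>C f) = c *\<^sub>C mult_z f" for c and f :: "complex \<Rightarrow> 'e"
    by (rule ext) (simp add: mult_z_def scaleC_fun_def scaleC_scaleC mult.commute)
  moreover have "ip_norm (hmu_inner m \<mu>) (mult_z f) \<le> sqrt K * ip_norm (hmu_inner m \<mu>) f"
    if f: "f \<in> hmu_space m \<mu>" for f
  proof -
    obtain a where a: "admissible a" "f = psum a" using f by (auto simp: hmu_space_eq)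
    have "sqrt (energy (rshift a)) \<le> sqrt (K * energy a)" by (intro real_sqrt_le_mono K a)
    then show ?thesis
      by (simp add: a mult_z_psum admissible_disc_convergent ip_norm_hmu admissible_rshift real_sqrt_mult)
  qed
  ultimately show ?thesis unfolding bounded_operator_def by blast
qed

lemma mult_z_funpow_psum: "admissible a \<Longrightarrow> (mult_z ^^ j) (psum a) = psum ((rshift ^^ j) a)"
  by (induction j) (simp_all add: mult_z_psum admissible_disc_convergent admissible_rshift_funpow)

lemma rshift_funpow_below: "j < n \<Longrightarrow> (rshift ^^ n) a j = 0"
proof (induction n arbitrary: j)
  case (Suc n)
  then show ?case by (cases j) auto
qed simp

proposition analytic_mult_z: "analytic_operator (hmu_space m \<mu>) mult_z"
  unfolding analytic_operator_def
proof (intro equalityI subsetI)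
  fix f assume f: "f \<in> (\<Inter>n. (mult_z ^^ n) ` hmu_space m \<mu>)"
  then have "f \<in> (mult_z ^^ 0) ` hmu_space m \<mu>" by blast
  then obtain a where a: "admissible a" "f = psum a" by (auto simp: hmu_space_eq)
  have "a j = 0" for j
  proof -
    have "f \<in> (mult_z ^^ Suc j) ` hmu_space m \<mu>" using f by blast
    then obtain b where b: "admissible b" "f = (mult_z ^^ Suc j) (psum b)" by (auto simp: hmu_space_eq)
    then have "psum a = psum ((rshift ^^ Suc j) b)" using a mult_z_funpow_psum[OF b(1), of "Suc j"] by simp
    then have "a = (rshift ^^ Suc j) b"
      by (intro psum_inject admissible_disc_convergent a admissible_rshift_funpow b)
    then show ?thesis using rshift_funpow_below[of j "Suc j" b] by simp
  qed
  then have "a = 0" by (simp add: fun_eq_iff)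
  then show "f \<in> {0}" by (simp add: a psum_zero)
next
  fix f :: "complex \<Rightarrow> 'e" assume "f \<in> {0}"
  moreover have "(mult_z ^^ n) 0 = (0 :: complex \<Rightarrow> 'e)" for n
    by (induction n) (simp_all add: mult_z_def fun_eq_iff)
  moreover have "0 \<in> hmu_space m \<mu>"
    by (rule complex_hilbert_space.zero_mem[OF complex_hilbert_space_hmu])
  ultimately show "f \<in> (\<Inter>n. (mult_z ^^ n) ` hmu_space m \<mu>)" by (force intro: image_eqI[where x = 0])
qed

text \<open>The Hardy part is constant along powers of the shift, and each Dirichlet part is a polynomial
  of degree less than \<open>m\<close> in the exponent.\<close>

lemma energy_difference_eq_0:
  assumes a: "admissible a" and m: "m \<ge> 2"
  shows "(\<Sum>j\<le>m. real (m choose j) * (-1) ^ (m - j) * energy ((rshift ^^ j) a)) = 0"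
proof -
  let ?c = "\<lambda>j. real (m choose j) * (-1) ^ (m - j)"
  have "l2sq ((rshift ^^ Suc s) a) = l2sq ((rshift ^^ s) a)" for s
    by (simp add: l2sq_rshift admissible_l2[OF admissible_rshift_funpow[OF a]])
  then have l: "(\<Sum>j\<le>m. ?c j * l2sq ((rshift ^^ j) a)) = 0"
    using m by (intro higher_difference_eq_0[where u = "\<lambda>k j. l2sq ((rshift ^^ j) a)" and k = 0 and n = 0]) auto
  have d: "(\<Sum>j\<le>m. ?c j * dl s ((rshift ^^ j) a)) = 0" if s: "s < m - 1" for s
    using a s by (intro semi_spectral.dlim_difference_eq_0[OF semi_spectral_\<mu>[OF s]]) (auto simp: admissible_def)
  have "(\<Sum>j\<le>m. ?c j * energy ((rshift ^^ j) a))
      = (\<Sum>j\<le>m. ?c j * l2sq ((rshift ^^ j) a)) + (\<Sum>j\<le>m. \<Sum>s<m - 1. ?c j * dl s ((rshift ^^ j) a))"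
    by (simp add: energy_def distrib_left sum.distrib sum_distrib_left)
  also have "(\<Sum>j\<le>m. \<Sum>s<m - 1. ?c j * dl s ((rshift ^^ j) a)) = (\<Sum>s<m - 1. \<Sum>j\<le>m. ?c j * dl s ((rshift ^^ j) a))"
    by (rule sum.swap)
  finally show ?thesis using l d by simp
qed

lemma rshift_funpow_combination:
  fixes a b :: "nat \<Rightarrow> 'e"
  shows "(rshift ^^ j) (a + c *\<^sub>C b) = (rshift ^^ j) a + c *\<^sub>C (rshift ^^ j) b"
proof (induction j)
  case (Suc j)
  have *: "rshift (u + c *\<^sub>C v) = rshift u + c *\<^sub>C rshift v" for u v :: "nat \<Rightarrow> 'e"
  proof
    fix i show "rshift (u + c *\<^sub>C v) i = (rshift u + c *\<^sub>C rshift v) i"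
      by (cases i) (simp_all add: fun_scaleC_apply)
  qed
  show ?case unfolding funpow.simps comp_apply Suc.IH by (rule *)
qed simp

proposition m_isometry_mult_z:
  assumes m: "m \<ge> 2"
  shows "m_isometry (hmu_space m \<mu>) (hmu_inner m \<mu>) m mult_z"
proof (rule complex_hilbert_space.m_isometryI[OF complex_hilbert_space_hmu bounded_mult_z])
  fix f g assume "f \<in> hmu_space m \<mu>" "g \<in> hmu_space m \<mu>"
  then obtain a b where a: "admissible a" "f = psum a" and b: "admissible b" "g = psum b"
    by (auto simp: hmu_space_eq)
  let ?c = "\<lambda>j. real (m choose j) * (-1) ^ (m - j)"
  have ip: "hmu_inner m \<mu> ((mult_z ^^ j) f) ((mult_z ^^ j) g)
      = (\<Sum>k<4. \<i> ^ k * of_real (energy ((rshift ^^ j) (a + \<i> ^ k *\<^sub>C b)))) / 4" for j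
    using a b by (simp add: mult_z_funpow_psum hmu_inner_psum admissible_rshift_funpow rshift_funpow_combination)
  have "(\<Sum>j\<le>m. (of_nat (m choose j) * (-1) ^ (m - j)) * hmu_inner m \<mu> ((mult_z ^^ j) f) ((mult_z ^^ j) g))
      = (\<Sum>j\<le>m. \<Sum>k<4. \<i> ^ k / 4 * of_real (?c j * energy ((rshift ^^ j) (a + \<i> ^ k *\<^sub>C b))))"
    unfolding ip by (intro sum.cong refl) (simp add: sum_distrib_left sum_divide_distrib mult_ac)
  also have "\<dots> = (\<Sum>k<4. \<i> ^ k / 4 * of_real (\<Sum>j\<le>m. ?c j * energy ((rshift ^^ j) (a + \<i> ^ k *\<^sub>C b))))"
    by (subst sum.swap) (simp only: sum_distrib_left of_real_sum)
  also have "\<dots> = 0"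
    using energy_difference_eq_0[OF admissible_add[OF a(1) admissible_scale[OF b(1)]] m] by simp
  finally show "(\<Sum>j\<le>m. (of_nat (m choose j) * (-1) ^ (m - j))
      * hmu_inner m \<mu> ((mult_z ^^ j) f) ((mult_z ^^ j) g)) = 0" .
qed

end

theorem theorem4p1:
  fixes \<mu> :: "nat \<Rightarrow> complex set \<Rightarrow> 'e::chilbert_space \<Rightarrow> 'e"
    and m :: nat
  assumes "separable_space (euclidean :: 'e topology)"
    and "m \<ge> 2"
    and "\<And>j. j \<in> {1..m-1} \<Longrightarrow> semi_spectral_measure (\<mu> j)"
  shows "bounded_operator (hmu_space m \<mu>) (hmu_inner m \<mu>) mult_z \<and>
    analytic_operator (hmu_space m \<mu>) mult_z \<and>
    m_isometry (hmu_space m \<mu>) (hmu_inner m \<mu>) m mult_z"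
proof -
  interpret semi_spectral_tuple m \<mu>
    by unfold_locales (use assms(3) in auto)
  show ?thesis using bounded_mult_z analytic_mult_z m_isometry_mult_z[OF assms(2)] by blast
qed

end
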